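(* Let $k$ be an algebraically closed field of characteristic $p>2$ and let $d\geq 1$ with $p\mid d$. Then the Schur superalgebra $S(1|1,d)$ is isomorphic (as an algebra) to the algebra $\tilde{\mathcal{A}}_d$, and $S(1|1,d)$ has finite representation type.
   Context: $S(1|1,d)=\operatorname{End}_{k\Sigma_d}(V^{\otimes d})$ where $V$ has an even basis vector $v_1$ and an odd basis vector $v_2$, and $\Sigma_d$ acts on the right on $V^{\otimes d}$ by place permutations with sign: $(\dots\otimes v_{i_j}\otimes v_{i_{j+1}}\otimes\dots)\cdot(j\ j{+}1)=(-1)^{\bar v_{i_j}\bar v_{i_{j+1}}}(\dots\otimes v_{i_{j+1}}\otimes v_{i_j}\otimes\dots)$. For $m\ge1$, $\tilde{\mathcal{A}}_m=k\mathcal{Q}/\mathcal{I}$ where $\mathcal{Q}$ is the quiver with vertices $0,1,\dots,m$ and arrows $\alpha_i:i-1\to i$, $\beta_i:i\to i-1$ for $1\le i\le m$, and $\mathcal{I}$ is the ideal generated by $\alpha_i\alpha_{i+1}=0$, $\beta_{i+1}\beta_i=0$, $\alpha_1\beta_1=0$, $\beta_m\alpha_m=0$, and $\beta_i\alpha_i=\alpha_{i+1}\beta_{i+1}$ for $1\le i\le m-1$ (paths written left to right). *)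

theory Defs
  imports "HOL-Computational_Algebra.Polynomial"
begin

record ('a, 'b) kalg =
  acarrier :: "'b set"
  aadd :: "'b \<Rightarrow> 'b \<Rightarrow> 'b"
  azero :: "'b"
  asmul :: "'a \<Rightarrow> 'b \<Rightarrow> 'b"
  amul :: "'b \<Rightarrow> 'b \<Rightarrow> 'b"
  aone :: "'b"

definition alg_iso :: "('a, 'b) kalg \<Rightarrow> ('a, 'c) kalg \<Rightarrow> bool" where
  "alg_iso A B \<longleftrightarrow> (\<exists>f. bij_betw f (acarrier A) (acarrier B)
     \<and> (\<forall>x\<in>acarrier A. \<forall>y\<in>acarrier A. f (aadd A x y) = aadd B (f x) (f y))
     \<and> (\<forall>c. \<forall>x\<in>acarrier A. f (asmul A c x) = asmul B c (f x))
     \<and> (\<forall>x\<in>acarrier A. \<forall>y\<in>acarrier A. f (amul A x y) = amul B (f x) (f y))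
     \<and> f (aone A) = aone B)"

text \<open>n x n matrices are functions nat => nat => 'a, vectors are functions nat => 'a;
  only entries with indices < n matter.\<close>

definition mat_mult :: "nat \<Rightarrow> (nat \<Rightarrow> nat \<Rightarrow> 'a::field) \<Rightarrow> (nat \<Rightarrow> nat \<Rightarrow> 'a) \<Rightarrow> nat \<Rightarrow> nat \<Rightarrow> 'a" where
  "mat_mult n X Y = (\<lambda>i j. if i < n \<and> j < n then (\<Sum>l<n. X i l * Y l j) else 0)"

definition mat_id :: "nat \<Rightarrow> nat \<Rightarrow> nat \<Rightarrow> 'a::field" where
  "mat_id n = (\<lambda>i j. if i < n \<and> j < n \<and> i = j then 1 else 0)"

definition is_mat :: "nat \<Rightarrow> (nat \<Rightarrow> nat \<Rightarrow> 'a::zero) \<Rightarrow> bool" where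
  "is_mat n X \<longleftrightarrow> (\<forall>i j. (n \<le> i \<or> n \<le> j) \<longrightarrow> X i j = 0)"

definition mat_vec :: "nat \<Rightarrow> (nat \<Rightarrow> nat \<Rightarrow> 'a::field) \<Rightarrow> (nat \<Rightarrow> 'a) \<Rightarrow> nat \<Rightarrow> 'a" where
  "mat_vec n X x = (\<lambda>i. if i < n then (\<Sum>l<n. X i l * x l) else 0)"

definition kvec :: "nat \<Rightarrow> (nat \<Rightarrow> 'a::zero) set" where
  "kvec n = {x. \<forall>i\<ge>n. x i = 0}"

definition is_rep :: "('a::field, 'b) kalg \<Rightarrow> nat \<Rightarrow> ('b \<Rightarrow> nat \<Rightarrow> nat \<Rightarrow> 'a) \<Rightarrow> bool" where
  "is_rep A n \<rho> \<longleftrightarrow>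
     (\<forall>x\<in>acarrier A. is_mat n (\<rho> x))
     \<and> (\<forall>x\<in>acarrier A. \<forall>y\<in>acarrier A. \<rho> (aadd A x y) = (\<lambda>i j. \<rho> x i j + \<rho> y i j))
     \<and> (\<forall>c. \<forall>x\<in>acarrier A. \<rho> (asmul A c x) = (\<lambda>i j. c * \<rho> x i j))
     \<and> (\<forall>x\<in>acarrier A. \<forall>y\<in>acarrier A. \<rho> (amul A x y) = mat_mult n (\<rho> x) (\<rho> y))
     \<and> \<rho> (aone A) = mat_id n"

definition subspace_of :: "nat \<Rightarrow> (nat \<Rightarrow> 'a::field) set \<Rightarrow> bool" where
  "subspace_of n U \<longleftrightarrow> U \<subseteq> kvec n \<and> (\<lambda>_. 0) \<in> U
     \<and> (\<forall>x\<in>U. \<forall>y\<in>U. (\<lambda>i. x i + y i) \<in> U) \<and> (\<forall>c. \<forall>x\<in>U. (\<lambda>i. c * x i) \<in> U)"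

definition submodule :: "('a::field, 'b) kalg \<Rightarrow> nat \<Rightarrow> ('b \<Rightarrow> nat \<Rightarrow> nat \<Rightarrow> 'a) \<Rightarrow> (nat \<Rightarrow> 'a) set \<Rightarrow> bool" where
  "submodule A n \<rho> U \<longleftrightarrow> subspace_of n U \<and> (\<forall>a\<in>acarrier A. \<forall>x\<in>U. mat_vec n (\<rho> a) x \<in> U)"

definition indecomposable :: "('a::field, 'b) kalg \<Rightarrow> nat \<Rightarrow> ('b \<Rightarrow> nat \<Rightarrow> nat \<Rightarrow> 'a) \<Rightarrow> bool" where
  "indecomposable A n \<rho> \<longleftrightarrow> n > 0 \<and>
     \<not> (\<exists>U W. submodule A n \<rho> U \<and> submodule A n \<rho> W
          \<and> U \<noteq> {\<lambda>_. 0} \<and> W \<noteq> {\<lambda>_. 0} \<and> U \<inter> W = {\<lambda>_. 0}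
          \<and> (\<forall>x\<in>kvec n. \<exists>u\<in>U. \<exists>w\<in>W. x = (\<lambda>i. u i + w i)))"

definition rep_iso :: "('a::field, 'b) kalg \<Rightarrow> nat \<Rightarrow> ('b \<Rightarrow> nat \<Rightarrow> nat \<Rightarrow> 'a)
     \<Rightarrow> nat \<Rightarrow> ('b \<Rightarrow> nat \<Rightarrow> nat \<Rightarrow> 'a) \<Rightarrow> bool" where
  "rep_iso A n \<rho> n' \<rho>' \<longleftrightarrow> n = n' \<and>
     (\<exists>P Q. is_mat n P \<and> is_mat n Q \<and> mat_mult n P Q = mat_id n \<and> mat_mult n Q P = mat_id n
        \<and> (\<forall>a\<in>acarrier A. mat_mult n P (\<rho> a) = mat_mult n (\<rho>' a) P))"

definition finite_rep_type :: "('a::field, 'b) kalg \<Rightarrow> bool" where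
  "finite_rep_type A \<longleftrightarrow> (\<exists>F. finite F \<and> (\<forall>(n, \<rho>)\<in>F. is_rep A n \<rho> \<and> indecomposable A n \<rho>)
     \<and> (\<forall>n \<rho>. is_rep A n \<rho> \<and> indecomposable A n \<rho> \<longrightarrow> (\<exists>(n', \<rho>')\<in>F. rep_iso A n \<rho> n' \<rho>')))"

text \<open>Basis of V^{\<otimes>d}: words of length d in {v1, v2}; a letter is True iff it is v2 (odd).
  Positions are 0..d-1; the transposition s_j = (j j+1) is for j+1 < d.\<close>

definition words :: "nat \<Rightarrow> bool list set" where
  "words d = {w. length w = d}"

definition tvec :: "nat \<Rightarrow> (bool list \<Rightarrow> 'a::field) set" where
  "tvec d = {x. \<forall>w. w \<notin> words d \<longrightarrow> x w = 0}"

definition swap_at :: "nat \<Rightarrow> bool list \<Rightarrow> bool list" where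
  "swap_at j w = w[j := w ! Suc j, Suc j := w ! j]"

text \<open>Right action of s_j on a vector x = sum_w x(w) e_w:
  e_w . s_j = (-1)^{parity(w_j) parity(w_{j+1})} e_{swap_j w}.\<close>
definition act_s :: "nat \<Rightarrow> (bool list \<Rightarrow> 'a::field) \<Rightarrow> bool list \<Rightarrow> 'a" where
  "act_s j x = (\<lambda>u. (if u ! j \<and> u ! Suc j then -1 else 1) * x (swap_at j u))"

definition endo_apply :: "nat \<Rightarrow> (bool list \<Rightarrow> bool list \<Rightarrow> 'a::field) \<Rightarrow> (bool list \<Rightarrow> 'a) \<Rightarrow> bool list \<Rightarrow> 'a" where
  "endo_apply d M x = (\<lambda>u. if u \<in> words d then (\<Sum>v\<in>words d. M u v * x v) else 0)"

definition schur11 :: "nat \<Rightarrow> ('a::field, bool list \<Rightarrow> bool list \<Rightarrow> 'a) kalg" where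
  "schur11 d = \<lparr>
     acarrier = {M. (\<forall>u v. (u \<notin> words d \<or> v \<notin> words d) \<longrightarrow> M u v = 0)
                 \<and> (\<forall>j. Suc j < d \<longrightarrow> (\<forall>x\<in>tvec d.
                        endo_apply d M (act_s j x) = act_s j (endo_apply d M x)))},
     aadd = (\<lambda>M N u v. M u v + N u v),
     azero = (\<lambda>u v. 0),
     asmul = (\<lambda>c M u v. c * M u v),
     amul = (\<lambda>M N u v. if u \<in> words d \<and> v \<in> words d then (\<Sum>w\<in>words d. M u w * N w v) else 0),
     aone = (\<lambda>u v. if u \<in> words d \<and> u = v then 1 else 0) \<rparr>"

datatype arrow = Alpha nat | Beta nat

fun arr_src :: "arrow \<Rightarrow> nat" where
  "arr_src (Alpha i) = i - 1" | "arr_src (Beta i) = i"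
fun arr_tgt :: "arrow \<Rightarrow> nat" where
  "arr_tgt (Alpha i) = i" | "arr_tgt (Beta i) = i - 1"

definition is_arrow :: "nat \<Rightarrow> arrow \<Rightarrow> bool" where
  "is_arrow m a \<longleftrightarrow> (case a of Alpha i \<Rightarrow> 1 \<le> i \<and> i \<le> m | Beta i \<Rightarrow> 1 \<le> i \<and> i \<le> m)"

text \<open>A path is (starting vertex, list of arrows), composed left to right.\<close>
fun path_end :: "nat \<Rightarrow> arrow list \<Rightarrow> nat" where
  "path_end v [] = v" | "path_end v (a # as) = path_end (arr_tgt a) as"

fun valid_path :: "nat \<Rightarrow> nat \<times> arrow list \<Rightarrow> bool" where
  "valid_path m (v, []) = (v \<le> m)"
| "valid_path m (v, a # as) = (v \<le> m \<and> is_arrow m a \<and> arr_src a = v \<and> valid_path m (arr_tgt a, as))"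

definition path_alg_carrier :: "nat \<Rightarrow> (nat \<times> arrow list \<Rightarrow> 'a::field) set" where
  "path_alg_carrier m = {f. finite {p. f p \<noteq> 0} \<and> (\<forall>p. \<not> valid_path m p \<longrightarrow> f p = 0)}"

definition path_mul :: "nat \<Rightarrow> (nat \<times> arrow list \<Rightarrow> 'a::field) \<Rightarrow> (nat \<times> arrow list \<Rightarrow> 'a) \<Rightarrow> nat \<times> arrow list \<Rightarrow> 'a" where
  "path_mul m f g = (\<lambda>(v, cs). if valid_path m (v, cs) then
      (\<Sum>n\<le>length cs. f (v, take n cs) * g (path_end v (take n cs), drop n cs)) else 0)"

definition path_one :: "nat \<Rightarrow> nat \<times> arrow list \<Rightarrow> 'a::field" where
  "path_one m = (\<lambda>(v, cs). if cs = [] \<and> v \<le> m then 1 else 0)"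

definition path_alg :: "nat \<Rightarrow> ('a::field, nat \<times> arrow list \<Rightarrow> 'a) kalg" where
  "path_alg m = \<lparr> acarrier = path_alg_carrier m,
     aadd = (\<lambda>f g p. f p + g p), azero = (\<lambda>p. 0), asmul = (\<lambda>c f p. c * f p),
     amul = path_mul m, aone = path_one m \<rparr>"

definition path_elem :: "nat \<times> arrow list \<Rightarrow> nat \<times> arrow list \<Rightarrow> 'a::field" where
  "path_elem q = (\<lambda>p. if p = q then 1 else 0)"

definition atilde_rels :: "nat \<Rightarrow> (nat \<times> arrow list \<Rightarrow> 'a::field) set" where
  "atilde_rels m =
     {path_elem (i - 1, [Alpha i, Alpha (Suc i)]) | i. 1 \<le> i \<and> i \<le> m - 1}
   \<union> {path_elem (Suc i, [Beta (Suc i), Beta i]) | i. 1 \<le> i \<and> i \<le> m - 1}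
   \<union> {path_elem (0, [Alpha 1, Beta 1])}
   \<union> {path_elem (m, [Beta m, Alpha m])}
   \<union> {(\<lambda>p. path_elem (i, [Beta i, Alpha i]) p - path_elem (i, [Alpha (Suc i), Beta (Suc i)]) p)
        | i. 1 \<le> i \<and> i \<le> m - 1}"

definition is_ideal :: "('a, 'b) kalg \<Rightarrow> 'b set \<Rightarrow> bool" where
  "is_ideal A I \<longleftrightarrow> I \<subseteq> acarrier A \<and> azero A \<in> I
     \<and> (\<forall>x\<in>I. \<forall>y\<in>I. aadd A x y \<in> I) \<and> (\<forall>c. \<forall>x\<in>I. asmul A c x \<in> I)
     \<and> (\<forall>a\<in>acarrier A. \<forall>x\<in>I. amul A a x \<in> I \<and> amul A x a \<in> I)"

definition gen_ideal :: "('a, 'b) kalg \<Rightarrow> 'b set \<Rightarrow> 'b set" where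
  "gen_ideal A S = \<Inter> {I. is_ideal A I \<and> S \<subseteq> I}"

definition coset :: "('a::field, 'b) kalg \<Rightarrow> 'b set \<Rightarrow> 'b \<Rightarrow> 'b set" where
  "coset A I x = {y \<in> acarrier A. aadd A y (asmul A (-1) x) \<in> I}"

definition quot_alg :: "('a::field, 'b) kalg \<Rightarrow> 'b set \<Rightarrow> ('a, 'b set) kalg" where
  "quot_alg A I = (let rep = (\<lambda>X. SOME x. x \<in> X) in
    \<lparr> acarrier = coset A I ` acarrier A,
      aadd = (\<lambda>X Y. coset A I (aadd A (rep X) (rep Y))),
      azero = coset A I (azero A),
      asmul = (\<lambda>c X. coset A I (asmul A c (rep X))),
      amul = (\<lambda>X Y. coset A I (amul A (rep X) (rep Y))),
      aone = coset A I (aone A) \<rparr>)"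

definition atilde :: "nat \<Rightarrow> ('a::field, (nat \<times> arrow list \<Rightarrow> 'a) set) kalg" where
  "atilde m = quot_alg (path_alg m) (gen_ideal (path_alg m) (atilde_rels m))"

end

theory Submission
  imports Defs "HOL-Library.Multiset" "HOL-Library.Function_Algebras"
begin

text \<open>
  Let \<open>L\<close> be the signed sum over all positions of the operators turning \<open>v2\<close> into \<open>v1\<close>, and
  \<open>R\<close> its transpose. They commute with the signed place permutations, square to zero and, as
  fermionic ladder operators, satisfy \<open>LR + RL = d\<close>, which is \<open>0\<close> in \<open>k\<close>. A matrix commuting
  with the symmetric group is determined by one entry for each orbit of pairs of words, and in
  characteristic other than 2 the entry vanishes as soon as two positions carry the same mixed
  pair. Hence the algebra is spanned by the products of \<open>1\<close>, \<open>L\<close>, \<open>R\<close>, \<open>LR\<close> with the weight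
  idempotents, and sending \<open>\<alpha>\<^sub>i\<close> to \<open>\<plusminus>L e\<^sub>i\<close> and \<open>\<beta>\<^sub>i\<close> to
  \<open>R e\<^bsub>i-1\<^esub>\<close> identifies it with the quiver algebra.

  A module is then a graded space with commuting operators \<open>E\<close>, \<open>F\<close> of degrees \<open>1\<close>, \<open>-1\<close> and
  square zero. If \<open>EFv \<noteq> 0\<close> for some homogeneous \<open>v\<close>, then \<open>v\<close>, \<open>Ev\<close>, \<open>Fv\<close>, \<open>EFv\<close> span a
  direct summand. Otherwise the module is a representation of zigzag quivers of type A, and a
  chain starting in the lowest degree and stopping as early as possible spans a direct summand.
  So an indecomposable module has a basis of at most \<open>d + 4\<close> vectors on which the generators act
  by matrices with entries 0 and 1.
\<close>

section \<open>Words and the ladder operators\<close>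

text \<open>The hypotheses on the characteristic enter through two facts. That d is 0 in k gives LR
  = -RL, so products of three ladder operators vanish and LR kills the extreme weights; that 2 is
  invertible kills the entries at repeated mixed pairs. No list of indecomposable modules is drawn
  up. It suffices that every nonzero module has a summand spanned by vectors that each generator
  sends to zero or to one another, with dual functionals behaving in the same way: the functionals
  cut out the complement, so an indecomposable module equals its summand. Which of the finitely many
  0-1 data come from modules is never decided; one module is picked for each datum that occurs, and
  two modules with the same datum are isomorphic. The bound d + 4 covers both shapes at once: four
  vectors for the square, and at most d + 1, one for each degree, for a chain.\<close>

fun weight :: "bool list \<Rightarrow> nat" where
  "weight [] = 0"
| "weight (a # u) = (if a then Suc (weight u) else weight u)"

text \<open>The sign counts the odd letters in front of the position changed (Jordan-Wigner).\<close>

fun lower :: "bool list \<Rightarrow> bool list \<Rightarrow> 'a::field" where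
  "lower (a # u) (b # v) =
     (if \<not> a \<and> b \<and> u = v then 1 else 0) + (if a = b then (if a then - 1 else 1) * lower u v else 0)"
| "lower _ _ = 0"

definition wmul :: "nat \<Rightarrow> (bool list \<Rightarrow> bool list \<Rightarrow> 'a::field) \<Rightarrow> (bool list \<Rightarrow> bool list \<Rightarrow> 'a)
    \<Rightarrow> bool list \<Rightarrow> bool list \<Rightarrow> 'a" where
  "wmul d M N u v = (\<Sum>w\<in>words d. M u w * N w v)"

abbreviation (input) raise :: "bool list \<Rightarrow> bool list \<Rightarrow> 'a::field" where
  "raise u v \<equiv> lower v u"

definition low_raise :: "nat \<Rightarrow> bool list \<Rightarrow> bool list \<Rightarrow> 'a::field" where
  "low_raise d = wmul d lower raise"

definition sgn_at :: "nat \<Rightarrow> bool list \<Rightarrow> 'a::field" where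
  "sgn_at j u = (if u ! j \<and> u ! Suc j then - 1 else 1)"

lemma finite_words [simp]: "finite (words d)"
  using finite_lists_length_eq[of "UNIV :: bool set" d] by (simp add: words_def)

lemma words_0 [simp]: "words 0 = {[]}"
  by (auto simp: words_def)

lemma Cons_in_words [simp]: "a # u \<in> words (Suc d) \<longleftrightarrow> u \<in> words d"
  by (simp add: words_def)

lemma words_Suc_cases:
  assumes "u \<in> words (Suc d)"
  obtains a u' where "u = a # u'" "u' \<in> words d"
  using assms by (cases u) (auto simp: words_def)

lemma sum_words_Suc:
  "(\<Sum>w\<in>words (Suc d). f w) = (\<Sum>w\<in>words d. f (False # w)) + (\<Sum>w\<in>words d. f (True # w))"
proof -
  have eq: "words (Suc d) = (#) False ` words d \<union> (#) True ` words d"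
    by (auto simp: words_def length_Suc_conv)
  show ?thesis
    unfolding eq by (subst sum.union_disjoint) (auto simp: sum.reindex)
qed

lemma weight_le_length: "weight u \<le> length u"
  by (induction u) auto

lemma weight_le: "u \<in> words d \<Longrightarrow> weight u \<le> d"
  using weight_le_length[of u] by (simp add: words_def)

lemma weight_lower: "lower u v \<noteq> 0 \<Longrightarrow> weight v = Suc (weight u)"
  by (induction u v rule: lower.induct) (auto split: if_splits)

lemma wmul_assoc: "wmul d (wmul d A B) C u v = wmul d A (wmul d B C) u v"
proof -
  have "wmul d (wmul d A B) C u v = (\<Sum>w\<in>words d. \<Sum>x\<in>words d. A u x * B x w * C w v)"
    by (simp add: wmul_def sum_distrib_right)
  also have "\<dots> = (\<Sum>x\<in>words d. \<Sum>w\<in>words d. A u x * B x w * C w v)"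
    by (rule sum.swap)
  also have "\<dots> = wmul d A (wmul d B C) u v"
    by (simp add: wmul_def sum_distrib_left mult.assoc)
  finally show ?thesis .
qed

text \<open>With one more letter in front, L becomes l \<otimes> 1 + s \<otimes> L, where l lowers a
  single letter and s is its parity sign. Since l^2 = 0, s^2 = 1 and ls = -sl, the mixed terms
  cancel in the square.\<close>

lemma lower_lower:
  "u \<in> words d \<Longrightarrow> v \<in> words d \<Longrightarrow> wmul d lower lower u v = (0 :: 'a::field)"
proof (induction d arbitrary: u v)
  case 0
  then show ?case by (simp add: wmul_def)
next
  case (Suc d)
  obtain a u' where u: "u = a # u'" "u' \<in> words d" using Suc.prems(1) by (rule words_Suc_cases)
  obtain b v' where v: "v = b # v'" "v' \<in> words d" using Suc.prems(2) by (rule words_Suc_cases)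
  have IH: "(\<Sum>w\<in>words d. lower u' w * lower w v') = (0::'a)"
    using Suc.IH[OF u(2) v(2)] by (simp add: wmul_def)
  show ?case
    using u(2) v(2) IH
    by (cases a; cases b)
       (simp_all add: u(1) v(1) wmul_def sum_words_Suc if_distrib if_distribR sum_negf
          cong: if_cong)
qed

lemma delta_mult:
  "(if P then 1 else 0) * x = (if P then x else 0 :: 'a::ring_1)"
  "x * (if P then 1 else 0) = (if P then x else 0)"
  "- (if P then x else 0) = (if P then - x else 0)"
  by auto

text \<open>Same decomposition: the mixed terms, the last summands of the two formulas in the proof,
  cancel, and lr + rl = 1 on the new letter adds one to the scalar.\<close>

lemma lower_raise_anticommute:
  "u \<in> words d \<Longrightarrow> v \<in> words d \<Longrightarrow>
     wmul d lower raise u v + wmul d raise lower u v = (if u = v then of_nat d else 0 :: 'a::field)"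
proof (induction d arbitrary: u v)
  case 0
  then show ?case by (simp add: wmul_def)
next
  case (Suc d)
  obtain a u' where u: "u = a # u'" "u' \<in> words d" using Suc.prems(1) by (rule words_Suc_cases)
  obtain b v' where v: "v = b # v'" "v' \<in> words d" using Suc.prems(2) by (rule words_Suc_cases)
  have "wmul (Suc d) lower raise u v = (if a \<or> b \<or> u' \<noteq> v' then 0 else 1)
      + (if a = b then wmul d lower raise u' v' else 0)
      - (if \<not> a \<and> b then raise u' v' else if a \<and> \<not> b then lower u' v' else 0 :: 'a)"
    using u(2) v(2)
    by (cases a; cases b)
       (simp_all add: u(1) v(1) wmul_def sum_words_Suc delta_mult sum_negf)
  moreover have "wmul (Suc d) raise lower u v = (if a \<and> b \<and> u' = v' then 1 else 0)
      + (if a = b then wmul d raise lower u' v' else 0)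
      + (if \<not> a \<and> b then raise u' v' else if a \<and> \<not> b then lower u' v' else 0 :: 'a)"
    using u(2) v(2)
    by (cases a; cases b)
       (simp_all add: u(1) v(1) wmul_def sum_words_Suc delta_mult sum_negf)
  ultimately show ?case
    using Suc.IH[OF u(2) v(2)] by (auto simp: u(1) v(1) algebra_simps split: if_splits)
qed

lemma raise_raise:
  "u \<in> words d \<Longrightarrow> v \<in> words d \<Longrightarrow> wmul d raise raise u v = (0 :: 'a::field)"
  using lower_lower[of v d u] by (simp add: wmul_def mult.commute)

section \<open>Adjacent transpositions and their signs\<close>

lemma length_swap_at [simp]: "length (swap_at j u) = length u"
  by (simp add: swap_at_def)

lemma swap_at_words [simp]: "swap_at j u \<in> words d \<longleftrightarrow> u \<in> words d"
  by (simp add: words_def)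

lemma swap_at_Suc [simp]: "swap_at (Suc j) (a # u) = a # swap_at j u"
  by (simp add: swap_at_def)

lemma swap_at_0 [simp]: "swap_at 0 (a # b # u) = b # a # u"
  by (simp add: swap_at_def)

lemma sgn_at_simps [simp]:
  "sgn_at (Suc j) (a # u) = sgn_at j u"
  "sgn_at 0 (a # b # u) = (if a \<and> b then - 1 else 1)"
  by (auto simp: sgn_at_def)

lemma sgn_at_sq [simp]: "sgn_at j u * sgn_at j u = 1" "sgn_at j u * (sgn_at j u * x) = x"
  by (auto simp: sgn_at_def)

text \<open>Fits the recursion of the ladder operators on the first letter: a swap either happens in
  the first two letters or passes to the tail.\<close>

lemma swap_at_induct [consumes 1, case_names 0 Suc]:
  assumes "Suc j < length u"
    and "\<And>a b u. P 0 (a # b # u)"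
    and "\<And>j a u. Suc j < length u \<Longrightarrow> P j u \<Longrightarrow> P (Suc j) (a # u)"
  shows "P j u"
  using assms(1)
proof (induction j arbitrary: u)
  case 0
  then obtain a b u' where "u = a # b # u'" by (cases u; cases "tl u") auto
  then show ?case using assms(2) by simp
next
  case (Suc j)
  then obtain a u' where "u = a # u'" by (cases u) auto
  then show ?case using assms(3) Suc by auto
qed

lemma swap_at_swap_at [simp]: "Suc j < length u \<Longrightarrow> swap_at j (swap_at j u) = u"
  by (induction j u rule: swap_at_induct) auto

lemma sgn_at_swap_at [simp]: "Suc j < length u \<Longrightarrow> sgn_at j (swap_at j u) = sgn_at j u"
  by (induction j u rule: swap_at_induct) auto

lemma weight_swap_at [simp]: "Suc j < length u \<Longrightarrow> weight (swap_at j u) = weight u"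
  by (induction j u rule: swap_at_induct) auto

lemma swap_at_eq_iff:
  "Suc j < length u \<Longrightarrow> Suc j < length v \<Longrightarrow> swap_at j u = swap_at j v \<longleftrightarrow> u = v"
  by (metis swap_at_swap_at)

text \<open>The Jordan-Wigner sign is made for this. Moving the changed letter past an odd neighbour
  alters the number of odd letters in front of it by one, and the same swap costs -1 in exactly one
  of the two words.\<close>

lemma lower_swap_at:
  assumes "Suc j < length u" "length v = length u"
  shows "lower (swap_at j u) (swap_at j v) = sgn_at j u * sgn_at j v * (lower u v :: 'a::field)"
  using assms
proof (induction j u arbitrary: v rule: swap_at_induct)
  case (0 a b u)
  then obtain a' b' v' where "v = a' # b' # v'" by (auto simp: length_Suc_conv)
  then show ?case by auto
next
  case (Suc j a u)
  then obtain b v' where v: "v = b # v'" "length v' = length u" by (auto simp: length_Suc_conv)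
  show ?case
    using Suc v by (auto simp: swap_at_eq_iff)
qed

lemma sum_words_swap_at:
  assumes "Suc j < d"
  shows "(\<Sum>w\<in>words d. f (swap_at j w)) = (\<Sum>w\<in>words d. f w)"
  by (rule sum.reindex_bij_witness[of _ "swap_at j" "swap_at j"]) (use assms in \<open>auto simp: words_def\<close>)

lemma low_raise_swap_at:
  assumes "Suc j < d" "u \<in> words d" "v \<in> words d"
  shows "low_raise d (swap_at j u) (swap_at j v) = sgn_at j u * sgn_at j v * (low_raise d u v :: 'a::field)"
proof -
  have "low_raise d (swap_at j u) (swap_at j v)
      = (\<Sum>w\<in>words d. lower (swap_at j u) (swap_at j w) * lower (swap_at j v) (swap_at j w) :: 'a)"
    unfolding low_raise_def wmul_def by (rule sum_words_swap_at[OF assms(1), symmetric])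
  also have "\<dots> = (\<Sum>w\<in>words d. sgn_at j u * sgn_at j v * (lower u w * lower v w))"
    by (rule sum.cong) (use assms in \<open>auto simp: words_def lower_swap_at mult_ac\<close>)
  also have "\<dots> = sgn_at j u * sgn_at j v * low_raise d u v"
    by (simp add: low_raise_def wmul_def sum_distrib_left)
  finally show ?thesis .
qed

text \<open>Commutation tested on basis vectors becomes equivariance of the matrix entries. Both
  signs appear as factors because each is its own inverse. From here on only matrices are
  needed.\<close>

lemma schur11_carrier_iff:
  "M \<in> acarrier (schur11 d) \<longleftrightarrow>
     (\<forall>u v. (u \<notin> words d \<or> v \<notin> words d) \<longrightarrow> M u v = (0::'a::field)) \<and>
     (\<forall>j u v. Suc j < d \<longrightarrow> u \<in> words d \<longrightarrow> v \<in> words d \<longrightarrow>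
        M (swap_at j u) (swap_at j v) = sgn_at j u * sgn_at j v * M u v)"
  (is "_ \<longleftrightarrow> ?A \<and> ?B")
proof -
  \<comment> \<open>Reindexing the sum by the swap moves it from the vector to the columns of
    \<open>M\<close>.\<close>
  have act: "endo_apply d M (act_s j x) u = (\<Sum>v\<in>words d. M u (swap_at j v) * sgn_at j v * x v)"
    if "Suc j < d" "u \<in> words d" for j u x
  proof -
    have "endo_apply d M (act_s j x) u = (\<Sum>v\<in>words d. M u v * (sgn_at j v * x (swap_at j v)))"
      using that by (simp add: endo_apply_def act_s_def sgn_at_def)
    also have "\<dots> = (\<Sum>v\<in>words d. M u (swap_at j v) * (sgn_at j (swap_at j v) * x (swap_at j (swap_at j v))))"
      by (rule sum_words_swap_at[OF that(1), symmetric])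
    also have "\<dots> = (\<Sum>v\<in>words d. M u (swap_at j v) * sgn_at j v * x v)"
      by (rule sum.cong) (use that in \<open>auto simp: words_def\<close>)
    finally show ?thesis .
  qed
  have act2: "act_s j (endo_apply d M x) u = (\<Sum>v\<in>words d. sgn_at j u * M (swap_at j u) v * x v)"
    if "Suc j < d" "u \<in> words d" for j u x
    using that by (simp add: endo_apply_def act_s_def sgn_at_def sum_distrib_left mult.assoc sum_negf)
  have out: "endo_apply d M (act_s j x) u = act_s j (endo_apply d M x) u" if "u \<notin> words d" for j u x
    using that by (simp add: endo_apply_def act_s_def)
  have "?B" if comm: "\<forall>j. Suc j < d \<longrightarrow> (\<forall>x\<in>tvec d. endo_apply d M (act_s j x) = act_s j (endo_apply d M x))"
  proof (intro allI impI)
    fix j u v assume j: "Suc j < d" and u: "u \<in> words d" and v: "v \<in> words d"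
    define x :: "bool list \<Rightarrow> 'a" where "x = (\<lambda>w. if w = v then 1 else 0)"
    have "x \<in> tvec d" using v by (auto simp: x_def tvec_def)
    then have "endo_apply d M (act_s j x) (swap_at j u) = act_s j (endo_apply d M x) (swap_at j u)"
      using comm j by simp
    moreover have "endo_apply d M (act_s j x) (swap_at j u) = M (swap_at j u) (swap_at j v) * sgn_at j v"
      using act[OF j, of "swap_at j u" x] u v
      by (simp add: x_def if_distrib[of "\<lambda>z. _ * z"] cong: if_cong)
    moreover have "act_s j (endo_apply d M x) (swap_at j u) = sgn_at j (swap_at j u) * M (swap_at j (swap_at j u)) v"
      using act2[OF j, of "swap_at j u" x] u v
      by (simp add: x_def if_distrib[of "\<lambda>z. _ * z"] cong: if_cong)
    ultimately have "M (swap_at j u) (swap_at j v) * sgn_at j v = sgn_at j u * M u v"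
      using j u by (simp add: words_def)
    then have "M (swap_at j u) (swap_at j v) * sgn_at j v * sgn_at j v = sgn_at j u * M u v * sgn_at j v"
      by simp
    then show "M (swap_at j u) (swap_at j v) = sgn_at j u * sgn_at j v * M u v"
      by (simp add: mult_ac)
  qed
  moreover have "endo_apply d M (act_s j x) = act_s j (endo_apply d M x)" if ?B "Suc j < d" for j x
  proof
    fix u
    show "endo_apply d M (act_s j x) u = act_s j (endo_apply d M x) u"
    proof (cases "u \<in> words d")
      case True
      have "M u (swap_at j v) * sgn_at j v = sgn_at j u * M (swap_at j u) v" if "v \<in> words d" for v
      proof -
        have "M (swap_at j (swap_at j u)) (swap_at j v)
            = sgn_at j (swap_at j u) * sgn_at j v * M (swap_at j u) v"
          using \<open>?B\<close> \<open>Suc j < d\<close> True that by simp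
        then show ?thesis using True that \<open>Suc j < d\<close>
          by (simp add: words_def mult_ac)
      qed
      then show ?thesis
        unfolding act[OF that(2) True] act2[OF that(2) True] by (intro sum.cong) auto
    qed (use out in blast)
  qed
  ultimately show ?thesis unfolding schur11_def by auto
qed

section \<open>The Schur superalgebra in coordinates\<close>

lemma weight_lower': "lower u v \<noteq> 0 \<Longrightarrow> weight u = weight v - 1"
  using weight_lower by fastforce

lemma weight_low_raise: "low_raise d u v \<noteq> 0 \<Longrightarrow> weight u = weight v"
  unfolding low_raise_def wmul_def
  by (metis (mono_tags, lifting) mult_eq_0_iff nat.inject sum.neutral weight_lower)

lemma wmul_cong:
  assumes "\<And>w. w \<in> words d \<Longrightarrow> A u w = A' u w" "\<And>w. w \<in> words d \<Longrightarrow> B w v = B' w v"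
  shows "wmul d A B u v = wmul d A' B' u v"
  unfolding wmul_def using assms by (intro sum.cong) auto

lemma wmul_zero: "wmul d (\<lambda>_ _. 0) B u v = 0" "wmul d A (\<lambda>_ _. 0) u v = 0"
  by (simp_all add: wmul_def)

lemma raise_lower:
  assumes "of_nat d = (0 :: 'a::field)" "u \<in> words d" "v \<in> words d"
  shows "wmul d raise lower u v = - (low_raise d u v :: 'a)"
  using lower_raise_anticommute[OF assms(2,3), where ?'a = 'a] assms(1)
  by (simp add: low_raise_def eq_neg_iff_add_eq_0 add.commute split: if_splits)

text \<open>LLR and LRR vanish because L and R square to zero; LRL and RLR are reduced to them by RL
  = -LR, which is where d = 0 in the field is used.\<close>

lemma low_raise_triple:
  assumes d: "of_nat d = (0 :: 'a::field)" and u: "u \<in> words d" and v: "v \<in> words d"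
  shows "wmul d (low_raise d) lower u v = (0 :: 'a)"
    and "wmul d (low_raise d) raise u v = (0 :: 'a)"
    and "wmul d lower (low_raise d) u v = (0 :: 'a)"
    and "wmul d raise (low_raise d) u v = (0 :: 'a)"
proof -
  have LLR: "wmul d lower (low_raise d) u v = (0 :: 'a)" if "u \<in> words d" "v \<in> words d" for u v
  proof -
    have "wmul d lower (low_raise d) u v = wmul d (wmul d lower lower) raise u v"
      unfolding low_raise_def by (rule wmul_assoc[symmetric])
    also have "\<dots> = wmul d (\<lambda>_ _. 0) raise u v"
      by (rule wmul_cong) (use that lower_lower in auto)
    finally show ?thesis by (simp add: wmul_zero)
  qed
  have LRR: "wmul d (low_raise d) raise u v = (0 :: 'a)" if "u \<in> words d" "v \<in> words d" for u v
  proof -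
    have "wmul d (low_raise d) raise u v = wmul d lower (wmul d raise raise) u v"
      unfolding low_raise_def by (rule wmul_assoc)
    also have "\<dots> = wmul d lower (\<lambda>_ _. 0) u v"
      by (rule wmul_cong) (use that raise_raise in auto)
    finally show ?thesis by (simp add: wmul_zero)
  qed
  have "wmul d (low_raise d) lower u v = (wmul d lower (wmul d raise lower) u v :: 'a)"
    unfolding low_raise_def by (rule wmul_assoc)
  also have "\<dots> = wmul d lower (\<lambda>w v. - low_raise d w v) u v"
    by (rule wmul_cong) (use u v raise_lower[OF d] in auto)
  also have "\<dots> = - wmul d lower (low_raise d) u v"
    by (simp add: wmul_def sum_negf)
  finally show "wmul d (low_raise d) lower u v = (0 :: 'a)" using LLR[OF u v] by simp
  have "wmul d raise (low_raise d) u v = (wmul d (wmul d raise lower) raise u v :: 'a)"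
    unfolding low_raise_def by (rule wmul_assoc[symmetric])
  also have "\<dots> = wmul d (\<lambda>u w. - low_raise d u w) raise u v"
    by (rule wmul_cong) (use u v raise_lower[OF d] in auto)
  also have "\<dots> = - wmul d (low_raise d) raise u v"
    by (simp add: wmul_def sum_negf)
  finally show "wmul d raise (low_raise d) u v = (0 :: 'a)" using LRR[OF u v] by simp
  show "wmul d lower (low_raise d) u v = (0 :: 'a)" "wmul d (low_raise d) raise u v = (0 :: 'a)"
    using LLR[OF u v] LRR[OF u v] by auto
qed

text \<open>The matrix of X + LY + RZ + LRW with X, Y, Z, W scalar on each weight space. These act
  first, so they see the weight of the column.\<close>

definition coord_mat :: "nat \<Rightarrow> (nat \<Rightarrow> 'a::field) \<Rightarrow> (nat \<Rightarrow> 'a) \<Rightarrow> (nat \<Rightarrow> 'a) \<Rightarrow> (nat \<Rightarrow> 'a)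
    \<Rightarrow> bool list \<Rightarrow> bool list \<Rightarrow> 'a" where
  "coord_mat d x y z w u v = (if u \<in> words d \<and> v \<in> words d then
     (if u = v then x (weight v) else 0) + y (weight v) * lower u v + z (weight v) * raise u v
       + w (weight v) * low_raise d u v else 0)"

text \<open>The truncated \<open>weight v - 1\<close> is harmless: \<open>lower u v = 0\<close> when \<open>weight v = 0\<close>.\<close>

lemma coord_mat_wmul:
  assumes d: "of_nat d = (0 :: 'a::field)" and u: "u \<in> words d" and v: "v \<in> words d"
  shows "wmul d (coord_mat d x y z w) lower u v
      = x (weight v - 1) * lower u v - z (weight v - 1) * (low_raise d u v :: 'a)" (is ?L)
    and "wmul d (coord_mat d x y z w) raise u v
      = x (Suc (weight v)) * raise u v + y (Suc (weight v)) * (low_raise d u v :: 'a)" (is ?R)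
    and "wmul d (coord_mat d x y z w) (low_raise d) u v = x (weight v) * (low_raise d u v :: 'a)" (is ?LR)
proof -
  \<comment> \<open>Column \<open>v\<close> of \<open>N\<close> is concentrated in weight
    \<open>n\<close>, so the four coefficient functions can be evaluated at \<open>n\<close> once
    and for all.\<close>
  have *: "wmul d (coord_mat d x y z w) N u v
      = x n * N u v + y n * wmul d lower N u v + z n * wmul d raise N u v + w n * wmul d (low_raise d) N u v"
    if "\<And>w. N w v \<noteq> 0 \<Longrightarrow> weight w = n" for N n
  proof -
    have "coord_mat d x y z w u w' * N w' v = (if u = w' then x n * N w' v else 0)
        + y n * (lower u w' * N w' v) + z n * (raise u w' * N w' v) + w n * (low_raise d u w' * N w' v)"
      if "w' \<in> words d" for w'
      using that u \<open>\<And>w. N w v \<noteq> 0 \<Longrightarrow> weight w = n\<close>[of w']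
      by (cases "N w' v = 0") (auto simp: coord_mat_def algebra_simps)
    then have "wmul d (coord_mat d x y z w) N u v = (\<Sum>w'\<in>words d. (if u = w' then x n * N w' v else 0)
        + y n * (lower u w' * N w' v) + z n * (raise u w' * N w' v) + w n * (low_raise d u w' * N w' v))"
      unfolding wmul_def by (intro sum.cong) auto
    also have "\<dots> = x n * N u v + y n * wmul d lower N u v + z n * wmul d raise N u v
        + w n * wmul d (low_raise d) N u v"
      using u by (simp add: sum.distrib wmul_def sum_distrib_left)
    finally show ?thesis .
  qed
  show ?L
    by (subst *[where n = "weight v - 1"])
       (use u v in \<open>auto simp: weight_lower' lower_lower raise_lower[OF d] low_raise_triple[OF d]\<close>)
  show ?R
    by (subst *[where n = "Suc (weight v)"])
       (use u v in \<open>auto simp: weight_lower raise_raise low_raise_def[symmetric] low_raise_triple[OF d]\<close>)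
  have "wmul d (low_raise d) (low_raise d) u v = (wmul d lower (wmul d raise (low_raise d)) u v :: 'a)"
    unfolding low_raise_def by (rule wmul_assoc)
  also have "\<dots> = wmul d lower (\<lambda>_ _. 0) u v"
    by (rule wmul_cong) (use u v low_raise_triple[OF d] in auto)
  finally have "wmul d (low_raise d) (low_raise d) u v = (0 :: 'a)" by (simp add: wmul_zero)
  then show ?LR
    by (subst *[where n = "weight v"])
       (use u v in \<open>auto simp: weight_low_raise low_raise_triple[OF d]\<close>)
qed

text \<open>The right factor has constant coefficients on each column, so
  \<open>coord_mat_wmul\<close> applies. The shifts \<open>i - 1\<close> and \<open>Suc i\<close>
  arise because L and R change the weight before the left factor acts; the minus sign is RL =
  -LR.\<close>

lemma coord_mat_mult:
  assumes d: "of_nat d = (0 :: 'a::field)"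
  shows "amul (schur11 d) (coord_mat d x y z w) (coord_mat d x' y' z' w')
    = coord_mat d (\<lambda>i. x i * x' i) (\<lambda>i. x (i - 1) * y' i + y i * x' i)
        (\<lambda>i. x (Suc i) * z' i + z i * x' i)
        (\<lambda>i. x i * w' i + w i * x' i + y (Suc i) * z' i - z (i - 1) * y' i :: 'a)"
proof (intro ext)
  fix u v
  show "amul (schur11 d) (coord_mat d x y z w) (coord_mat d x' y' z' w') u v
    = coord_mat d (\<lambda>i. x i * x' i) (\<lambda>i. x (i - 1) * y' i + y i * x' i)
        (\<lambda>i. x (Suc i) * z' i + z i * x' i)
        (\<lambda>i. x i * w' i + w i * x' i + y (Suc i) * z' i - z (i - 1) * y' i) u v"
  proof (cases "u \<in> words d \<and> v \<in> words d")
    case True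
    let ?K = "coord_mat d x y z w" and ?i = "weight v"
    have "amul (schur11 d) ?K (coord_mat d x' y' z' w') u v = (\<Sum>s\<in>words d. ?K u s * coord_mat d x' y' z' w' s v)"
      using True by (simp add: schur11_def)
    also have "\<dots> = (\<Sum>s\<in>words d. (if s = v then x' ?i * ?K u s else 0) + y' ?i * (?K u s * lower s v)
        + z' ?i * (?K u s * raise s v) + w' ?i * (?K u s * low_raise d s v))"
      using True by (intro sum.cong) (auto simp: coord_mat_def[of d x'] algebra_simps)
    also have "\<dots> = x' ?i * ?K u v + y' ?i * wmul d ?K lower u v + z' ?i * wmul d ?K raise u v
        + w' ?i * wmul d ?K (low_raise d) u v"
      using True by (simp add: sum.distrib wmul_def sum_distrib_left)
    finally show ?thesis
      using True by (simp add: coord_mat_wmul[OF d]) (simp add: coord_mat_def algebra_simps)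
  qed (auto simp: schur11_def coord_mat_def)
qed

lemma coord_mat_add:
  "aadd (schur11 d) (coord_mat d x y z w) (coord_mat d x' y' z' w')
    = coord_mat d (\<lambda>i. x i + x' i) (\<lambda>i. y i + y' i) (\<lambda>i. z i + z' i) (\<lambda>i. w i + w' i)"
  by (intro ext) (auto simp: schur11_def coord_mat_def algebra_simps)

lemma coord_mat_smult:
  "asmul (schur11 d) c (coord_mat d x y z w)
    = coord_mat d (\<lambda>i. c * x i) (\<lambda>i. c * y i) (\<lambda>i. c * z i) (\<lambda>i. c * w i)"
  by (intro ext) (auto simp: schur11_def coord_mat_def algebra_simps)

lemma coord_mat_one: "aone (schur11 d) = coord_mat d (\<lambda>_. 1) (\<lambda>_. 0) (\<lambda>_. 0) (\<lambda>_. 0)"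
  by (intro ext) (auto simp: schur11_def coord_mat_def)

lemma coord_mat_in_carrier: "coord_mat d x y z w \<in> acarrier (schur11 d)"
  unfolding schur11_carrier_iff
proof (intro conjI allI impI)
  fix j u v assume *: "Suc j < d" "u \<in> words d" "v \<in> words d"
  then have len: "Suc j < length u" "Suc j < length v" "length v = length u" by (auto simp: words_def)
  let ?s = "sgn_at j u * sgn_at j v :: 'a"
  have "coord_mat d x y z w (swap_at j u) (swap_at j v)
      = (if u = v then x (weight v) else 0) + y (weight v) * (?s * lower u v)
        + z (weight v) * (?s * raise u v) + w (weight v) * (?s * low_raise d u v)"
    using * len lower_swap_at[OF len(1,3), where ?'a = 'a] lower_swap_at[OF len(2) len(3)[symmetric], where ?'a = 'a]
      low_raise_swap_at[OF *, where ?'a = 'a]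
    unfolding coord_mat_def by (simp only: swap_at_eq_iff swap_at_words weight_swap_at simp_thms if_True mult.commute[of "sgn_at j v" "sgn_at j u"])
  also have "\<dots> = ?s * (if u = v then x (weight v) else 0) + y (weight v) * (?s * lower u v)
        + z (weight v) * (?s * raise u v) + w (weight v) * (?s * low_raise d u v)"
    by simp
  also have "\<dots> = ?s * coord_mat d x y z w u v"
    using * by (simp only: coord_mat_def simp_thms if_True distrib_left mult.left_commute)
  finally show "coord_mat d x y z w (swap_at j u) (swap_at j v) = ?s * coord_mat d x y z w u v" .
qed (auto simp: coord_mat_def)

section \<open>Orbit representatives and uniqueness of coordinates\<close>

lemma weight_append [simp]: "weight (u @ v) = weight u + weight v"
  by (induction u) auto

lemma weight_replicate [simp]: "weight (replicate n a) = (if a then n else 0)"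
  by (induction n) auto

definition sorted_word :: "nat \<Rightarrow> nat \<Rightarrow> bool list" where
  "sorted_word n i = replicate (n - i) False @ replicate i True"

lemma weight_sorted_word [simp]: "weight (sorted_word n i) = i"
  by (simp add: sorted_word_def)

lemma sorted_word_in_words: "i \<le> n \<Longrightarrow> sorted_word n i \<in> words n"
  by (simp add: sorted_word_def words_def)

text \<open>Only the word \<open>True # True # c\<close> lies between the two; the sign comes from
  lowering its second letter behind an odd one.\<close>

lemma low_raise_entry:
  assumes "c \<in> words n"
  shows "low_raise (Suc (Suc n)) (False # True # c) (True # False # c) = (-1 :: 'a::field)"
  using assms
  by (simp add: low_raise_def wmul_def sum_words_Suc delta_mult)

lemma lower_weight_0: "weight v \<noteq> Suc (weight u) \<Longrightarrow> lower u v = 0"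
  using weight_lower by blast

lemma low_raise_weight_0: "weight v \<noteq> weight u \<Longrightarrow> low_raise d u v = 0"
  using weight_low_raise by metis

text \<open>At the off-diagonal representatives a single family survives. On the diagonal LR
  contributes as well, so \<open>x\<close> can be read off only after \<open>w\<close>.\<close>

lemma coord_mat_entries:
  fixes x y z w :: "nat \<Rightarrow> 'a::field"
  shows "i \<le> d \<Longrightarrow> coord_mat d x y z w (sorted_word d i) (sorted_word d i)
      = x i + w i * low_raise d (sorted_word d i) (sorted_word d i)" (is "_ \<Longrightarrow> ?x")
    and "i < d \<Longrightarrow> coord_mat d x y z w (False # sorted_word (d - 1) i) (True # sorted_word (d - 1) i) = y (Suc i)"
      (is "_ \<Longrightarrow> ?y")
    and "i < d \<Longrightarrow> coord_mat d x y z w (True # sorted_word (d - 1) i) (False # sorted_word (d - 1) i) = z i"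
      (is "_ \<Longrightarrow> ?z")
    and "Suc i < d \<Longrightarrow> coord_mat d x y z w (False # True # sorted_word (d - 2) i) (True # False # sorted_word (d - 2) i)
      = - w (Suc i)" (is "_ \<Longrightarrow> ?w")
proof -
  show ?x if "i \<le> d"
    using that by (simp add: coord_mat_def sorted_word_in_words lower_weight_0)
  have word: "a # sorted_word (d - 1) i \<in> words d" if "i < d" for a
    using that sorted_word_in_words[of i "d - 1"] by (simp add: words_def)
  show ?y if "i < d"
    using word[OF that] by (simp add: coord_mat_def low_raise_weight_0)
  show ?z if "i < d"
    using word[OF that] by (simp add: coord_mat_def low_raise_weight_0)
  show ?w if "Suc i < d"
  proof -
    have c: "sorted_word (d - 2) i \<in> words (d - 2)" "Suc (Suc (d - 2)) = d"
      using that by (auto intro!: sorted_word_in_words)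
    then have "a # b # sorted_word (d - 2) i \<in> words d" for a b
      by (simp add: words_def)
    then show ?thesis
      using low_raise_entry[OF c(1), where ?'a = 'a] unfolding c(2)
      by (simp add: coord_mat_def lower_weight_0)
  qed
qed

text \<open>Letters of \<open>ys\<close> are brought to the front one at a time and join the prefix
  \<open>us\<close>. With pairs as letters, this moves a pair of words within its orbit.\<close>

lemma mset_swap_induct:
  assumes swap: "\<And>xs a b ys. P (xs @ a # b # ys) \<Longrightarrow> P (xs @ b # a # ys)"
    and "mset xs = mset ys" "P (us @ xs)"
  shows "P (us @ ys)"
  using assms(2,3)
proof (induction ys arbitrary: us xs)
  case (Cons y ys)
  then have "y \<in> set xs" by (metis list.set_intros(1) set_mset_mset)
  then obtain as bs where xs: "xs = as @ y # bs" by (meson split_list)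
  have "P (us @ as @ y # bs) \<Longrightarrow> P (us @ y # as @ bs)" for bs
  proof (induction as arbitrary: bs rule: rev_induct)
    case (snoc a as)
    then have "P ((us @ as) @ a # y # bs)" by simp
    then have "P ((us @ as) @ y # a # bs)" by (rule swap)
    then show ?case using snoc.IH[of "a # bs"] by simp
  qed simp
  then have "P ((us @ [y]) @ (as @ bs))" using Cons.prems(2) xs by simp
  moreover have "mset (as @ bs) = mset ys" using Cons.prems(1) xs by simp
  ultimately show ?case using Cons.IH[of "as @ bs" "us @ [y]"] by simp
qed simp

lemma swap_at_append:
  "length u = j \<Longrightarrow> swap_at j (u @ a # b # v) = u @ b # a # v"
  by (auto simp: swap_at_def list_update_append nth_append)

text \<open>One representative for each orbit of pairs of words whose entry is not forced to vanish.\<close>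

lemma schur11_eq_zero:
  assumes N: "N \<in> acarrier (schur11 d)" and two: "(2 :: 'a::field) \<noteq> 0"
    and x: "\<And>i. i \<le> d \<Longrightarrow> N (sorted_word d i) (sorted_word d i) = (0 :: 'a)"
    and y: "\<And>i. i < d \<Longrightarrow> N (False # sorted_word (d - 1) i) (True # sorted_word (d - 1) i) = 0"
    and z: "\<And>i. i < d \<Longrightarrow> N (True # sorted_word (d - 1) i) (False # sorted_word (d - 1) i) = 0"
    and w: "\<And>i. Suc i < d \<Longrightarrow>
      N (False # True # sorted_word (d - 2) i) (True # False # sorted_word (d - 2) i) = 0"
  shows "N u v = 0"
proof (cases "u \<in> words d \<and> v \<in> words d")
  case True
  \<comment> \<open>A pair of words is read as one list of letter pairs, on which swapping in both
    words at once is a swap of neighbours. The length guard lets \<open>Q\<close> range over all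
    lists.\<close>
  define Q where "Q zs \<longleftrightarrow> (length zs = d \<longrightarrow> N (map fst zs) (map snd zs) = 0)" for zs
  have N_swap: "N (swap_at j u) (swap_at j v) = sgn_at j u * sgn_at j v * N u v"
    if "Suc j < d" "u \<in> words d" "v \<in> words d" for j u v
    using N that unfolding schur11_carrier_iff by blast
  have swap: "Q (xs @ b # a # ys)" if "Q (xs @ a # b # ys)" for xs a b ys
    unfolding Q_def
  proof
    assume len: "length (xs @ b # a # ys) = d"
    let ?zs = "xs @ a # b # ys" and ?j = "length xs"
    have "N (swap_at ?j (map fst ?zs)) (swap_at ?j (map snd ?zs)) = 0"
      using that len by (subst N_swap) (auto simp: words_def Q_def)
    then show "N (map fst (xs @ b # a # ys)) (map snd (xs @ b # a # ys)) = 0"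
      by (simp add: swap_at_append)
  qed
  have perm: "Q ys" if "mset xs = mset ys" "Q xs" for xs ys
    using mset_swap_induct[of Q xs ys "[]"] swap that by auto
  \<comment> \<open>Swapping two equal mixed pairs fixes both words, and exactly one of the words
    has two odd letters there, so the entry is its own negative.\<close>
  have twice: "Q ((a, \<not> a) # (a, \<not> a) # zs)" for a zs
    unfolding Q_def
  proof
    let ?zs = "(a, \<not> a) # (a, \<not> a) # zs"
    assume "length ?zs = d"
    then have "N (swap_at 0 (map fst ?zs)) (swap_at 0 (map snd ?zs)) = - N (map fst ?zs) (map snd ?zs)"
      by (subst N_swap) (auto simp: words_def)
    then have "N (map fst ?zs) (map snd ?zs) * 2 = 0"
      by (simp add: algebra_simps)
    then show "N (map fst ?zs) (map snd ?zs) = 0" using two by auto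
  qed
  \<comment> \<open>With at most one mixed pair of each kind, the four cases for \<open>k\<close>
    and \<open>l\<close> are the four families of representatives.\<close>
  have canonical: "Q (replicate k (False, True) @ replicate l (True, False) @
      replicate m (False, False) @ replicate n (True, True))" (is "Q ?zs") if "k \<le> 1" "l \<le> 1" for k l m n
  proof -
    have zs: "N (map fst ?zs) (map snd ?zs) = 0" if "length ?zs = d"
    proof -
      have d: "d = k + l + m + n" using that by simp
      consider "k = 0" "l = 0" | "k = 1" "l = 0" | "k = 0" "l = 1" | "k = 1" "l = 1"
        using \<open>k \<le> 1\<close> \<open>l \<le> 1\<close> by linarith
      then show ?thesis
        by cases (use x[of n] y[of n] z[of n] w[of n] in \<open>simp_all add: d sorted_word_def\<close>)
    qed
    then show ?thesis by (simp add: Q_def)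
  qed
  have "Q zs" for zs
  proof -
    define cnt where "cnt = count (mset zs)"
    show ?thesis
    proof (cases "\<exists>a. cnt (a, \<not> a) \<ge> 2")
      case True
      then obtain a where "cnt (a, \<not> a) \<ge> 2" by blast
      then have "{#(a, \<not> a), (a, \<not> a)#} \<subseteq># mset zs"
        by (auto simp: cnt_def subseteq_mset_def)
      then obtain B where "mset zs = {#(a, \<not> a), (a, \<not> a)#} + B" by (auto simp: mset_subset_eq_exists_conv)
      moreover obtain ys where "mset ys = B" using ex_mset by blast
      ultimately have "mset ((a, \<not> a) # (a, \<not> a) # ys) = mset zs" by simp
      then show ?thesis using twice perm by blast
    next
      case False
      let ?zs = "replicate (cnt (False, True)) (False, True) @ replicate (cnt (True, False)) (True, False) @
        replicate (cnt (False, False)) (False, False) @ replicate (cnt (True, True)) (True, True)"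
      have "count (mset ?zs) p = cnt p" for p
        by (cases p; cases "fst p"; cases "snd p") auto
      then have "mset ?zs = mset zs" by (intro multiset_eqI) (simp add: cnt_def)
      moreover have "cnt (False, True) < 2" "cnt (True, False) < 2"
        using False[unfolded not_ex, THEN spec, of False] False[unfolded not_ex, THEN spec, of True] by auto
      then have "cnt (False, True) \<le> 1" "cnt (True, False) \<le> 1" by auto
      then have "Q ?zs" by (rule canonical)
      ultimately show ?thesis using perm by blast
    qed
  qed
  from this[of "zip u v"] show ?thesis
    using True by (simp add: Q_def words_def)
next
  case False
  then show ?thesis using N unfolding schur11_carrier_iff by blast
qed

text \<open>The coordinates are chosen so that \<open>M\<close> and the coordinate matrix agree at
  all representatives; their difference then vanishes by \<open>schur11_eq_zero\<close>.\<close>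

lemma schur11_coord_mat:
  assumes M: "M \<in> acarrier (schur11 d)" and two: "(2 :: 'a::field) \<noteq> 0"
  obtains x y z w where "M = coord_mat d x y z (w :: nat \<Rightarrow> 'a)"
proof -
  \<comment> \<open>The index is the weight of the column: for \<open>y\<close> and \<open>w\<close>
    it exceeds the weight of the common tail by one, for \<open>z\<close> it equals it.\<close>
  define y where "y i = M (False # sorted_word (d - 1) (i - 1)) (True # sorted_word (d - 1) (i - 1))" for i
  define z where "z i = M (True # sorted_word (d - 1) i) (False # sorted_word (d - 1) i)" for i
  define w where "w i = - M (False # True # sorted_word (d - 2) (i - 1)) (True # False # sorted_word (d - 2) (i - 1))" for i
  define x where "x i = M (sorted_word d i) (sorted_word d i) - w i * low_raise d (sorted_word d i) (sorted_word d i)" for i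
  let ?K = "coord_mat d x y z w"
  define N where "N u v = M u v - ?K u v" for u v
  have "N \<in> acarrier (schur11 d)"
    using M coord_mat_in_carrier[of d x y z w] unfolding schur11_carrier_iff N_def
    by (simp add: right_diff_distrib)
  then have "N u v = 0" for u v
    by (rule schur11_eq_zero[OF _ two])
       (simp_all add: N_def coord_mat_entries coord_mat_entries[unfolded One_nat_def] x_def y_def z_def w_def)
  then have "M = ?K" by (auto simp: N_def)
  then show thesis by (rule that)
qed

text \<open>When d is 0 in the field, LR vanishes on the weights 0 and d, so \<open>w 0\<close> and
  \<open>w d\<close> cannot be recovered from the matrix and have to be normalized.\<close>

lemma coord_mat_eq_0:
  assumes "coord_mat d x y z w = (\<lambda>_ _. 0 :: 'a::field)" "w 0 = 0" "w d = 0"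
  shows "i < d \<Longrightarrow> y (Suc i) = 0" "i < d \<Longrightarrow> z i = 0" "i < d \<Longrightarrow> w i = 0" "i \<le> d \<Longrightarrow> x i = 0"
proof -
  note entries = coord_mat_entries[of _ d x y z w, unfolded assms(1)]
  show "i < d \<Longrightarrow> y (Suc i) = 0" "i < d \<Longrightarrow> z i = 0"
    using entries(2,3)[of i] by auto
  show w: "i < d \<Longrightarrow> w i = 0" for i
    using entries(4)[of "i - 1"] assms(2) by (cases i) auto
  show "x i = 0" if "i \<le> d"
    using entries(1)[of i] that w[of i] assms(3) by (cases "i = d") auto
qed

text \<open>R kills the top weight directly. L kills weight 0, which helps only after LR is
  rewritten as -RL.\<close>

lemma low_raise_extreme:
  assumes d: "of_nat d = (0 :: 'a::field)" and u: "u \<in> words d" and v: "v \<in> words d"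
    and ext: "weight v = 0 \<or> weight v = d"
  shows "low_raise d u v = (0 :: 'a)"
proof (cases "weight v = 0")
  case True
  then have "wmul d raise lower u v = (0 :: 'a)"
    unfolding wmul_def by (intro sum.neutral) (simp add: lower_weight_0)
  then show ?thesis using raise_lower[OF d u v] by simp
next
  case False
  have "raise w v = (0 :: 'a)" if "w \<in> words d" for w
    by (rule lower_weight_0) (use False ext weight_le[OF that] in auto)
  then show ?thesis by (simp add: low_raise_def wmul_def)
qed

text \<open>The hypotheses skip \<open>y 0\<close>, \<open>z d\<close>, \<open>w 0\<close> and
  \<open>w d\<close>, the coefficients of zero matrices. This absorbs the truncated subtractions and
  the end vertices in all later comparisons of coordinates.\<close>

lemma coord_mat_cong:
  assumes d: "of_nat d = (0 :: 'a::field)"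
    and "\<And>i. i \<le> d \<Longrightarrow> x i = x' i" "\<And>i. i < d \<Longrightarrow> y (Suc i) = y' (Suc i)" "\<And>i. i < d \<Longrightarrow> z i = z' i"
    "\<And>i. 0 < i \<Longrightarrow> i < d \<Longrightarrow> w i = w' i"
  shows "coord_mat d x y z w = coord_mat d x' y' z' (w' :: nat \<Rightarrow> 'a)"
proof (intro ext)
  fix u v
  show "coord_mat d x y z w u v = coord_mat d x' y' z' w' u v"
  proof (cases "u \<in> words d \<and> v \<in> words d")
    case True
    then have le: "weight u \<le> d" "weight v \<le> d" by (auto simp: weight_le)
    have "y (weight v) * lower u v = y' (weight v) * lower u v"
      using weight_lower[of u v, where ?'a = 'a] assms(3)[of "weight u"] le by (cases "lower u v = (0 :: 'a)") auto
    moreover have "z (weight v) * raise u v = z' (weight v) * raise u v"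
      using weight_lower[of v u, where ?'a = 'a] assms(4)[of "weight v"] le by (cases "raise u v = (0 :: 'a)") auto
    moreover have "w (weight v) * low_raise d u v = w' (weight v) * low_raise d u v"
      using low_raise_extreme[OF d, of u v] assms(5)[of "weight v"] le True
      by (cases "weight v = 0 \<or> weight v = d") auto
    ultimately show ?thesis unfolding coord_mat_def assms(2)[OF le(2)] by (simp only:)
  qed (auto simp: coord_mat_def)
qed

section \<open>The quiver algebra\<close>

text \<open>The isomorphism sends an element of \<open>B\<close> to its fibre under \<Phi>, which is
  a coset. A representative chosen from a fibre maps back to the element, so operations on cosets
  defined by \<open>SOME\<close> need no separate argument of independence.\<close>

lemma alg_iso_quot_alg:
  assumes maps: "\<And>x. x \<in> acarrier A \<Longrightarrow> \<Phi> x \<in> acarrier B"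
    and surj: "\<And>M. M \<in> acarrier B \<Longrightarrow> \<exists>x\<in>acarrier A. \<Phi> x = M"
    and add: "\<And>x y. x \<in> acarrier A \<Longrightarrow> y \<in> acarrier A \<Longrightarrow>
      aadd A x y \<in> acarrier A \<and> \<Phi> (aadd A x y) = aadd B (\<Phi> x) (\<Phi> y)"
    and smul: "\<And>c x. x \<in> acarrier A \<Longrightarrow> asmul A c x \<in> acarrier A \<and> \<Phi> (asmul A c x) = asmul B c (\<Phi> x)"
    and mul: "\<And>x y. x \<in> acarrier A \<Longrightarrow> y \<in> acarrier A \<Longrightarrow>
      amul A x y \<in> acarrier A \<and> \<Phi> (amul A x y) = amul B (\<Phi> x) (\<Phi> y)"
    and one: "aone A \<in> acarrier A" "\<Phi> (aone A) = aone B"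
    and ker: "\<And>x y. x \<in> acarrier A \<Longrightarrow> y \<in> acarrier A \<Longrightarrow> aadd A y (asmul A (- 1) x) \<in> I \<longleftrightarrow> \<Phi> y = \<Phi> x"
  shows "alg_iso B (quot_alg A I :: ('a::field, _) kalg)"
proof -
  define g where "g M = {x \<in> acarrier A. \<Phi> x = M}" for M
  have g_\<Phi>: "g (\<Phi> x) = coset A I x" if "x \<in> acarrier A" for x
    using ker[OF that] by (auto simp: g_def coset_def)
  define rep where "rep = (\<lambda>X :: 'b set. SOME x. x \<in> X)"
  have rep: "rep (g M) \<in> acarrier A \<and> \<Phi> (rep (g M)) = M" if "M \<in> acarrier B" for M
  proof -
    have "\<exists>x. x \<in> g M" using surj[OF that] by (auto simp: g_def)
    then have "rep (g M) \<in> g M" unfolding rep_def by (rule someI_ex)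
    then show ?thesis by (simp add: g_def)
  qed
  have "inj_on g (acarrier B)"
    by (rule inj_onI) (metis rep)
  moreover have "g ` acarrier B = coset A I ` acarrier A"
  proof -
    have "acarrier B = \<Phi> ` acarrier A" using surj maps by blast
    then show ?thesis by (simp add: image_image g_\<Phi> cong: image_cong)
  qed
  ultimately have "bij_betw g (acarrier B) (acarrier (quot_alg A I))"
    by (simp add: bij_betw_def quot_alg_def)
  moreover have "g (aadd B M N) = aadd (quot_alg A I) (g M) (g N)" if "M \<in> acarrier B" "N \<in> acarrier B" for M N
    using rep[OF that(1)] rep[OF that(2)] add[of "rep (g M)" "rep (g N)"] g_\<Phi>[of "aadd A (rep (g M)) (rep (g N))"]
    by (simp add: quot_alg_def Let_def rep_def[symmetric])
  moreover have "g (amul B M N) = amul (quot_alg A I) (g M) (g N)" if "M \<in> acarrier B" "N \<in> acarrier B" for M N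
    using rep[OF that(1)] rep[OF that(2)] mul[of "rep (g M)" "rep (g N)"] g_\<Phi>[of "amul A (rep (g M)) (rep (g N))"]
    by (simp add: quot_alg_def Let_def rep_def[symmetric])
  moreover have "g (asmul B c M) = asmul (quot_alg A I) c (g M)" if "M \<in> acarrier B" for c M
    using rep[OF that(1)] smul[of "rep (g M)" c] g_\<Phi>[of "asmul A c (rep (g M))"]
    by (simp add: quot_alg_def Let_def rep_def[symmetric])
  moreover have "g (aone B) = aone (quot_alg A I)"
    using one g_\<Phi>[of "aone A"] by (simp add: quot_alg_def Let_def)
  ultimately show ?thesis
    unfolding alg_iso_def by blast
qed

section \<open>Paths and their products\<close>

lemma valid_path_append:
  "valid_path m (v, as @ bs) \<longleftrightarrow> valid_path m (v, as) \<and> valid_path m (path_end v as, bs)"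
proof (induction as arbitrary: v)
  case Nil
  then show ?case by (cases bs) auto
qed auto

lemma path_carrier_add:
  "f \<in> path_alg_carrier m \<Longrightarrow> g \<in> path_alg_carrier m \<Longrightarrow> (\<lambda>p. f p + g p) \<in> path_alg_carrier m"
  by (auto simp: path_alg_carrier_def intro: finite_subset[of _ "{p. f p \<noteq> 0} \<union> {p. g p \<noteq> 0}"])

lemma path_carrier_smult:
  "f \<in> path_alg_carrier m \<Longrightarrow> (\<lambda>p. c * f p) \<in> path_alg_carrier m"
  by (auto simp: path_alg_carrier_def intro: finite_subset[of _ "{p. f p \<noteq> 0}"])

lemma path_elem_in_carrier: "valid_path m p \<Longrightarrow> path_elem p \<in> path_alg_carrier m"
  by (auto simp: path_alg_carrier_def path_elem_def)

lemma path_carrier_mul: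
  assumes f: "f \<in> path_alg_carrier m" and g: "g \<in> path_alg_carrier m"
  shows "path_mul m f g \<in> path_alg_carrier m"
proof -
  let ?S = "(\<lambda>((v, as), (v' :: nat, bs)). (v, as @ bs)) ` ({p. f p \<noteq> 0} \<times> {p. g p \<noteq> 0})"
  have "p \<in> ?S" if nz: "path_mul m f g p \<noteq> 0" for p
  proof -
    obtain v cs where p: "p = (v, cs)" by (cases p)
    from nz have "(\<Sum>n\<le>length cs. f (v, take n cs) * g (path_end v (take n cs), drop n cs)) \<noteq> 0"
      by (simp add: p path_mul_def split: if_splits)
    then obtain n where "f (v, take n cs) * g (path_end v (take n cs), drop n cs) \<noteq> 0"
      by (meson sum.not_neutral_contains_not_neutral)
    then show ?thesis
      by (intro image_eqI[of _ _ "((v, take n cs), (path_end v (take n cs), drop n cs))"]) (auto simp: p)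
  qed
  then have "{p. path_mul m f g p \<noteq> 0} \<subseteq> ?S" by blast
  then have "finite {p. path_mul m f g p \<noteq> 0}"
    by (rule finite_subset) (use f g in \<open>auto simp: path_alg_carrier_def\<close>)
  then show ?thesis
    by (auto simp: path_alg_carrier_def path_mul_def)
qed

lemma path_mul_diff:
  "path_mul m (\<lambda>p. f p - f' p) g = (\<lambda>p. path_mul m f g p - path_mul m f' g p)"
  by (auto simp: path_mul_def fun_eq_iff left_diff_distrib sum_subtractf)

lemma path_mul_path_elem:
  fixes v :: nat
  assumes "valid_path m (v, as @ bs)"
  shows "path_mul m (path_elem (v, as)) (path_elem (path_end v as, bs)) = (path_elem (v, as @ bs) :: _ \<Rightarrow> 'b::field)"
proof
  fix p :: "nat \<times> arrow list"
  obtain u cs where p: "p = (u, cs)" by (cases p)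
  show "path_mul m (path_elem (v, as)) (path_elem (path_end v as, bs)) p = (path_elem (v, as @ bs) p :: 'b)"
  proof (cases "u = v \<and> cs = as @ bs")
    case True
    have eq: "path_elem (v, as) (v, take n (as @ bs)) * path_elem (path_end v as, bs)
            (path_end v (take n (as @ bs)), drop n (as @ bs)) = (if n = length as then 1 else 0 :: 'b)"
      if "n \<le> length (as @ bs)" for n
    proof (cases "n = length as")
      case False
      then have "length (take n (as @ bs)) \<noteq> length as" using that by auto
      then have "take n (as @ bs) \<noteq> as" by metis
      then show ?thesis using False by (simp add: path_elem_def)
    qed (simp add: path_elem_def)
    have "path_mul m (path_elem (v, as)) (path_elem (path_end v as, bs)) p
        = (\<Sum>n\<le>length (as @ bs). if n = length as then 1 else 0 :: 'b)"
    proof -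
      have "path_mul m (path_elem (v, as)) (path_elem (path_end v as, bs)) p
          = (\<Sum>n\<le>length (as @ bs). path_elem (v, as) (v, take n (as @ bs)) * path_elem (path_end v as, bs)
            (path_end v (take n (as @ bs)), drop n (as @ bs)) :: 'b)"
        using True assms by (simp only: p path_mul_def prod.case if_True)
      also have "\<dots> = (\<Sum>n\<le>length (as @ bs). if n = length as then 1 else 0)"
        by (intro sum.cong refl eq) simp
      finally show ?thesis .
    qed
    then show ?thesis by (simp add: p True path_elem_def)
  next
    case False
    have zero: "path_elem (v, as) (u, take n cs) * path_elem (path_end v as, bs) (path_end u (take n cs), drop n cs) = (0 :: 'b)"
      for n
    proof (cases "u = v \<and> take n cs = as")
      case True
      then have "drop n cs \<noteq> bs" using False append_take_drop_id[of n cs] by auto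
      then show ?thesis by (simp add: path_elem_def)
    qed (auto simp: path_elem_def)
    show ?thesis using False by (auto simp: p path_mul_def zero path_elem_def[of "(v, as @ bs)"])
  qed
qed

text \<open>
  The sign \<open>(-1)^i\<close> on \<open>\<alpha>\<^sub>i\<close> turns \<open>LR = - RL\<close> into the relation
  \<open>\<beta>\<^sub>i \<alpha>\<^sub>i = \<alpha>\<^bsub>i+1\<^esub> \<beta>\<^bsub>i+1\<^esub>\<close>. Coordinates are
  indexed by the weight of the column, that is by the end vertex of a path.
\<close>

definition path_hom :: "nat \<Rightarrow> (nat \<times> arrow list \<Rightarrow> 'a::field) \<Rightarrow> bool list \<Rightarrow> bool list \<Rightarrow> 'a" where
  "path_hom d f = coord_mat d (\<lambda>i. f (i, [])) (\<lambda>i. (- 1) ^ i * f (i - 1, [Alpha i]))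
     (\<lambda>i. f (Suc i, [Beta (Suc i)]))
     (\<lambda>i. (- 1) ^ Suc i * (f (i, [Beta i, Alpha i]) + f (i, [Alpha (Suc i), Beta (Suc i)])))"

text \<open>The coordinates see only paths of length at most two, for which the sum over all cuts is
  short. The two loops at a vertex share a coordinate because the relations identify them; the sign
  in \<open>path_hom\<close> turns the minus of \<open>coord_mat_mult\<close> into this
  plus.\<close>

lemma path_hom_mul:
  assumes "of_nat d = (0 :: 'a::field)"
  shows "path_hom d (path_mul d f g) = amul (schur11 d) (path_hom d f) (path_hom d g :: _ \<Rightarrow> _ \<Rightarrow> 'a)"
  unfolding path_hom_def coord_mat_mult[OF assms]
proof (rule coord_mat_cong[OF assms], goal_cases)
  case (1 i)
  then show ?case by (simp add: path_mul_def)
next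
  case (2 i)
  then show ?case
    by (simp add: path_mul_def is_arrow_def numeral_eq_Suc lessThan_Suc_atMost[symmetric] algebra_simps)
next
  case (3 i)
  then show ?case
    by (simp add: path_mul_def is_arrow_def numeral_eq_Suc lessThan_Suc_atMost[symmetric] algebra_simps)
next
  case (4 i)
  then show ?case
    by (simp add: path_mul_def is_arrow_def numeral_eq_Suc lessThan_Suc_atMost[symmetric] algebra_simps)
qed

lemma path_hom_add: "path_hom d (\<lambda>p. f p + g p) = aadd (schur11 d) (path_hom d f) (path_hom d g)"
  by (simp add: path_hom_def coord_mat_add algebra_simps)

lemma path_hom_smult: "path_hom d (\<lambda>p. c * f p) = asmul (schur11 d) c (path_hom d f)"
  by (simp add: path_hom_def coord_mat_smult algebra_simps)

lemma path_hom_one: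
  assumes "of_nat d = (0 :: 'a::field)"
  shows "path_hom d (path_one d) = (aone (schur11 d) :: _ \<Rightarrow> _ \<Rightarrow> 'a)"
  unfolding path_hom_def coord_mat_one
  by (rule coord_mat_cong[OF assms]) (simp_all add: path_one_def)

text \<open>Combinations of paths that form a basis modulo the relations.\<close>

fun norm_elem :: "nat \<Rightarrow> (nat \<Rightarrow> 'a::field) \<Rightarrow> (nat \<Rightarrow> 'a) \<Rightarrow> (nat \<Rightarrow> 'a) \<Rightarrow> (nat \<Rightarrow> 'a)
    \<Rightarrow> nat \<times> arrow list \<Rightarrow> 'a" where
  "norm_elem m x y z w (v, []) = (if v \<le> m then x v else 0)"
| "norm_elem m x y z w (v, [Alpha i]) = (if i = Suc v \<and> i \<le> m then y i else 0)"
| "norm_elem m x y z w (v, [Beta i]) = (if v = i \<and> 1 \<le> i \<and> i \<le> m then z (i - 1) else 0)"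
| "norm_elem m x y z w (v, [Beta i, Alpha j]) = (if v = i \<and> j = i \<and> 1 \<le> i \<and> i < m then w i else 0)"
| "norm_elem m x y z w _ = 0"

lemma norm_elem_in_carrier: "norm_elem m x y z w \<in> path_alg_carrier m"
proof -
  let ?A = "Alpha ` {1..m} \<union> Beta ` {1..m}"
  have "p \<in> {..m} \<times> {as. set as \<subseteq> ?A \<and> length as \<le> 2}" if "norm_elem m x y z w p \<noteq> 0" for p
    using that by (induction m x y z w p rule: norm_elem.induct) (auto split: if_splits)
  then have "{p. norm_elem m x y z w p \<noteq> 0} \<subseteq> {..m} \<times> {as. set as \<subseteq> ?A \<and> length as \<le> 2}" by blast
  moreover have "finite ({..m} \<times> {as. set as \<subseteq> ?A \<and> length as \<le> 2})"
    by (intro finite_cartesian_product finite_lists_length_le) auto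
  moreover have "norm_elem m x y z w p = 0" if "\<not> valid_path m p" for p
    using that by (induction m x y z w p rule: norm_elem.induct) (auto simp: is_arrow_def)
  ultimately show ?thesis unfolding path_alg_carrier_def using finite_subset by blast
qed

lemma norm_elem_add:
  "norm_elem m x y z w p + norm_elem m x' y' z' w' p
    = norm_elem m (\<lambda>i. x i + x' i) (\<lambda>i. y i + y' i) (\<lambda>i. z i + z' i) (\<lambda>i. w i + w' i) p"
  by (cases "(m, x, y, z, w, p)" rule: norm_elem.cases) auto

lemma norm_elem_smult:
  "c * norm_elem m x y z w p
    = norm_elem m (\<lambda>i. c * x i) (\<lambda>i. c * y i) (\<lambda>i. c * z i) (\<lambda>i. c * w i) p"
  by (cases "(m, x, y, z, w, p)" rule: norm_elem.cases) auto

lemma path_hom_norm_elem: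
  assumes "of_nat d = (0 :: 'a::field)"
  shows "path_hom d (norm_elem d x y z w)
    = coord_mat d x (\<lambda>i. (- 1) ^ i * y i) z (\<lambda>i. (- 1) ^ Suc i * w i :: 'a)"
  unfolding path_hom_def by (rule coord_mat_cong[OF assms]) auto

lemma path_carrier_one: "(path_one m :: _ \<Rightarrow> 'a::field) \<in> path_alg_carrier m"
proof -
  have "{p. path_one m p \<noteq> (0 :: 'a)} \<subseteq> (\<lambda>v. (v, [])) ` {..m}"
    by (auto simp: path_one_def split: if_splits)
  then show ?thesis
    using finite_subset by (fastforce simp: path_alg_carrier_def path_one_def)
qed

lemma path_hom_in_carrier: "path_hom d f \<in> acarrier (schur11 d)"
  by (simp add: path_hom_def coord_mat_in_carrier)

text \<open>The end loops affect only \<open>w 0\<close> and \<open>w d\<close>, which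
  \<open>coord_mat_cong\<close> ignores; in the commutation relation the two loops cancel;
  \<alpha>\<alpha> and \<beta>\<beta> have no coordinate at all.\<close>

lemma path_hom_rels:
  assumes d: "of_nat d = (0 :: 'a::field)" and f: "f \<in> atilde_rels d"
  shows "path_hom d f = (\<lambda>_ _. 0 :: 'a)"
proof -
  have "path_hom d f = coord_mat d (\<lambda>_. 0) (\<lambda>_. 0) (\<lambda>_. 0) (\<lambda>_. 0)"
    unfolding path_hom_def
    by (rule coord_mat_cong[OF d]) (use f in \<open>auto simp: atilde_rels_def path_elem_def\<close>)
  also have "\<dots> = (\<lambda>_ _. 0)" by (auto simp: coord_mat_def fun_eq_iff)
  finally show ?thesis .
qed

lemma atilde_rels_carrier: "1 \<le> m \<Longrightarrow> (atilde_rels m :: (_ \<Rightarrow> 'a::field) set) \<subseteq> path_alg_carrier m"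
proof
  fix f :: "nat \<times> arrow list \<Rightarrow> 'a" assume m: "1 \<le> m" and f: "f \<in> atilde_rels m"
  have diff: "(\<lambda>p. g p - h p) \<in> path_alg_carrier m" if "g \<in> path_alg_carrier m" "h \<in> path_alg_carrier m"
    for g h :: "nat \<times> arrow list \<Rightarrow> 'a"
    using path_carrier_add[OF that(1) path_carrier_smult[OF that(2), of "-1"]] by simp
  show "f \<in> path_alg_carrier m"
    using f m unfolding atilde_rels_def
    by (auto intro!: path_elem_in_carrier diff simp: is_arrow_def)
qed

text \<open>The generated ideal is an intersection, so membership in it has to be derived in an
  arbitrary ideal that contains the relations.\<close>

locale relation_ideal =
  fixes m :: nat and I :: "(nat \<times> arrow list \<Rightarrow> 'a::field) set"
  assumes m: "1 \<le> m" and ideal: "is_ideal (path_alg m) I" and rels: "atilde_rels m \<subseteq> I"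
begin

lemma
  shows zero: "(\<lambda>_. 0) \<in> I"
    and add: "f \<in> I \<Longrightarrow> g \<in> I \<Longrightarrow> (\<lambda>p. f p + g p) \<in> I"
    and smult: "f \<in> I \<Longrightarrow> (\<lambda>p. c * f p) \<in> I"
    and mul_left: "f \<in> path_alg_carrier m \<Longrightarrow> g \<in> I \<Longrightarrow> path_mul m f g \<in> I"
    and mul_right: "f \<in> I \<Longrightarrow> g \<in> path_alg_carrier m \<Longrightarrow> path_mul m f g \<in> I"
  using ideal by (auto simp: is_ideal_def path_alg_def)

lemma diff: "f \<in> I \<Longrightarrow> g \<in> I \<Longrightarrow> (\<lambda>p. f p - g p) \<in> I"
  using add[of f "\<lambda>p. (-1) * g p"] smult[of g "-1"] by simp

lemma append_left:
  assumes "valid_path m (v, as @ bs)" "path_elem (path_end v as, bs) \<in> I"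
  shows "path_elem (v, as @ bs) \<in> I"
  using mul_left[OF path_elem_in_carrier[of m "(v, as)"] assms(2)] path_mul_path_elem[OF assms(1), where ?'b = 'a] assms(1)
  by (simp add: valid_path_append)

lemma append_right:
  assumes "valid_path m (v, as @ bs)" "path_elem (v, as) \<in> I"
  shows "path_elem (v, as @ bs) \<in> I"
  using mul_right[OF assms(2) path_elem_in_carrier[of m "(path_end v as, bs)"]] path_mul_path_elem[OF assms(1), where ?'b = 'a] assms(1)
  by (simp add: valid_path_append)

lemma alpha_alpha:
  assumes "1 \<le> i" "i < m"
  shows "path_elem (i - 1, [Alpha i, Alpha (Suc i)]) \<in> I"
proof -
  have "i \<le> m - 1" using assms by simp
  then show ?thesis using rels assms(1) unfolding atilde_rels_def by blast
qed

lemma beta_beta: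
  assumes "1 \<le> i" "i < m"
  shows "path_elem (Suc i, [Beta (Suc i), Beta i]) \<in> I"
proof -
  have "i \<le> m - 1" using assms by simp
  then show ?thesis using rels assms(1) unfolding atilde_rels_def by blast
qed

lemma ends: "path_elem (0, [Alpha 1, Beta 1]) \<in> I" "path_elem (m, [Beta m, Alpha m]) \<in> I"
  using rels by (auto simp: atilde_rels_def)

lemma loops:
  assumes "1 \<le> i" "i < m"
  shows "(\<lambda>p. path_elem (i, [Beta i, Alpha i]) p - path_elem (i, [Alpha (Suc i), Beta (Suc i)]) p) \<in> I"
proof -
  have "i \<le> m - 1" using assms by simp
  then show ?thesis using rels assms(1) unfolding atilde_rels_def by blast
qed

text \<open>The commutation relation multiplied by \<open>a\<close> on the right.\<close>

lemma loop_extend: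
  assumes "1 \<le> i" "i < m" "is_arrow m a" "arr_src a = i"
  shows "path_elem (i, [Beta i, Alpha i, a]) \<in> I \<longleftrightarrow> path_elem (i, [Alpha (Suc i), Beta (Suc i), a]) \<in> I"
proof -
  have a: "valid_path m (i, [a])" using assms by (cases a) (auto simp: is_arrow_def)
  have v: "valid_path m (i, [Beta i, Alpha i] @ [a])" "valid_path m (i, [Alpha (Suc i), Beta (Suc i)] @ [a])"
    using a assms by (auto simp: is_arrow_def)
  have "path_mul m (\<lambda>p. path_elem (i, [Beta i, Alpha i]) p - path_elem (i, [Alpha (Suc i), Beta (Suc i)]) p)
      (path_elem (i, [a])) \<in> I"
    by (rule mul_right[OF loops[OF assms(1,2)] path_elem_in_carrier[OF a]])
  then have D: "(\<lambda>p. path_elem (i, [Beta i, Alpha i, a]) p - path_elem (i, [Alpha (Suc i), Beta (Suc i), a]) p) \<in> I"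
    using path_mul_path_elem[OF v(1), where ?'b = 'a] path_mul_path_elem[OF v(2), where ?'b = 'a]
    by (simp add: path_mul_diff)
  show ?thesis
    using add[OF D, of "path_elem (i, [Alpha (Suc i), Beta (Suc i), a])"]
      diff[OF _ D, of "path_elem (i, [Beta i, Alpha i, a])"] by auto
qed

text \<open>Such a path contains \<alpha>\<alpha>, \<beta>\<beta> or an end loop, or comes to
  contain one when the loop on its first two arrows is exchanged: \<alpha>\<beta>\<alpha> becomes
  \<beta>\<alpha>\<alpha>, and \<beta>\<alpha>\<beta> becomes \<alpha>\<beta>\<beta>.\<close>

lemma three_arrows:
  assumes valid: "valid_path m (v, [a, b, c])"
  shows "path_elem (v, [a, b, c]) \<in> I"
proof -
  have left: "path_elem (v, [a, b, c]) \<in> I" if "path_elem (v, [a, b]) \<in> I"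
    using append_right[of v "[a, b]" "[c]"] that valid by simp
  have right: "path_elem (v, [a, b, c]) \<in> I" if "path_elem (arr_tgt a, [b, c]) \<in> I"
    using append_left[of v "[a]" "[b, c]"] that valid by simp
  consider (aa) i where "a = Alpha i" "b = Alpha (Suc i)" "v = i - 1" "1 \<le> i" "i < m"
    | (bb) i where "a = Beta (Suc i)" "b = Beta i" "v = Suc i" "1 \<le> i" "i < m"
    | (ab) i where "a = Alpha (Suc i)" "b = Beta (Suc i)" "v = i" "i < m"
    | (ba) i where "a = Beta i" "b = Alpha i" "v = i" "1 \<le> i" "i \<le> m"
  proof -
    have "valid_path m (v, [a, b])" using valid by simp
    then show thesis
      using that(2)[of "v - 1"]
      by (cases a; cases b) (auto simp: is_arrow_def Suc_le_eq intro: that(1,3,4) dest!: gr0_implies_Suc)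
  qed
  then show ?thesis
  proof cases
    case (aa i)
    then show ?thesis using left alpha_alpha by simp
  next
    case (bb i)
    then show ?thesis using left beta_beta by simp
  next
    case (ab i)
    show ?thesis
    proof (cases "i = 0")
      case True
      then show ?thesis using left ab ends(1) by simp
    next
      case False
      then have i: "1 \<le> i" by simp
      show ?thesis
      proof (cases c)
        case (Alpha j)
        then have j: "c = Alpha (Suc i)" using valid ab by (auto simp: is_arrow_def)
        have "path_elem (i, [Beta i] @ [Alpha i, Alpha (Suc i)]) \<in> I"
          by (rule append_left) (use i ab alpha_alpha[OF i] in \<open>auto simp: is_arrow_def\<close>)
        then show ?thesis
          using loop_extend[of i c] i ab j by (simp add: is_arrow_def)
      next
        case (Beta j)
        then have "c = Beta i" using valid ab by (auto simp: is_arrow_def)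
        then show ?thesis using right ab beta_beta[of i] i by simp
      qed
    qed
  next
    case (ba i)
    show ?thesis
    proof (cases "i = m")
      case True
      then show ?thesis using left ba ends(2) by simp
    next
      case False
      then have i: "1 \<le> i" "i < m" using ba by auto
      show ?thesis
      proof (cases c)
        case (Alpha j)
        then have "c = Alpha (Suc i)" using valid ba by (auto simp: is_arrow_def)
        then show ?thesis using right ba alpha_alpha[OF i] by simp
      next
        case (Beta j)
        then have c: "c = Beta i" using valid ba by (auto simp: is_arrow_def)
        have "path_elem (i, [Alpha (Suc i)] @ [Beta (Suc i), Beta i]) \<in> I"
          by (rule append_left) (use i ba beta_beta[OF i] in \<open>auto simp: is_arrow_def\<close>)
        then show ?thesis
          using loop_extend[of i c] i ba c by (simp add: is_arrow_def)
      qed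
    qed
  qed
qed

text \<open>Paths of length at most one and the loops \<beta>\<alpha> at inner vertices are normal
  already, and \<alpha>\<beta> there is exchanged for \<beta>\<alpha>. Everything else lies in the
  ideal.\<close>

lemma path_elem_normal_form:
  assumes valid: "valid_path m p"
  shows "\<exists>x y z w. (\<lambda>q. path_elem p q - norm_elem m x y z w q) \<in> I"
proof -
  have nf: ?thesis if "path_elem p = (norm_elem m x y z w :: _ \<Rightarrow> 'a)" for x y z w
  proof -
    have "(\<lambda>q. path_elem p q - norm_elem m x y z w q) = (\<lambda>_. 0)" using that by simp
    then show ?thesis using zero by metis
  qed
  let ?\<delta> = "\<lambda>i j :: nat. if j = i then 1 else 0 :: 'a"
  have norm_0: "norm_elem m (\<lambda>_. 0) (\<lambda>_. 0) (\<lambda>_. 0) (\<lambda>_. 0) q = (0 :: 'a)" for q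
    using norm_elem_smult[of 0 m "\<lambda>_. 0" "\<lambda>_. 0" "\<lambda>_. 0" "\<lambda>_. 0" q] by simp
  have in_I: ?thesis if "path_elem p \<in> I"
  proof -
    have "(\<lambda>q. path_elem p q - norm_elem m (\<lambda>_. 0) (\<lambda>_. 0) (\<lambda>_. 0) (\<lambda>_. 0) q)
        = (path_elem p :: _ \<Rightarrow> 'a)"
      by (simp add: norm_0)
    then show ?thesis using that by metis
  qed
  obtain v as where p: "p = (v, as)" by (cases p)
  have norm_w: "norm_elem m (\<lambda>_. 0) (\<lambda>_. 0) (\<lambda>_. 0) (?\<delta> i) = path_elem (i, [Beta i, Alpha i])"
    if "1 \<le> i" "i < m" for i
  proof
    fix q show "norm_elem m (\<lambda>_. 0) (\<lambda>_. 0) (\<lambda>_. 0) (?\<delta> i) q = path_elem (i, [Beta i, Alpha i]) q"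
      using that
      by (cases "(m, \<lambda>_ :: nat. 0 :: 'a, \<lambda>_ :: nat. 0 :: 'a, \<lambda>_ :: nat. 0 :: 'a, ?\<delta> i, q)" rule: norm_elem.cases)
         (auto simp: path_elem_def)
  qed
  consider "as = []" | a where "as = [a]" | a b where "as = [a, b]" | a b c cs where "as = a # b # c # cs"
    by (metis list.exhaust)
  then show ?thesis
  proof cases
    case 1
    have "path_elem p q = norm_elem m (?\<delta> v) (\<lambda>_. 0) (\<lambda>_. 0) (\<lambda>_. 0) q" for q
      using valid
      by (cases "(m, ?\<delta> v, \<lambda>_ :: nat. 0 :: 'a, \<lambda>_ :: nat. 0 :: 'a, \<lambda>_ :: nat. 0 :: 'a, q)" rule: norm_elem.cases)
         (auto simp: p 1 path_elem_def)
    then show ?thesis by (rule nf[OF ext])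
  next
    case (2 a)
    show ?thesis
    proof (cases a)
      case (Alpha i)
      have "path_elem p q = norm_elem m (\<lambda>_. 0) (?\<delta> i) (\<lambda>_. 0) (\<lambda>_. 0) q" for q
        using valid
        by (cases "(m, \<lambda>_ :: nat. 0 :: 'a, ?\<delta> i, \<lambda>_ :: nat. 0 :: 'a, \<lambda>_ :: nat. 0 :: 'a, q)" rule: norm_elem.cases)
           (auto simp: p 2 Alpha path_elem_def is_arrow_def)
      then show ?thesis by (rule nf[OF ext])
    next
      case (Beta i)
      have "path_elem p q = norm_elem m (\<lambda>_. 0) (\<lambda>_. 0) (?\<delta> (i - 1)) (\<lambda>_. 0) q" for q
        using valid
        by (cases "(m, \<lambda>_ :: nat. 0 :: 'a, \<lambda>_ :: nat. 0 :: 'a, ?\<delta> (i - 1), \<lambda>_ :: nat. 0 :: 'a, q)" rule: norm_elem.cases)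
           (auto simp: p 2 Beta path_elem_def is_arrow_def)
      then show ?thesis by (rule nf[OF ext])
    qed
  next
    case (3 a b)
    show ?thesis
    proof (cases a)
      case (Alpha i)
      show ?thesis
      proof (cases b)
        case (Alpha j)
        then show ?thesis
          using in_I alpha_alpha[of i] valid \<open>a = Alpha i\<close> by (auto simp: p 3 is_arrow_def)
      next
        case (Beta j)
        then have ij: "j = i" "v = i - 1" "1 \<le> i" "i \<le> m"
          using valid \<open>a = Alpha i\<close> by (auto simp: p 3 is_arrow_def)
        show ?thesis
        proof (cases "i = 1")
          case True
          then show ?thesis using in_I ends(1) ij \<open>a = Alpha i\<close> Beta by (simp add: p 3)
        next
          case False
          then have i: "1 \<le> i - 1" "i - 1 < m" "Suc (i - 1) = i" using ij by auto
          have "(\<lambda>q. path_elem p q - norm_elem m (\<lambda>_. 0) (\<lambda>_. 0) (\<lambda>_. 0) (?\<delta> (i - 1)) q) \<in> I"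
            using smult[OF loops[OF i(1,2)], of "-1"] ij \<open>a = Alpha i\<close> Beta
            unfolding norm_w[OF i(1,2)] i(3) by (simp add: p 3)
          then show ?thesis by blast
        qed
      qed
    next
      case (Beta i)
      show ?thesis
      proof (cases b)
        case (Alpha j)
        then have ij: "j = i" "v = i" "1 \<le> i" "i \<le> m"
          using valid \<open>a = Beta i\<close> by (auto simp: p 3 is_arrow_def)
        show ?thesis
        proof (cases "i = m")
          case True
          then show ?thesis using in_I ends(2) ij \<open>a = Beta i\<close> Alpha by (simp add: p 3)
        next
          case False
          then have "path_elem p = norm_elem m (\<lambda>_. 0) (\<lambda>_. 0) (\<lambda>_. 0) (?\<delta> i)"
            using norm_w[of i] ij \<open>a = Beta i\<close> Alpha by (simp add: p 3)
          then show ?thesis by (rule nf)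
        qed
      next
        case (Beta j)
        then show ?thesis
          using in_I beta_beta[of j] valid \<open>a = Beta i\<close> by (auto simp: p 3 is_arrow_def)
      qed
    qed
  next
    case (4 a b c cs)
    then have "valid_path m (v, [a, b, c] @ cs)" using valid by (simp add: p)
    then have "path_elem (v, [a, b, c] @ cs) \<in> I"
      using append_right three_arrows by (metis valid_path_append)
    then show ?thesis using in_I by (simp add: p 4)
  qed
qed

lemma normal_form:
  assumes f: "f \<in> path_alg_carrier m"
  shows "\<exists>x y z w. (\<lambda>p. f p - norm_elem m x y z w p) \<in> I"
proof -
  have "finite {p. f p \<noteq> 0}" using f by (simp add: path_alg_carrier_def)
  then show ?thesis using f
  proof (induction "{p. f p \<noteq> 0}" arbitrary: f rule: finite_induct)
    case empty
    then have "f = (\<lambda>_. 0)" by auto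
    moreover have "norm_elem m (\<lambda>_. 0) (\<lambda>_. 0) (\<lambda>_. 0) (\<lambda>_. 0) q = (0 :: 'a)" for q
      using norm_elem_smult[of 0 m "\<lambda>_. 0" "\<lambda>_. 0" "\<lambda>_. 0" "\<lambda>_. 0" q] by simp
    ultimately have "(\<lambda>q. f q - norm_elem m (\<lambda>_. 0) (\<lambda>_. 0) (\<lambda>_. 0) (\<lambda>_. 0) q) = (\<lambda>_. 0)" by simp
    then show ?case using zero by metis
  next
    case (insert p S)
    define g where "g = f(p := 0)"
    have S: "S = {q. g q \<noteq> 0}" using insert.hyps(2,4) by (auto simp: g_def)
    have "finite {q. g q \<noteq> 0}" using insert.hyps(1) S by simp
    then have "g \<in> path_alg_carrier m"
      using insert.prems by (simp add: path_alg_carrier_def g_def)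
    then obtain x y z w where nf: "(\<lambda>q. g q - norm_elem m x y z w q) \<in> I"
      using insert.hyps(3)[OF S] by blast
    have "f p \<noteq> 0" using insert.hyps(4) by blast
    then have "valid_path m p" using insert.prems unfolding path_alg_carrier_def by blast
    then obtain x' y' z' w' where nf': "(\<lambda>q. path_elem p q - norm_elem m x' y' z' w' q) \<in> I"
      using path_elem_normal_form by blast
    let ?n = "norm_elem m (\<lambda>i. x i + f p * x' i) (\<lambda>i. y i + f p * y' i) (\<lambda>i. z i + f p * z' i)
      (\<lambda>i. w i + f p * w' i)"
    have "(\<lambda>q. f q - ?n q)
        = (\<lambda>q. (g q - norm_elem m x y z w q) + f p * (path_elem p q - norm_elem m x' y' z' w' q))"
      by (simp add: fun_eq_iff norm_elem_add[symmetric] norm_elem_smult[symmetric] g_def path_elem_def algebra_simps)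
    then have "(\<lambda>q. f q - ?n q) \<in> I"
      using add[OF nf smult[OF nf', of "f p"]] by (simp only:)
    then show ?case by blast
  qed
qed

end

text \<open>For the hard inclusion, an element of the kernel is reduced to a normal form modulo the
  relations. The normal form is in the kernel too, and since its coordinates are independent it is
  zero.\<close>

lemma gen_ideal_atilde:
  assumes d: "of_nat d = (0 :: 'a::field)" and d1: "1 \<le> d"
  shows "gen_ideal (path_alg d) (atilde_rels d)
    = {f \<in> path_alg_carrier d. path_hom d f = (\<lambda>_ _. 0 :: 'a)}" (is "_ = ?ker")
proof
  have zero: "coord_mat d (\<lambda>_. 0) (\<lambda>_. 0) (\<lambda>_. 0) (\<lambda>_. 0) = (\<lambda>_ _. 0 :: 'a)"
    by (auto simp: coord_mat_def fun_eq_iff)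
  have "is_ideal (path_alg d) ?ker"
  proof -
    have "(\<lambda>_. 0) \<in> ?ker" by (simp add: path_alg_carrier_def path_hom_def zero)
    moreover have "(\<lambda>p. f p + g p) \<in> ?ker" if "f \<in> ?ker" "g \<in> ?ker" for f g
      using that by (simp add: path_carrier_add path_hom_add) (simp add: schur11_def)
    moreover have "(\<lambda>p. c * f p) \<in> ?ker" if "f \<in> ?ker" for c f
      using that by (simp add: path_carrier_smult path_hom_smult) (simp add: schur11_def)
    moreover have "path_mul d f g \<in> ?ker" "path_mul d g f \<in> ?ker" if "f \<in> path_alg_carrier d" "g \<in> ?ker" for f g
      using that by (simp_all add: path_carrier_mul path_hom_mul[OF d]) (simp_all add: schur11_def fun_eq_iff)
    ultimately show ?thesis by (auto simp: is_ideal_def path_alg_def)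
  qed
  then show "gen_ideal (path_alg d) (atilde_rels d) \<subseteq> ?ker"
    using path_hom_rels[OF d] atilde_rels_carrier[OF d1] unfolding gen_ideal_def by blast
  show "?ker \<subseteq> gen_ideal (path_alg d) (atilde_rels d)"
    unfolding gen_ideal_def
  proof (intro subsetI InterI, clarify)
    fix f :: "nat \<times> arrow list \<Rightarrow> 'a" and I :: "(nat \<times> arrow list \<Rightarrow> 'a) set"
    assume f: "f \<in> path_alg_carrier d" "path_hom d f = (\<lambda>_ _. 0)"
      and I: "is_ideal (path_alg d) I" "atilde_rels d \<subseteq> I"
    \<comment> \<open>Intersecting with the kernel makes \<open>f\<close> differ from its normal
      form by an element of both ideals.\<close>
    let ?I = "I \<inter> ?ker"
    interpret relation_ideal d ?I
    proof
      show "is_ideal (path_alg d) ?I"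
        using I(1) \<open>is_ideal (path_alg d) ?ker\<close> by (auto simp: is_ideal_def)
      show "atilde_rels d \<subseteq> ?I"
        using I(2) path_hom_rels[OF d] atilde_rels_carrier[OF d1] by blast
    qed (use d1 in auto)
    obtain x y z w where nf: "(\<lambda>p. f p - norm_elem d x y z w p) \<in> ?I"
      using normal_form[OF f(1)] by blast
    let ?n = "norm_elem d x y z w"
    have "path_hom d f = path_hom d (\<lambda>p. (f p - ?n p) + ?n p)" by simp
    also have "\<dots> = aadd (schur11 d) (\<lambda>_ _. 0) (path_hom d ?n)"
      unfolding path_hom_add using nf by simp
    finally have "path_hom d ?n = (\<lambda>_ _. 0)"
      using f(2) by (simp add: schur11_def)
    \<comment> \<open>\<open>norm_elem\<close> reads \<open>w\<close> only strictly between 0 and d,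
      so the end values may be set to 0, as \<open>coord_mat_eq_0\<close> demands.\<close>
    define w' where "w' i = (if 0 < i \<and> i < d then w i else 0)" for i
    have n: "?n = norm_elem d x y z w'"
    proof
      fix p show "norm_elem d x y z w p = norm_elem d x y z w' p"
        by (cases "(d, x, y, z, w, p)" rule: norm_elem.cases) (auto simp: w'_def)
    qed
    have "coord_mat d x (\<lambda>i. (- 1) ^ i * y i) z (\<lambda>i. (- 1) ^ Suc i * w' i) = (\<lambda>_ _. 0)"
      using \<open>path_hom d ?n = _\<close> unfolding n path_hom_norm_elem[OF d] .
    from coord_mat_eq_0[OF this]
    have 0: "i \<le> d \<Longrightarrow> x i = 0" "i < d \<Longrightarrow> y (Suc i) = 0" "i < d \<Longrightarrow> z i = 0" "i < d \<Longrightarrow> w' i = 0" for i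
      by (auto simp: w'_def)
    have "?n p = 0" for p
      unfolding n
      by (cases "(d, x, y, z, w', p)" rule: norm_elem.cases)
         (use 0 in \<open>auto simp: Suc_le_eq dest!: gr0_implies_Suc\<close>)
    then show "f \<in> I" using nf by simp
  qed
qed

lemma schur11_iso_atilde:
  assumes d: "of_nat d = (0 :: 'a::field)" and d1: "1 \<le> d" and two: "(2 :: 'a) \<noteq> 0"
  shows "alg_iso (schur11 d :: ('a, _) kalg) (atilde d :: ('a, _) kalg)"
  unfolding atilde_def
proof (rule alg_iso_quot_alg[where \<Phi> = "path_hom d"])
  fix M assume "M \<in> acarrier (schur11 d :: ('a, _) kalg)"
  then obtain x y z w where M: "M = coord_mat d x y z w" using two by (rule schur11_coord_mat)
  \<comment> \<open>The signs undo those of \<open>path_hom_norm_elem\<close>.\<close>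
  have "path_hom d (norm_elem d x (\<lambda>i. (-1) ^ i * y i) z (\<lambda>i. (-1) ^ Suc i * w i)) = M"
    unfolding path_hom_norm_elem[OF d] M by (simp flip: mult.assoc power_mult_distrib)
  then show "\<exists>f\<in>acarrier (path_alg d). path_hom d f = M"
    using norm_elem_in_carrier by (fastforce simp: path_alg_def)
next
  fix f g :: "nat \<times> arrow list \<Rightarrow> 'a"
  assume f: "f \<in> acarrier (path_alg d)" and g: "g \<in> acarrier (path_alg d)"
  have fg: "(\<lambda>p. g p + - 1 * f p) \<in> path_alg_carrier d"
    using path_carrier_add path_carrier_smult[of f d "-1"] f g by (fastforce simp: path_alg_def)
  show "(aadd (path_alg d) g (asmul (path_alg d) (- 1) f) \<in> gen_ideal (path_alg d) (atilde_rels d))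
      = (path_hom d g = path_hom d f)"
  proof -
    have "path_hom d (\<lambda>p. g p + - 1 * f p) = aadd (schur11 d) (path_hom d g) (asmul (schur11 d) (- 1) (path_hom d f))"
      by (simp only: path_hom_add path_hom_smult)
    also have "\<dots> = (\<lambda>u v. path_hom d g u v - path_hom d f u v)"
      by (simp add: schur11_def)
    finally have "path_hom d (\<lambda>p. g p + - 1 * f p) = (\<lambda>_ _. 0) \<longleftrightarrow> path_hom d g = path_hom d f"
      by (simp add: fun_eq_iff)
    then show ?thesis
      using fg unfolding gen_ideal_atilde[OF d d1] by (simp add: path_alg_def)
  qed
qed (auto simp: path_alg_def path_carrier_add path_carrier_smult path_carrier_mul path_hom_add path_hom_smult
  path_hom_mul[OF d] path_hom_one[OF d] path_hom_in_carrier path_carrier_one)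

section \<open>Splitting off a thin summand\<close>

text \<open>Source of the functionals that split off a summand, in any dimension: take an
  independent subset of \<open>G\<close> with the same span, adjoin \<open>x\<close>, prescribe the
  values and extend linearly.\<close>

lemma (in vector_space) exists_functional:
  assumes "x \<notin> span G"
  shows "\<exists>\<phi> :: 'b \<Rightarrow> 'a. (\<forall>u v. \<phi> (u + v) = \<phi> u + \<phi> v) \<and> (\<forall>c v. \<phi> (scale c v) = c * \<phi> v)
    \<and> \<phi> x = 1 \<and> (\<forall>g\<in>G. \<phi> g = 0)"
proof -
  interpret field: vector_space "(*) :: 'a \<Rightarrow> 'a \<Rightarrow> 'a"
    by unfold_locales (auto simp: algebra_simps)
  interpret vector_space_pair scale "(*) :: 'a \<Rightarrow> 'a \<Rightarrow> 'a" ..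
  obtain B where B: "B \<subseteq> G" "independent B" "G \<subseteq> span B"
    by (rule maximal_independent_subset)
  have "span B \<subseteq> span G" using B(1) by (rule span_mono)
  then have "independent (insert x B)"
    using B(2) assms by (intro independent_insertI) auto
  then obtain \<phi> where lin: "Vector_Spaces.linear scale (*) \<phi>"
    and \<phi>: "\<forall>y\<in>insert x B. \<phi> y = (if y = x then 1 else 0)"
    using linear_independent_extend[of "insert x B" "\<lambda>y. if y = x then 1 else 0"] by blast
  interpret \<phi>: Vector_Spaces.linear scale "(*)" \<phi> by (rule lin)
  have "\<phi> b = 0" if "b \<in> B" for b
    using \<phi> that assms B(1) span_base by auto
  then have "\<phi> y = 0" if "y \<in> span B" for y
    using linear_eq_0_on_span[OF lin] that by blast
  then show ?thesis
    using \<phi> B(3) by (intro exI[of _ \<phi>]) (auto simp: \<phi>.add \<phi>.scale)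
qed

text \<open>Models matrices acting on infinite sequences, of which only the first n terms matter.
  There the projections \<pi> add up to truncation and not to the identity; \<open>F_decomp\<close>
  is what remains of the decomposition into degrees. \<open>E\<close> is the action of R, and
  \<open>F\<close> that of L with signs, so that they commute.\<close>

locale graded_module = vector_space scale
  for scale :: "'a::field \<Rightarrow> 'v::ab_group_add \<Rightarrow> 'v" (infixr "*s" 75) +
  fixes d :: nat and \<pi> :: "nat \<Rightarrow> 'v \<Rightarrow> 'v" and E F :: "'v \<Rightarrow> 'v"
  assumes \<pi>_add: "\<pi> i (x + y) = \<pi> i x + \<pi> i y" and \<pi>_scale: "\<pi> i (c *s x) = c *s \<pi> i x"
    and E_add: "E (x + y) = E x + E y" and E_scale: "E (c *s x) = c *s E x"
    and F_add: "F (x + y) = F x + F y" and F_scale: "F (c *s x) = c *s F x"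
    and \<pi>_\<pi>: "\<pi> i (\<pi> j x) = (if i = j then \<pi> i x else 0)"
    and \<pi>_big: "d < i \<Longrightarrow> \<pi> i x = 0"
    and \<pi>_E: "\<pi> (Suc i) (E x) = E (\<pi> i x)" and \<pi>_0_E: "\<pi> 0 (E x) = 0"
    and \<pi>_F: "\<pi> i (F x) = F (\<pi> (Suc i) x)" and F_\<pi>_0: "F (\<pi> 0 x) = 0"
    and EE: "E (E x) = 0" and FF: "F (F x) = 0" and EF: "E (F x) = F (E x)"
    and F_decomp: "F x = F (\<Sum>i\<le>d. \<pi> i x)"
begin

text \<open>
  The last two conditions say that the span of \<open>x\<close> and the common kernel of the functionals
  \<open>\<phi>\<close> are submodules; by duality of \<open>x\<close> and \<open>\<phi>\<close> they are complementary.
\<close>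

definition thin_datum :: "nat \<Rightarrow> (nat \<Rightarrow> 'v) \<Rightarrow> (nat \<Rightarrow> 'v \<Rightarrow> 'a) \<Rightarrow> bool" where
  "thin_datum N x \<phi> \<longleftrightarrow> 0 < N \<and> N \<le> d + 4
     \<and> (\<forall>k<N. (\<forall>u v. \<phi> k (u + v) = \<phi> k u + \<phi> k v) \<and> (\<forall>c v. \<phi> k (c *s v) = c * \<phi> k v))
     \<and> (\<forall>k<N. \<exists>i. \<pi> i (x k) = x k)
     \<and> (\<forall>k<N. \<forall>l<N. \<phi> k (x l) = (if k = l then 1 else 0))
     \<and> (\<forall>g\<in>range \<pi> \<union> {E, F}. \<forall>k<N. g (x k) = 0 \<or> (\<exists>l<N. g (x k) = x l))
     \<and> (\<forall>g\<in>range \<pi> \<union> {E, F}. \<forall>k<N. (\<forall>v. \<phi> k (g v) = 0) \<or> (\<exists>l<N. \<forall>v. \<phi> k (g v) = \<phi> l v))"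

lemma thin_datumD:
  assumes "thin_datum N x \<phi>"
  shows "0 < N" "N \<le> d + 4"
    and "k < N \<Longrightarrow> \<phi> k (u + v) = \<phi> k u + \<phi> k v" "k < N \<Longrightarrow> \<phi> k (c *s v) = c * \<phi> k v"
    and "k < N \<Longrightarrow> \<exists>i. \<pi> i (x k) = x k"
    and "k < N \<Longrightarrow> l < N \<Longrightarrow> \<phi> k (x l) = (if k = l then 1 else 0)"
    and "g \<in> range \<pi> \<union> {E, F} \<Longrightarrow> k < N \<Longrightarrow> g (x k) = 0 \<or> (\<exists>l<N. g (x k) = x l)"
    and "g \<in> range \<pi> \<union> {E, F} \<Longrightarrow> k < N \<Longrightarrow> (\<forall>v. \<phi> k (g v) = 0) \<or> (\<exists>l<N. \<forall>v. \<phi> k (g v) = \<phi> l v)"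
  using assms unfolding thin_datum_def by (elim conjE, simp only: simp_thms; blast)+

lemma \<pi>_0 [simp]: "\<pi> i 0 = 0" and E_0 [simp]: "E 0 = 0" and F_0 [simp]: "F 0 = 0"
  using \<pi>_add[of i 0 0] E_add[of 0 0] F_add[of 0 0] by simp_all

lemma \<pi>_diff: "\<pi> i (x - y) = \<pi> i x - \<pi> i y" and E_diff: "E (x - y) = E x - E y" and F_diff: "F (x - y) = F x - F y"
  using \<pi>_add[of i "x - y" y] E_add[of "x - y" y] F_add[of "x - y" y] by (simp_all add: algebra_simps)

lemma E_sum: "E (\<Sum>i\<in>I. f i) = (\<Sum>i\<in>I. E (f i))" and F_sum: "F (\<Sum>i\<in>I. f i) = (\<Sum>i\<in>I. F (f i))"
  by (induction I rule: infinite_finite_induct) (simp_all add: E_add F_add)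

lemma homogeneous: "\<pi> i u = u \<Longrightarrow> \<pi> j u = (if j = i then u else 0)"
  by (metis \<pi>_\<pi>)

text \<open>A functional detecting \<open>E (F v)\<close>, pulled back along EF, F, E and the
  identity, is dual to v, Ev, Fv, EFv up to the correction made below. Both families are closed
  under the operators because E^2 = F^2 = 0 and EF = FE.\<close>

lemma square_datum:
  assumes v: "\<pi> i v = v" and nz: "E (F v) \<noteq> 0"
  shows "\<exists>N x \<phi>. thin_datum N x \<phi>"
proof -
  have EF_\<pi>: "\<pi> j (E (F x)) = E (F (\<pi> j x))" for j x
    by (cases j) (simp_all add: \<pi>_E \<pi>_F \<pi>_0_E F_\<pi>_0)
  obtain \<psi> :: "'v \<Rightarrow> 'a" where \<psi>: "\<And>u v. \<psi> (u + v) = \<psi> u + \<psi> v" "\<And>c v. \<psi> (c *s v) = c * \<psi> v"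
    "\<psi> (E (F v)) = 1"
    using exists_functional[of "E (F v)" "{}"] nz by auto
  \<comment> \<open>Composing with the projection makes the functional homogeneous: followed by any
    \<pi> it becomes itself or zero.\<close>
  define \<phi> where "\<phi> u = \<psi> (\<pi> i u)" for u
  have \<phi>: "\<phi> (u + v) = \<phi> u + \<phi> v" "\<phi> (c *s v) = c * \<phi> v" for u v c
    by (simp_all add: \<phi>_def \<pi>_add \<pi>_scale \<psi>)
  have \<phi>1: "\<phi> (E (F v)) = 1" by (simp add: \<phi>_def EF_\<pi> v \<psi>)
  have \<phi>_\<pi>: "\<phi> (\<pi> j u) = (if j = i then \<phi> u else 0)" for j u
    using \<psi>(2)[of 0 0] by (simp add: \<phi>_def \<pi>_\<pi>)
  have \<phi>_0: "\<phi> 0 = 0" using \<phi>(2)[of 0 0] by simp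
  have \<phi>_diff: "\<phi> (u - w) = \<phi> u - \<phi> w" for u w using \<phi>(1)[of "u - w" w] by (simp add: algebra_simps)
  \<comment> \<open>corrects \<open>v\<close> so that the family \<open>v'\<close>, \<open>E v\<close>, \<open>F v\<close>, \<open>E (F v)\<close> is dual to the functionals\<close>
  define v' where "v' = v - \<phi> v *s E (F v)"
  have v': "\<phi> v' = 0" "E v' = E v" "F v' = F v" "\<pi> i v' = v'"
    by (simp_all add: v'_def \<phi>_diff \<phi> \<phi>1 E_diff E_scale EE F_diff F_scale FF \<pi>_diff \<pi>_scale EF_\<pi> v)
       (simp add: EF FF)
  have FEv: "F (E w) = E (F w)" for w by (simp add: EF)
  have \<pi>v: "\<pi> j v = (if j = i then v else 0)" "\<pi> j v' = (if j = i then v' else 0)" for j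
    using homogeneous v v'(4) by auto
  have \<phi>E: "\<phi> (E v) = 0"
    by (cases i) (use v in \<open>simp_all add: \<phi>_def \<pi>_E \<pi>_0_E \<pi>v \<psi>(2)[of 0 0, simplified]\<close>)
  have \<phi>F: "\<phi> (F v) = 0"
    by (simp add: \<phi>_def \<pi>_F \<pi>v \<psi>(2)[of 0 0, simplified])
  define x where "x = (!) [v', E v, F v, E (F v)]"
  define f where "f = (!) [\<lambda>u. \<phi> (E (F u)), \<lambda>u. \<phi> (F u), \<lambda>u. \<phi> (E u), \<phi>]"
  have all4: "(\<forall>k<4. P k) \<longleftrightarrow> P 0 \<and> P (Suc 0) \<and> P 2 \<and> P 3" and ex4: "(\<exists>k<4. P k) \<longleftrightarrow> P 0 \<or> P (Suc 0) \<or> P 2 \<or> P 3"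
    for P :: "nat \<Rightarrow> bool"
    by (auto simp: numeral_eq_Suc less_Suc_eq)
  have x: "x 0 = v'" "x (Suc 0) = E v" "x 2 = F v" "x 3 = E (F v)"
    and f: "f 0 = (\<lambda>u. \<phi> (E (F u)))" "f (Suc 0) = (\<lambda>u. \<phi> (F u))" "f 2 = (\<lambda>u. \<phi> (E u))" "f 3 = \<phi>"
    by (simp_all add: x_def f_def)
  have "i \<noteq> 0" using F_\<pi>_0[of v] v nz by (metis E_0)
  then obtain i' where i': "i = Suc i'" by (cases i) auto
  have EFF: "E (F (F w)) = 0" "F (E (F w)) = 0" "E (F (E w)) = 0" for w
    by (simp_all add: FF EE FEv)
  have F\<pi>: "F (\<pi> j w) = (if j = 0 then 0 else \<pi> (j - 1) (F w))" for j w
    by (cases j) (simp_all add: F_\<pi>_0 \<pi>_F)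
  have "thin_datum 4 x f"
    unfolding thin_datum_def all4 ex4 x f
  proof (intro conjI ballI)
    show "\<exists>j. \<pi> j (E v) = E v" using v by (intro exI[of _ "Suc i"]) (simp add: \<pi>_E)
    show "\<exists>j. \<pi> j (F v) = F v" using v by (intro exI[of _ i']) (simp add: \<pi>_F i')
    show "\<exists>j. \<pi> j (E (F v)) = E (F v)" using v by (intro exI[of _ i]) (simp add: EF_\<pi>)
    show "\<exists>j. \<pi> j v' = v'" using v' by blast
    fix g assume g: "g \<in> range \<pi> \<union> {E, F}"
    have \<pi>Ev: "\<pi> j (E v) = (if j = Suc i then E v else 0)" for j
      by (cases j) (auto simp: \<pi>_E \<pi>_0_E \<pi>v)
    have \<pi>Fv: "\<pi> j (F v) = (if Suc j = i then F v else 0)" for j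
      by (auto simp: \<pi>_F \<pi>v)
    show "g v' = 0 \<or> g v' = v' \<or> g v' = E v \<or> g v' = F v \<or> g v' = E (F v)"
      using g by (auto simp: \<pi>v v')
    show "g (E v) = 0 \<or> g (E v) = v' \<or> g (E v) = E v \<or> g (E v) = F v \<or> g (E v) = E (F v)"
      using g by (auto simp: \<pi>Ev EE FEv)
    show "g (F v) = 0 \<or> g (F v) = v' \<or> g (F v) = E v \<or> g (F v) = F v \<or> g (F v) = E (F v)"
      using g by (auto simp: \<pi>Fv FF)
    show "g (E (F v)) = 0 \<or> g (E (F v)) = v' \<or> g (E (F v)) = E v \<or> g (E (F v)) = F v \<or> g (E (F v)) = E (F v)"
      using g by (auto simp: EF_\<pi> \<pi>v EE EFF)
    show "(\<forall>u. \<phi> (E (F (g u))) = 0) \<or> (\<forall>u. \<phi> (E (F (g u))) = \<phi> (E (F u))) \<or> (\<forall>u. \<phi> (E (F (g u))) = \<phi> (F u))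
        \<or> (\<forall>u. \<phi> (E (F (g u))) = \<phi> (E u)) \<or> (\<forall>u. \<phi> (E (F (g u))) = \<phi> u)"
      using g by (auto simp: EF_\<pi>[symmetric] \<phi>_\<pi> EFF \<phi>_0)
    show "(\<forall>u. \<phi> (F (g u)) = 0) \<or> (\<forall>u. \<phi> (F (g u)) = \<phi> (E (F u))) \<or> (\<forall>u. \<phi> (F (g u)) = \<phi> (F u))
        \<or> (\<forall>u. \<phi> (F (g u)) = \<phi> (E u)) \<or> (\<forall>u. \<phi> (F (g u)) = \<phi> u)"
      using g by (auto simp: F\<pi> \<phi>_\<pi> FF \<phi>_0 FEv)
    show "(\<forall>u. \<phi> (E (g u)) = 0) \<or> (\<forall>u. \<phi> (E (g u)) = \<phi> (E (F u))) \<or> (\<forall>u. \<phi> (E (g u)) = \<phi> (F u))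
        \<or> (\<forall>u. \<phi> (E (g u)) = \<phi> (E u)) \<or> (\<forall>u. \<phi> (E (g u)) = \<phi> u)"
      using g by (auto simp: \<pi>_E[symmetric] \<phi>_\<pi> EE \<phi>_0)
    show "(\<forall>u. \<phi> (g u) = 0) \<or> (\<forall>u. \<phi> (g u) = \<phi> (E (F u))) \<or> (\<forall>u. \<phi> (g u) = \<phi> (F u))
        \<or> (\<forall>u. \<phi> (g u) = \<phi> (E u)) \<or> (\<forall>u. \<phi> (g u) = \<phi> u)"
      using g by (auto simp: \<phi>_\<pi>)
  qed (auto simp: \<phi> E_add E_scale F_add F_scale v' \<phi>1 \<phi>E \<phi>F EFF EE FF \<phi>_0 FEv)
  then show ?thesis by blast
qed

text \<open>Every composite of two operators now vanishes, so along a chain each degree is a source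
  or a sink and \<open>E\<close> alternates with \<open>F\<close>. Cutting the chain at the first
  length where one dies or none continues is what produces a functional splitting it off.\<close>

lemma zigzag_datum:
  assumes EF0: "\<And>x. E (F x) = 0" and nz: "\<exists>i v. \<pi> i v \<noteq> 0"
  shows "\<exists>N x \<phi>. thin_datum N x \<phi>"
proof -
  have FE0: "F (E x) = 0" for x using EF0 EF by metis
  define a where "a = (LEAST i. \<exists>v. \<pi> i v \<noteq> 0)"
  have a: "\<exists>v. \<pi> a v \<noteq> 0" using nz unfolding a_def by (rule LeastI_ex)
  have below: "\<pi> i v = 0" if "i < a" for i v
    using not_less_Least[of i "\<lambda>i. \<exists>v. \<pi> i v \<noteq> 0"] that a_def by auto
  \<comment> \<open>A zigzag starts at degree \<open>a\<close>, with a sink there if \<open>F\<close> reaches that degree and with a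
    source otherwise; \<open>src k\<close> tells whether the vertex of degree \<open>a + k\<close> is a source.\<close>
  define t where "t \<longleftrightarrow> (\<forall>v. F (\<pi> (Suc a) v) = 0)"
  define src where "src k \<longleftrightarrow> (even k \<longleftrightarrow> t)" for k :: nat
  have src_Suc: "src (Suc k) \<longleftrightarrow> \<not> src k" for k by (auto simp: src_def)
  have src_0: "src 0 \<longleftrightarrow> t" by (simp add: src_def)
  \<comment> \<open>A linear relation between neighbouring degrees: the graph of \<open>E\<close>
    out of a source, the converse of the graph of \<open>F\<close> into a sink.\<close>
  define rel where "rel k u v \<longleftrightarrow> \<pi> (a + k) u = u \<and> \<pi> (Suc (a + k)) v = v \<and> (if src k then E u = v else F v = u)"
    for k u v
  have rel_0: "rel k 0 0" for k by (simp add: rel_def)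
  have rel_add: "rel k (u + u') (v + v')" if "rel k u v" "rel k u' v'" for k u v u' v'
    using that by (auto simp: rel_def \<pi>_add E_add F_add)
  have rel_scale: "rel k (c *s u) (c *s v)" if "rel k u v" for k c u v
    using that by (auto simp: rel_def \<pi>_scale E_scale F_scale)
  define chain where "chain j c \<longleftrightarrow> \<pi> a (c 0) = c 0 \<and> (\<forall>k<j. rel k (c k) (c (Suc k)))" for j c
  have chain_wt: "\<pi> (a + k) (c k) = c k" if "chain j c" "k \<le> j" for j k c
    using that by (cases k) (auto simp: chain_def rel_def)
  \<comment> \<open>Chains of length \<open>Suc j\<close> from degree \<open>a\<close> behave differently from those of length \<open>j\<close>: either
    some of them die, or none survives.\<close>
  define Stop where "Stop j \<longleftrightarrow> (\<exists>c. chain (Suc j) c \<and> c (Suc j) = 0 \<and> c 0 \<noteq> 0) \<or> (\<forall>c. chain (Suc j) c \<longrightarrow> c 0 = 0)"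
    for j
  have "Stop d"
  proof -
    have "c (Suc d) = 0" if "chain (Suc d) c" for c
      using chain_wt[OF that, of "Suc d"] \<pi>_big[of "a + Suc d" "c (Suc d)"] by simp
    then show ?thesis unfolding Stop_def by blast
  qed
  define b where "b = (LEAST j. Stop j)"
  have "Stop b" unfolding b_def using \<open>Stop d\<close> by (rule LeastI)
  have not_Stop: "\<not> Stop j" if "j < b" for j
    using that unfolding b_def by (rule not_less_Least)
  \<comment> \<open>Otherwise \<open>b - 1\<close> would satisfy the first alternative of
    \<open>Stop\<close>; for \<open>b = 0\<close> the claim is trivial.\<close>
  have no_zero: "c 0 = 0" if "chain b c" "c b = 0" for c
    using not_Stop[of "b - 1"] that by (cases b) (auto simp: Stop_def)
  have ex_chain: "\<exists>c. chain b c \<and> c 0 \<noteq> 0"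
  proof (cases b)
    case 0
    obtain v where "\<pi> a v \<noteq> 0" using a by blast
    then show ?thesis
      by (intro exI[of _ "\<lambda>_. \<pi> a v"]) (simp add: chain_def 0 \<pi>_\<pi>)
  next
    case (Suc j)
    then show ?thesis using not_Stop[of j] by (auto simp: Stop_def)
  qed
  have extend: "chain (Suc b) (c(Suc b := v))" if "chain b c" "rel b (c b) v" for c v
    using that by (auto simp: chain_def less_Suc_eq)
  \<comment> \<open>What the functional must kill in the last degree: at a sink, everything that
    \<open>F\<close> brings in from beyond the chain.\<close>
  define Z where "Z = (if src b then {0} else {F z | z. \<pi> (Suc (a + b)) z = z})"
  obtain c where c: "chain b c" "c 0 \<noteq> 0" "src b \<Longrightarrow> E (c b) = 0"
    and Z: "\<And>c. chain b c \<Longrightarrow> c b \<in> Z \<Longrightarrow> c 0 = 0"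
  proof (cases "src b")
    case True
    \<comment> \<open>At a source \<open>E\<close> continues every chain, so stopping means that
      some chain with nonzero start is killed by the next \<open>E\<close>.\<close>
    obtain c where c: "chain b c" "c 0 \<noteq> 0" using ex_chain by blast
    then have "rel b (c b) (E (c b))"
      using chain_wt[OF c(1), of b] True by (auto simp: rel_def \<pi>_E)
    then have "chain (Suc b) (c(Suc b := E (c b)))" using extend c by blast
    then have "\<not> (\<forall>c. chain (Suc b) c \<longrightarrow> c 0 = 0)" using c(2) by (metis fun_upd_other nat.distinct(1))
    then obtain c where "chain (Suc b) c" "c (Suc b) = 0" "c 0 \<noteq> 0"
      using \<open>Stop b\<close> by (auto simp: Stop_def)
    moreover from this have "chain b c" "E (c b) = 0" using True by (auto simp: chain_def rel_def)
    ultimately show thesis using that no_zero True by (auto simp: Z_def)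
  next
    case False
    \<comment> \<open>At a sink, continuing by 0 forces \<open>c b = 0\<close>, which minimality
      excludes. So the second alternative of \<open>Stop\<close> holds: no chain with nonzero start
      continues.\<close>
    have "c 0 = 0" if "chain (Suc b) c" "c (Suc b) = 0" for c
    proof -
      have "chain b c" "F (c (Suc b)) = c b" using that(1) False by (auto simp: chain_def rel_def)
      then show ?thesis using no_zero that(2) by simp
    qed
    then have all: "c 0 = 0" if "chain (Suc b) c" for c
      using \<open>Stop b\<close> that by (auto simp: Stop_def)
    have "c 0 = 0" if c: "chain b c" "c b \<in> Z" for c
    proof -
      obtain z where "c b = F z" "\<pi> (Suc (a + b)) z = z" using c(2) False by (auto simp: Z_def)
      then have "rel b (c b) z" using chain_wt[OF c(1), of b] False by (auto simp: rel_def)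
      then show ?thesis using all[OF extend[OF c(1)]] by fastforce
    qed
    then show thesis using that ex_chain False by blast
  qed
  \<comment> \<open>A functional annihilating \<open>G\<close> is constant along chains. The predicate \<open>Q\<close> telescopes an
    element of the span of \<open>G\<close> into a chain, so that \<open>c 0\<close> in this span would contradict \<open>Z\<close>.\<close>
  define G where "G = {u - v | k u v. k < b \<and> rel k u v} \<union> Z"
  define Q where "Q y \<longleftrightarrow> (\<exists>v. v 0 = 0 \<and> (\<forall>k<b. rel k (\<pi> (a + k) y + v k) (v (Suc k))) \<and> \<pi> (a + b) y + v b \<in> Z)"
    for y
  have Z_0: "0 \<in> Z" unfolding Z_def by (auto intro!: exI[of _ 0])
  have Z_add: "y + y' \<in> Z" if "y \<in> Z" "y' \<in> Z" for y y'
    using that unfolding Z_def by (auto split: if_splits) (metis F_add \<pi>_add)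
  have Z_scale: "r *s y \<in> Z" if "y \<in> Z" for r y
    using that unfolding Z_def by (auto split: if_splits) (metis F_scale \<pi>_scale)
  have "subspace {y. Q y}"
  proof (rule subspaceI; clarsimp)
    show "Q 0" unfolding Q_def using Z_0 by (intro exI[of _ "\<lambda>_. 0"]) (simp add: rel_0)
  next
    fix x y assume "Q x" "Q y"
    then obtain v v' where v: "v 0 = 0" "\<forall>k<b. rel k (\<pi> (a + k) x + v k) (v (Suc k))" "\<pi> (a + b) x + v b \<in> Z"
      and v': "v' 0 = 0" "\<forall>k<b. rel k (\<pi> (a + k) y + v' k) (v' (Suc k))" "\<pi> (a + b) y + v' b \<in> Z"
      unfolding Q_def by blast
    have eq: "\<pi> (a + k) (x + y) + (v k + v' k) = (\<pi> (a + k) x + v k) + (\<pi> (a + k) y + v' k)" for k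
      by (simp add: \<pi>_add algebra_simps)
    show "Q (x + y)"
      unfolding Q_def by (intro exI[of _ "\<lambda>k. v k + v' k"]) (use v v' rel_add Z_add in \<open>simp add: eq\<close>)
  next
    fix r x assume "Q x"
    then obtain v where v: "v 0 = 0" "\<forall>k<b. rel k (\<pi> (a + k) x + v k) (v (Suc k))" "\<pi> (a + b) x + v b \<in> Z"
      unfolding Q_def by blast
    have eq: "\<pi> (a + k) (r *s x) + r *s v k = r *s (\<pi> (a + k) x + v k)" for k
      by (simp add: \<pi>_scale scale_right_distrib)
    show "Q (r *s x)"
      unfolding Q_def by (intro exI[of _ "\<lambda>k. r *s v k"]) (use v rel_scale Z_scale in \<open>simp add: eq\<close>)
  qed
  moreover have "G \<subseteq> {y. Q y}"
  proof (safe; unfold G_def; elim UnE)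
    fix y assume "y \<in> {u - v | k u v. k < b \<and> rel k u v}"
    then obtain l u w where l: "l < b" "rel l u w" "y = u - w" by blast
    then have wt: "\<pi> j u = (if j = a + l then u else 0)" "\<pi> j w = (if j = Suc (a + l) then w else 0)" for j
      using l(2) homogeneous[of "a + l" u j] homogeneous[of "Suc (a + l)" w j] by (simp_all add: rel_def)
    define v where "v k = (if k = Suc l then w else 0)" for k
    have y: "\<pi> (a + k) y + v k = (if k = l then u else 0)" for k
      using wt by (simp add: l(3) \<pi>_diff v_def)
    have "rel k (\<pi> (a + k) y + v k) (v (Suc k))" for k
      unfolding y using l rel_0 by (simp add: v_def)
    moreover have "\<pi> (a + b) y + v b \<in> Z" unfolding y using l Z_0 by simp
    ultimately show "Q y" unfolding Q_def by (intro exI[of _ v]) (simp add: v_def)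
  next
    fix y assume y: "y \<in> Z"
    have "\<pi> (a + k) y = (if k = b then y else 0)" for k
    proof (cases "src b")
      case False
      then obtain z where z: "y = F z" "\<pi> (Suc (a + b)) z = z" using y by (auto simp: Z_def)
      then show ?thesis using homogeneous[OF z(2), of "Suc (a + k)"] by (simp add: \<pi>_F)
    qed (use y in \<open>simp add: Z_def\<close>)
    then show "Q y" unfolding Q_def using y rel_0 by (intro exI[of _ "\<lambda>_. 0"]) simp
  qed
  ultimately have span_Q: "Q y" if "y \<in> span G" for y
    using span_minimal that by blast
  have "c 0 \<notin> span G"
  proof
    assume "c 0 \<in> span G"
    then obtain v where v: "v 0 = 0" "\<forall>k<b. rel k (\<pi> (a + k) (c 0) + v k) (v (Suc k))" "\<pi> (a + b) (c 0) + v b \<in> Z"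
      using span_Q unfolding Q_def by blast
    have "\<pi> j (c 0) = (if j = a then c 0 else 0)" for j
      using c(1) homogeneous[of a "c 0" j] by (simp add: chain_def)
    then have \<pi>_c0: "\<pi> (a + k) (c 0) = (if k = 0 then c 0 else 0)" for k by simp
    define c' where "c' k = \<pi> (a + k) (c 0) + v k" for k
    have c'_Suc: "c' (Suc k) = v (Suc k)" and c'_0: "c' 0 = c 0" for k
      using v(1) \<pi>_c0[of "Suc k"] \<pi>_c0[of 0] by (simp_all add: c'_def)
    have "chain b c'"
      using v(2) c(1) unfolding chain_def by (simp add: c'_0 c'_Suc) (simp add: c'_def)
    moreover have "c' b \<in> Z" using v(3) by (simp add: c'_def)
    ultimately have "c' 0 = 0" by (rule Z)
    then show False using c(2) c'_0 by simp
  qed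
  then obtain \<phi> :: "'v \<Rightarrow> 'a" where \<phi>: "\<And>u v. \<phi> (u + v) = \<phi> u + \<phi> v" "\<And>r v. \<phi> (r *s v) = r * \<phi> v"
    "\<phi> (c 0) = 1" "\<And>g. g \<in> G \<Longrightarrow> \<phi> g = 0"
    using exists_functional by blast
  have \<phi>_0: "\<phi> 0 = 0" using \<phi>(2)[of 0 0] by simp
  have \<phi>_diff: "\<phi> (u - w) = \<phi> u - \<phi> w" for u w using \<phi>(1)[of "u - w" w] by (simp add: algebra_simps)
  have \<phi>_rel: "\<phi> u = \<phi> v" if "rel k u v" "k < b" for k u v
    using \<phi>(4)[of "u - v"] that \<phi>_diff[of u v] by (auto simp: G_def)
  have \<phi>_c: "k \<le> b \<Longrightarrow> \<phi> (c k) = 1" for k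
  proof (induction k)
    case (Suc k)
    then show ?case using \<phi>_rel[of k "c k" "c (Suc k)"] c(1) by (simp add: chain_def)
  qed (rule \<phi>(3))
  have crel: "rel k (c k) (c (Suc k))" if "k < b" for k using c(1) that by (simp add: chain_def)
  have cwt: "\<pi> j (c k) = (if j = a + k then c k else 0)" if "k \<le> b" for j k
    using chain_wt[OF c(1) that] by (rule homogeneous)
  have "c b \<noteq> 0" using \<phi>_c[of b] \<phi>_0 by auto
  then have "a + b \<le> d" using chain_wt[OF c(1), of b] \<pi>_big[of "a + b"] by (metis le_refl not_le)
  \<comment> \<open>If degree \<open>a\<close> is a sink, \<open>F\<close> reaches a nonzero vector
    there; for \<open>b = 0\<close> this would be a chain in \<open>Z\<close> with nonzero
    start.\<close>
  have b_pos: "0 < b" if "\<not> t"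
  proof (rule ccontr)
    assume "\<not> 0 < b"
    then have b: "b = 0" "\<not> src b" using src_0 that by auto
    obtain v where v: "F (\<pi> (Suc a) v) \<noteq> 0" using \<open>\<not> t\<close> unfolding t_def by blast
    have "F (\<pi> (Suc a) v) \<in> {F z | z. \<pi> (Suc a) z = z}" by (auto simp: \<pi>_\<pi>)
    then have "F (\<pi> (Suc a) v) = 0"
      using Z[of "\<lambda>_. F (\<pi> (Suc a) v)"] b by (auto simp: chain_def Z_def \<pi>_F \<pi>_\<pi>)
    then show False using v by simp
  qed
  \<comment> \<open>The dual functionals are the homogeneous components of a single one.\<close>
  define f where "f k u = \<phi> (\<pi> (a + k) u)" for k u
  have E_c: "E (c k) = (if src k \<and> k < b then c (Suc k) else 0)" if "k \<le> b" for k
  proof (cases "src k")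
    case True
    then show ?thesis using crel[of k] c(3) that by (cases "k = b") (auto simp: rel_def)
  next
    case False
    \<comment> \<open>A vector at a sink is a value of \<open>F\<close> or of \<open>E\<close>, so
      EF = 0 or E^2 = 0 applies; at the start of the chain this needs \<open>b_pos\<close>.\<close>
    have "E (c k) = 0"
    proof (cases k)
      case 0
      then have "0 < b" using False src_0 b_pos by simp
      then have "F (c (Suc 0)) = c 0" using crel[of 0] False 0 by (simp add: rel_def)
      then show ?thesis using EF0[of "c (Suc 0)"] 0 by simp
    next
      case (Suc l)
      then have "E (c l) = c k" using crel[of l] False that src_Suc by (auto simp: rel_def)
      then show ?thesis using EE[of "c l"] by simp
    qed
    then show ?thesis using False by simp
  qed
  have F_c: "F (c k) = (if \<not> src k \<or> k = 0 then 0 else c (k - 1))" if "k \<le> b" for k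
  proof (cases k)
    case 0
    have "F (c 0) = F (\<pi> a (c 0))" using cwt[of 0 a] by simp
    also have "\<dots> = 0"
      using below by (cases a) (simp_all add: F_\<pi>_0 \<pi>_F[symmetric])
    finally show ?thesis using 0 by simp
  next
    case (Suc l)
    then have "rel l (c l) (c k)" using crel that by simp
    then show ?thesis using Suc FE0[of "c l"] src_Suc[of l] by (auto simp: rel_def)
  qed
  have f_E: "f k (E u) = (if \<not> src k \<and> 0 < k then f (k - 1) u else 0)" if "k \<le> b" for k u
  proof (cases k)
    case 0
    have "\<pi> a (E u) = 0"
      by (cases a) (simp_all add: \<pi>_0_E \<pi>_E below)
    then show ?thesis using 0 \<phi>_0 by (simp add: f_def)
  next
    case (Suc l)
    have E: "\<pi> (a + k) (E u) = E (\<pi> (a + l) u)" by (simp add: Suc \<pi>_E)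
    show ?thesis
    proof (cases "src k")
      case True
      \<comment> \<open>Degree \<open>a + l\<close> is a sink; since FE = 0, a value of
        \<open>E\<close> is related to 0 along this edge and the functional kills it.\<close>
      then have "rel l 0 (E (\<pi> (a + l) u))"
        using Suc src_Suc by (auto simp: rel_def FE0 \<pi>_E \<pi>_\<pi>)
      then have "\<phi> (E (\<pi> (a + l) u)) = 0" using \<phi>_rel[of l 0] Suc that \<phi>_0 by simp
      then show ?thesis using True by (simp add: f_def E)
    next
      case False
      then have "rel l (\<pi> (a + l) u) (E (\<pi> (a + l) u))"
        using Suc src_Suc by (auto simp: rel_def \<pi>_E \<pi>_\<pi>)
      then have "\<phi> (E (\<pi> (a + l) u)) = \<phi> (\<pi> (a + l) u)"
        using \<phi>_rel[of l "\<pi> (a + l) u"] Suc that by simp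
      then show ?thesis using False by (simp add: f_def E) (simp add: Suc)
    qed
  qed
  have f_F: "f k (F u) = (if \<not> src k \<and> k < b then f (Suc k) u else 0)" if "k \<le> b" for k u
  proof -
    have F: "\<pi> (a + k) (F u) = F (\<pi> (Suc (a + k)) u)" by (simp add: \<pi>_F)
    show ?thesis
    proof (cases "src k")
      case True
      have "\<phi> (F (\<pi> (Suc (a + k)) u)) = 0"
      proof (cases k)
        case 0
        then show ?thesis using True src_0 t_def \<phi>_0 by simp
      next
        case (Suc l)
        then have "rel l 0 (F (\<pi> (Suc (a + k)) u))"
          using True src_Suc by (auto simp: rel_def FF \<pi>_F \<pi>_\<pi>)
        then show ?thesis using \<phi>_rel[of l 0] Suc that \<phi>_0 by simp
      qed
      then show ?thesis using True by (simp add: f_def F)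
    next
      case False
      show ?thesis
      proof (cases "k = b")
        case True
        have "F (\<pi> (Suc (a + k)) u) \<in> G"
          using False True by (auto simp: G_def Z_def \<pi>_\<pi>)
        then show ?thesis using True \<phi>(4) by (simp add: f_def \<pi>_F)
      next
        case neq: False
        have "rel k (F (\<pi> (Suc (a + k)) u)) (\<pi> (Suc (a + k)) u)"
          using False by (auto simp: rel_def \<pi>_F \<pi>_\<pi>)
        then show ?thesis using \<phi>_rel[of k] neq that False by (simp add: f_def F)
      qed
    qed
  qed
  have f_\<pi>: "f k (\<pi> j u) = (if a + k = j then f k u else 0)" for k j u
    by (simp add: f_def \<pi>_\<pi> \<phi>_0)
  have "thin_datum (Suc b) c f"
    unfolding thin_datum_def
  proof (intro conjI allI impI ballI)
    show "Suc b \<le> d + 4" using \<open>a + b \<le> d\<close> by simp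
    fix k assume k: "k < Suc b"
    show "\<exists>i. \<pi> i (c k) = c k" using cwt k by (intro exI[of _ "a + k"]) simp
    show "f k (c l) = (if k = l then 1 else 0)" if "l < Suc b" for l
      using k that by (simp add: f_def cwt \<phi>_0 \<phi>_c)
    fix g assume g: "g \<in> range \<pi> \<union> {E, F}"
    then consider j where "g = \<pi> j" | "g = E" | "g = F" by blast
    then show "g (c k) = 0 \<or> (\<exists>l<Suc b. g (c k) = c l)"
    proof cases
      case (1 j)
      then show ?thesis using cwt k by auto
    next
      case 2
      then show ?thesis using E_c[of k] k by (auto split: if_splits)
    next
      case 3
      then show ?thesis using F_c[of k] k by (cases "\<not> src k \<or> k = 0") (auto intro!: exI[of _ "k - 1"])
    qed
    from g consider j where "g = \<pi> j" | "g = E" | "g = F" by blast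
    then show "(\<forall>v. f k (g v) = 0) \<or> (\<exists>l<Suc b. \<forall>v. f k (g v) = f l v)"
    proof cases
      case (1 j)
      then show ?thesis using f_\<pi> k by auto
    next
      case 2
      then show ?thesis using f_E[of k] k by (cases "\<not> src k \<and> 0 < k") (auto intro!: exI[of _ "k - 1"])
    next
      case 3
      then show ?thesis using f_F[of k] k by (cases "\<not> src k \<and> k < b") (auto intro!: exI[of _ "Suc k"])
    qed
  qed (auto simp: f_def \<pi>_add \<pi>_scale \<phi>)
  then show ?thesis by blast
qed

lemma exists_thin_datum:
  assumes nz: "\<exists>i v. \<pi> i v \<noteq> 0"
  shows "\<exists>N x \<phi>. thin_datum N x \<phi>"
proof (cases "\<exists>v. E (F v) \<noteq> 0")
  case True
  then obtain v where "E (F v) \<noteq> 0" by blast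
  \<comment> \<open>\<open>square_datum\<close> needs a homogeneous vector, and
    \<open>F_decomp\<close> passes to a component.\<close>
  moreover have "E (F v) = (\<Sum>i\<le>d. E (F (\<pi> i v)))"
    by (subst F_decomp) (simp add: F_sum E_sum)
  ultimately obtain i where "E (F (\<pi> i v)) \<noteq> 0" by (metis (mono_tags, lifting) sum.neutral)
  then show ?thesis by (intro square_datum[of i "\<pi> i v"]) (simp_all add: \<pi>_\<pi>)
next
  case False
  then show ?thesis using zigzag_datum nz by blast
qed

end

section \<open>Finite representation type\<close>

definition idem_elem :: "nat \<Rightarrow> nat \<Rightarrow> bool list \<Rightarrow> bool list \<Rightarrow> 'a::field" where
  "idem_elem d i = coord_mat d (\<lambda>j. if j = i then 1 else 0) (\<lambda>_. 0) (\<lambda>_. 0) (\<lambda>_. 0)"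

text \<open>Carries the same sign as \<alpha> in \<open>path_hom\<close>, so that it commutes with
  \<open>raise_elem\<close> instead of anticommuting.\<close>

definition lower_elem :: "nat \<Rightarrow> bool list \<Rightarrow> bool list \<Rightarrow> 'a::field" where
  "lower_elem d = coord_mat d (\<lambda>_. 0) (\<lambda>i. (- 1) ^ i) (\<lambda>_. 0) (\<lambda>_. 0)"

definition raise_elem :: "nat \<Rightarrow> bool list \<Rightarrow> bool list \<Rightarrow> 'a::field" where
  "raise_elem d = coord_mat d (\<lambda>_. 0) (\<lambda>_. 0) (\<lambda>_. 1) (\<lambda>_. 0)"

lemma generators_in_carrier:
  "idem_elem d i \<in> acarrier (schur11 d)" "lower_elem d \<in> acarrier (schur11 d)"
  "raise_elem d \<in> acarrier (schur11 d)"
  by (simp_all add: idem_elem_def lower_elem_def raise_elem_def coord_mat_in_carrier)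

lemma azero_coord_mat: "azero (schur11 d) = coord_mat d (\<lambda>_. 0) (\<lambda>_. 0) (\<lambda>_. 0) (\<lambda>_. 0)"
  by (simp add: schur11_def coord_mat_def fun_eq_iff)

lemma schur11_relations:
  assumes d: "of_nat d = (0 :: 'a::field)"
  shows "amul (schur11 d) (idem_elem d i) (idem_elem d j) = (if i = j then idem_elem d i else azero (schur11 d) :: _ \<Rightarrow> _ \<Rightarrow> 'a)"
    and "d < i \<Longrightarrow> idem_elem d i = (azero (schur11 d) :: _ \<Rightarrow> _ \<Rightarrow> 'a)"
    and "amul (schur11 d) (idem_elem d (Suc i)) (raise_elem d) = (amul (schur11 d) (raise_elem d) (idem_elem d i) :: _ \<Rightarrow> _ \<Rightarrow> 'a)"
    and "amul (schur11 d) (idem_elem d 0) (raise_elem d) = (azero (schur11 d) :: _ \<Rightarrow> _ \<Rightarrow> 'a)"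
    and "amul (schur11 d) (idem_elem d i) (lower_elem d) = (amul (schur11 d) (lower_elem d) (idem_elem d (Suc i)) :: _ \<Rightarrow> _ \<Rightarrow> 'a)"
    and "amul (schur11 d) (lower_elem d) (idem_elem d 0) = (azero (schur11 d) :: _ \<Rightarrow> _ \<Rightarrow> 'a)"
    and "amul (schur11 d) (raise_elem d) (raise_elem d) = (azero (schur11 d) :: _ \<Rightarrow> _ \<Rightarrow> 'a)"
    and "amul (schur11 d) (lower_elem d) (lower_elem d) = (azero (schur11 d) :: _ \<Rightarrow> _ \<Rightarrow> 'a)"
    and "amul (schur11 d) (raise_elem d) (lower_elem d) = (amul (schur11 d) (lower_elem d) (raise_elem d) :: _ \<Rightarrow> _ \<Rightarrow> 'a)"
  unfolding idem_elem_def lower_elem_def raise_elem_def azero_coord_mat coord_mat_mult[OF d] if_distrib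
  by (auto intro!: coord_mat_cong[OF d])

text \<open>Diagonal coordinate matrices are combinations of idempotents, and the other three
  families arise from diagonal ones by multiplying on the left with L, R and LR.\<close>

lemma schur11_induct [consumes 3, case_names idem lower raise add smult mult]:
  assumes M: "M \<in> acarrier (schur11 d)" and d: "of_nat d = (0 :: 'a::field)" and two: "(2 :: 'a) \<noteq> 0"
    and idem: "\<And>i. i \<le> d \<Longrightarrow> P (idem_elem d i)" and lower: "P (lower_elem d)" and raise: "P (raise_elem d)"
    and add: "\<And>A B. A \<in> acarrier (schur11 d) \<Longrightarrow> B \<in> acarrier (schur11 d) \<Longrightarrow> P A \<Longrightarrow> P B \<Longrightarrow> P (aadd (schur11 d) A B)"
    and smult: "\<And>c A. A \<in> acarrier (schur11 d) \<Longrightarrow> P A \<Longrightarrow> P (asmul (schur11 d) c A)"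
    and mult: "\<And>A B. A \<in> acarrier (schur11 d) \<Longrightarrow> B \<in> acarrier (schur11 d) \<Longrightarrow> P A \<Longrightarrow> P B \<Longrightarrow> P (amul (schur11 d) A B)"
  shows "P (M :: _ \<Rightarrow> _ \<Rightarrow> 'a)"
proof -
  let ?K = "coord_mat d :: _ \<Rightarrow> _ \<Rightarrow> _ \<Rightarrow> _ \<Rightarrow> bool list \<Rightarrow> bool list \<Rightarrow> 'a" and ?o = "\<lambda>_ :: nat. 0 :: 'a"
  note K = coord_mat_in_carrier
  have diag: "P (?K x ?o ?o ?o)" for x
  proof -
    have "P (?K (\<lambda>i. if i \<le> j then x i else 0) ?o ?o ?o)" if "j \<le> d" for j
      using that
    proof (induction j)
      case 0
      have "asmul (schur11 d) (x 0) (idem_elem d 0) = ?K (\<lambda>i. if i \<le> 0 then x i else 0) ?o ?o ?o"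
        unfolding idem_elem_def coord_mat_smult by (rule coord_mat_cong[OF d]) auto
      then show ?case using smult[OF generators_in_carrier(1) idem[of 0], of "x 0"] by simp
    next
      case (Suc j)
      have "aadd (schur11 d) (?K (\<lambda>i. if i \<le> j then x i else 0) ?o ?o ?o)
          (asmul (schur11 d) (x (Suc j)) (idem_elem d (Suc j))) = ?K (\<lambda>i. if i \<le> Suc j then x i else 0) ?o ?o ?o"
        unfolding idem_elem_def coord_mat_smult coord_mat_add
        by (rule coord_mat_cong[OF d]) (auto simp: le_Suc_eq)
      moreover have "asmul (schur11 d) (x (Suc j)) (idem_elem d (Suc j)) \<in> acarrier (schur11 d)"
        by (simp add: idem_elem_def coord_mat_smult K)
      ultimately show ?case
        using add[OF K _ Suc.IH smult[OF generators_in_carrier(1) idem[of "Suc j"], of "x (Suc j)"]] Suc.prems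
        by simp
    qed
    from this[of d] show ?thesis
      using coord_mat_cong[OF d, of "\<lambda>i. if i \<le> d then x i else 0" x ?o ?o ?o ?o ?o ?o] by simp
  qed
  have sq: "(-1 :: 'a) ^ i * ((-1) ^ i * x) = x" for i x
    by (simp flip: mult.assoc power_mult_distrib)
  obtain x y z w where M: "M = ?K x y z w" using M two by (rule schur11_coord_mat)
  have Y: "?K ?o y ?o ?o = amul (schur11 d) (lower_elem d) (?K (\<lambda>i. (-1) ^ i * y i) ?o ?o ?o)"
    unfolding lower_elem_def coord_mat_mult[OF d] by (rule coord_mat_cong[OF d]) (auto simp: sq)
  have Z: "?K ?o ?o z ?o = amul (schur11 d) (raise_elem d) (?K z ?o ?o ?o)"
    unfolding raise_elem_def coord_mat_mult[OF d] by (rule coord_mat_cong[OF d]) auto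
  have W: "?K ?o ?o ?o w = amul (schur11 d) (amul (schur11 d) (lower_elem d) (raise_elem d))
      (?K (\<lambda>i. (-1) ^ Suc i * w i) ?o ?o ?o)"
    unfolding lower_elem_def raise_elem_def coord_mat_mult[OF d] by (rule coord_mat_cong[OF d]) (auto simp: sq)
  have LR: "(amul (schur11 d) (lower_elem d) (raise_elem d) :: _ \<Rightarrow> _ \<Rightarrow> 'a) \<in> acarrier (schur11 d)"
    unfolding lower_elem_def raise_elem_def coord_mat_mult[OF d] by (rule K)
  have "P (?K ?o y ?o ?o)" "P (?K ?o ?o z ?o)" "P (?K ?o ?o ?o w)"
    unfolding Y Z W by (intro mult diag lower raise generators_in_carrier K LR)+
  then have "P (aadd (schur11 d) (aadd (schur11 d) (?K x ?o ?o ?o) (?K ?o y ?o ?o))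
      (aadd (schur11 d) (?K ?o ?o z ?o) (?K ?o ?o ?o w)))"
    using diag[of x] by (intro add) (simp_all add: coord_mat_add K)
  then show ?thesis by (simp add: coord_mat_add M)
qed

section \<open>Matrices and intertwiners\<close>

lemma mat_mult_assoc: "mat_mult n (mat_mult n X Y) Z = mat_mult n X (mat_mult n Y Z)"
proof -
  have "(\<Sum>l<n. (\<Sum>m<n. X i m * Y m l) * Z l j) = (\<Sum>m<n. X i m * (\<Sum>l<n. Y m l * Z l j))" for i j
    by (simp add: sum_distrib_left sum_distrib_right mult.assoc) (rule sum.swap)
  then show ?thesis by (simp add: mat_mult_def fun_eq_iff)
qed

lemma mat_mult_id:
  assumes "is_mat n X"
  shows "mat_mult n (mat_id n) X = X" "mat_mult n X (mat_id n) = X"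
  using assms
  by (auto simp: mat_mult_def mat_id_def is_mat_def fun_eq_iff if_distrib[of "\<lambda>a. a * _"]
        if_distrib[of "\<lambda>a. _ * a"] cong: if_cong)

lemma is_mat_mult: "is_mat n (mat_mult n X Y)"
  by (simp add: is_mat_def mat_mult_def)

lemma mat_mult_add:
  "mat_mult n X (\<lambda>i j. Y i j + Z i j) = (\<lambda>i j. mat_mult n X Y i j + mat_mult n X Z i j)"
  "mat_mult n (\<lambda>i j. Y i j + Z i j) X = (\<lambda>i j. mat_mult n Y X i j + mat_mult n Z X i j)"
  by (auto simp: mat_mult_def fun_eq_iff algebra_simps sum.distrib)

lemma mat_mult_scale:
  "mat_mult n X (\<lambda>i j. c * Y i j) = (\<lambda>i j. c * mat_mult n X Y i j)"
  "mat_mult n (\<lambda>i j. c * Y i j) X = (\<lambda>i j. c * mat_mult n Y X i j)"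
  by (auto simp: mat_mult_def fun_eq_iff sum_distrib_left mult_ac)

lemma mat_vec_mult: "mat_vec n (mat_mult n X Y) v = mat_vec n X (mat_vec n Y v)"
proof -
  have "(\<Sum>l<n. (\<Sum>m<n. X i m * Y m l) * v l) = (\<Sum>m<n. X i m * (\<Sum>l<n. Y m l * v l))" for i
    by (simp add: sum_distrib_left sum_distrib_right mult.assoc) (rule sum.swap)
  then show ?thesis by (simp add: mat_vec_def mat_mult_def fun_eq_iff)
qed

definition schur_gens :: "nat \<Rightarrow> (bool list \<Rightarrow> bool list \<Rightarrow> 'a::field) set" where
  "schur_gens d = idem_elem d ` {..d} \<union> {lower_elem d, raise_elem d}"

text \<open>The combinatorial type \<open>Z\<close> need not be extended to a representation of the whole algebra.\<close>

definition realizes :: "nat \<Rightarrow> nat \<Rightarrow> ((bool list \<Rightarrow> bool list \<Rightarrow> 'a::field) \<Rightarrow> nat \<Rightarrow> nat \<Rightarrow> 'a)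
    \<Rightarrow> ((bool list \<Rightarrow> bool list \<Rightarrow> 'a) \<Rightarrow> nat \<Rightarrow> nat \<Rightarrow> 'a) \<Rightarrow> bool" where
  "realizes d n \<rho> Z \<longleftrightarrow> (\<exists>P Q. is_mat n P \<and> is_mat n Q \<and> mat_mult n P Q = mat_id n \<and> mat_mult n Q P = mat_id n
     \<and> (\<forall>g\<in>schur_gens d. mat_mult n P (\<rho> g) = mat_mult n (Z g) P))"

text \<open>Passing to the common datum by \<open>P\<close> and back by \<open>Q'\<close>
  intertwines the generators, and intertwining survives sums, multiples and products.\<close>

lemma realizes_imp_rep_iso:
  assumes d: "of_nat d = (0 :: 'a::field)" and two: "(2 :: 'a) \<noteq> 0"
    and rep: "is_rep (schur11 d) n \<rho>" "is_rep (schur11 d) n \<rho>'"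
    and Z: "realizes d n \<rho> Z" "realizes d n \<rho>' (Z :: _ \<Rightarrow> _ \<Rightarrow> _ \<Rightarrow> 'a)"
  shows "rep_iso (schur11 d) n \<rho> n \<rho>'"
proof -
  obtain P Q where P: "is_mat n P" "is_mat n Q" "mat_mult n P Q = mat_id n" "mat_mult n Q P = mat_id n"
    and PZ: "\<And>g. g \<in> schur_gens d \<Longrightarrow> mat_mult n P (\<rho> g) = mat_mult n (Z g) P"
    using Z(1) unfolding realizes_def by blast
  obtain P' Q' where P': "is_mat n P'" "is_mat n Q'" "mat_mult n P' Q' = mat_id n" "mat_mult n Q' P' = mat_id n"
    and PZ': "\<And>g. g \<in> schur_gens d \<Longrightarrow> mat_mult n P' (\<rho>' g) = mat_mult n (Z g) P'"
    using Z(2) unfolding realizes_def by blast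
  have cancel: "mat_mult n P (mat_mult n Q X) = X" "mat_mult n Q (mat_mult n P X) = X"
    "mat_mult n P' (mat_mult n Q' X) = X" "mat_mult n Q' (mat_mult n P' X) = X" if "is_mat n X" for X
    using that P P' by (simp_all add: mat_mult_assoc[symmetric] mat_mult_id)
  let ?T = "mat_mult n Q' P" and ?S = "mat_mult n Q P'"
  have inter: "mat_mult n ?T (\<rho> g) = mat_mult n (\<rho>' g) ?T" if g: "g \<in> schur_gens d" for g
  proof -
    have car: "g \<in> acarrier (schur11 d)" using g generators_in_carrier by (auto simp: schur_gens_def)
    then have "is_mat n (\<rho>' g)" using rep(2) by (simp add: is_rep_def)
    then have "mat_mult n (\<rho>' g) ?T = mat_mult n Q' (mat_mult n P' (mat_mult n (\<rho>' g) ?T))"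
      using cancel(4) is_mat_mult by metis
    also have "\<dots> = mat_mult n Q' (mat_mult n (mat_mult n (Z g) P') ?T)"
      using PZ'[OF g] by (simp add: mat_mult_assoc[symmetric])
    also have "\<dots> = mat_mult n Q' (mat_mult n (Z g) (mat_mult n P' (mat_mult n Q' P)))"
      by (simp add: mat_mult_assoc)
    also have "\<dots> = mat_mult n Q' (mat_mult n P (\<rho> g))"
      using cancel(3)[OF P(1)] PZ[OF g] by simp
    finally show ?thesis by (simp add: mat_mult_assoc)
  qed
  have "mat_mult n ?T (\<rho> a) = mat_mult n (\<rho>' a) ?T" if "a \<in> acarrier (schur11 d)" for a
    using that d two
  proof (induction a rule: schur11_induct)
    case (add A B)
    then show ?case using rep by (simp add: is_rep_def mat_mult_add)
  next
    case (smult c A)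
    then show ?case using rep by (simp add: is_rep_def mat_mult_scale)
  next
    case (mult A B)
    have mul: "\<rho> (amul (schur11 d) A B) = mat_mult n (\<rho> A) (\<rho> B)"
      "\<rho>' (amul (schur11 d) A B) = mat_mult n (\<rho>' A) (\<rho>' B)"
      using rep mult.hyps by (simp_all add: is_rep_def)
    have "mat_mult n ?T (\<rho> (amul (schur11 d) A B)) = mat_mult n (mat_mult n ?T (\<rho> A)) (\<rho> B)"
      by (simp only: mul mat_mult_assoc)
    also have "\<dots> = mat_mult n (\<rho>' A) (mat_mult n ?T (\<rho> B))"
      by (simp only: mult.IH(1) mat_mult_assoc[of n "\<rho>' A"])
    also have "\<dots> = mat_mult n (\<rho>' (amul (schur11 d) A B)) ?T"
      by (simp only: mul mult.IH(2) mat_mult_assoc[of n "\<rho>' A"])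
    finally show ?case .
  qed (auto intro: inter simp: schur_gens_def)
  moreover have "mat_mult n ?T ?S = mat_id n" "mat_mult n ?S ?T = mat_id n"
    using cancel P P' by (simp_all add: mat_mult_assoc)
  ultimately show ?thesis unfolding rep_iso_def using is_mat_mult by blast
qed

text \<open>A family with a dual family is independent. Applied both to the thin vectors and to the
  unit vectors, this makes their numbers agree.\<close>

lemma (in vector_space) dual_family_card:
  fixes \<phi> :: "nat \<Rightarrow> 'b \<Rightarrow> 'a"
  assumes add: "\<And>k u v. k < N \<Longrightarrow> \<phi> k (u + v) = \<phi> k u + \<phi> k v"
    and scl: "\<And>k c v. k < N \<Longrightarrow> \<phi> k (scale c v) = c * \<phi> k v"
    and dual: "\<And>k l. k < N \<Longrightarrow> l < N \<Longrightarrow> \<phi> k (x l) = (if k = l then 1 else 0)"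
    and T: "finite T" "x ` {..<N} \<subseteq> span T"
  shows "N \<le> card T"
proof -
  have "inj_on x {..<N}"
    by (rule inj_onI) (metis dual lessThan_iff zero_neq_one)
  moreover have "independent (x ` {..<N})"
    unfolding dependent_def
  proof safe
    fix k assume k: "k < N" and *: "x k \<in> span (x ` {..<N} - {x k})"
    have 0: "\<phi> k 0 = 0" using scl[OF k, of 0 0] by simp
    have "span (x ` {..<N} - {x k}) \<subseteq> {v. \<phi> k v = 0}"
      by (rule span_minimal) (use k in \<open>auto intro!: subspaceI simp: add scl dual 0\<close>)
    then have "\<phi> k (x k) = 0" using * by blast
    then show False using dual k by simp
  qed
  then have "card (x ` {..<N}) \<le> card T"
    using independent_span_bound[OF T(1) _ T(2)] by blast
  ultimately show ?thesis by (simp add: card_image)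
qed

section \<open>Sequences as a vector space\<close>

definition vec_scale :: "'a::field \<Rightarrow> (nat \<Rightarrow> 'a) \<Rightarrow> nat \<Rightarrow> 'a" where
  "vec_scale c v = (\<lambda>i. c * v i)"

text \<open>The ambient space consists of all sequences, with \<open>kvec n\<close> as a subspace,
  so that one space serves every n.\<close>

interpretation vec: vector_space vec_scale
  by unfold_locales (auto simp: vec_scale_def fun_eq_iff algebra_simps)

lemma vec_scale_apply [simp]: "vec_scale c v i = c * v i"
  by (simp add: vec_scale_def)

lemma mat_vec_add: "mat_vec n X (u + v) = mat_vec n X u + mat_vec n X v"
  by (auto simp: mat_vec_def fun_eq_iff algebra_simps sum.distrib)

lemma mat_vec_scale: "mat_vec n X (vec_scale c v) = vec_scale c (mat_vec n X v)"
  by (auto simp: mat_vec_def fun_eq_iff sum_distrib_left algebra_simps)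

lemma mat_vec_add_mat: "mat_vec n (\<lambda>i j. X i j + Y i j) v = mat_vec n X v + mat_vec n Y v"
  by (auto simp: mat_vec_def fun_eq_iff algebra_simps sum.distrib)

lemma mat_vec_scale_mat: "mat_vec n (\<lambda>i j. c * X i j) v = vec_scale c (mat_vec n X v)"
  by (auto simp: mat_vec_def fun_eq_iff sum_distrib_left algebra_simps)

lemma mat_vec_zero: "mat_vec n (\<lambda>_ _. 0) v = 0"
  by (auto simp: mat_vec_def fun_eq_iff)

lemma mat_vec_in_kvec: "mat_vec n X v \<in> kvec n"
  by (simp add: mat_vec_def kvec_def)

lemma mat_vec_id: "mat_vec n (mat_id n) v = (\<lambda>i. if i < n then v i else 0)"
  by (auto simp: mat_vec_def mat_id_def fun_eq_iff if_distrib[of "\<lambda>a. a * _"] cong: if_cong)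

lemma mat_vec_trunc: "mat_vec n X (\<lambda>i. if i < n then v i else 0) = mat_vec n X v"
  by (auto simp: mat_vec_def fun_eq_iff intro!: sum.cong)

lemma subspace_kvec: "vec.subspace (kvec n)"
  by (rule vec.subspaceI) (auto simp: kvec_def)

lemma subspace_of_iff: "subspace_of n U \<longleftrightarrow> U \<subseteq> kvec n \<and> vec.subspace U"
  by (auto simp: subspace_of_def vec.subspace_def vec_scale_def zero_fun_def plus_fun_def)

definition unit_vec :: "nat \<Rightarrow> nat \<Rightarrow> 'a::field" where
  "unit_vec j = (\<lambda>i. if i = j then 1 else 0)"

lemma sum_fun_apply: "(\<Sum>k\<in>A. f k) i = (\<Sum>k\<in>A. (f k i :: 'a::comm_monoid_add))"
  by (induction A rule: infinite_finite_induct) auto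

lemma kvec_unit_decomp:
  assumes "v \<in> kvec n"
  shows "v = (\<Sum>j<n. vec_scale (v j) (unit_vec j))"
  using assms by (auto simp: fun_eq_iff sum_fun_apply unit_vec_def kvec_def if_distrib[of "\<lambda>a. _ * a"] cong: if_cong)

lemma rep_graded_module:
  assumes d: "of_nat d = (0 :: 'a::field)" and rep: "is_rep (schur11 d) n (\<rho> :: _ \<Rightarrow> _ \<Rightarrow> _ \<Rightarrow> 'a)"
  shows "graded_module vec_scale d (\<lambda>i. mat_vec n (\<rho> (idem_elem d i))) (mat_vec n (\<rho> (raise_elem d)))
      (mat_vec n (\<rho> (lower_elem d)))"
    and "(\<Sum>i\<le>d. mat_vec n (\<rho> (idem_elem d i)) v) = (\<lambda>i. if i < n then v i else 0)"
proof -
  define op where "op a = mat_vec n (\<rho> a)" for a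
  note gens = generators_in_carrier
  have op_add: "op a (u + v) = op a u + op a v" and op_scale: "op a (vec_scale c v) = vec_scale c (op a v)" for a c u v
    by (simp_all add: op_def mat_vec_add mat_vec_scale)
  have mul: "op a (op b v) = op (amul (schur11 d) a b) v"
    if "a \<in> acarrier (schur11 d)" "b \<in> acarrier (schur11 d)" for a b v
    using rep that by (simp add: op_def is_rep_def mat_vec_mult)
  \<comment> \<open>\<open>is_rep\<close> is not stated for the zero element, which is therefore
    written as a zero multiple.\<close>
  have zero: "op (azero (schur11 d)) v = 0" for v
  proof -
    have "asmul (schur11 d) 0 (idem_elem d 0) = (azero (schur11 d) :: _ \<Rightarrow> _ \<Rightarrow> 'a)"
      by (simp add: schur11_def)
    moreover have "\<rho> (asmul (schur11 d) 0 (idem_elem d 0)) = (\<lambda>i j. 0 * \<rho> (idem_elem d 0) i j)"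
      using rep gens(1) unfolding is_rep_def by blast
    ultimately have "\<rho> (azero (schur11 d)) = (\<lambda>_ _. 0)" by simp
    then show ?thesis by (simp add: op_def mat_vec_zero)
  qed
  \<comment> \<open>Additivity is available for two summands at a time, so each partial sum is kept
    as one algebra element; at \<open>j = d\<close> it is the unit.\<close>
  have partial: "(\<Sum>i\<le>j. op (idem_elem d i) v)
      = op (coord_mat d (\<lambda>i. if i \<le> j then 1 else 0) (\<lambda>_. 0) (\<lambda>_. 0) (\<lambda>_. 0)) v"
    for j and v :: "nat \<Rightarrow> 'a"
  proof (induction j)
    case 0
    have "idem_elem d 0 = (coord_mat d (\<lambda>i. if i \<le> 0 then 1 else 0) (\<lambda>_. 0) (\<lambda>_. 0) (\<lambda>_. 0) :: _ \<Rightarrow> _ \<Rightarrow> 'a)"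
      unfolding idem_elem_def by (rule coord_mat_cong[OF d]) auto
    then show ?case by simp
  next
    case (Suc j)
    let ?K = "coord_mat d (\<lambda>i. if i \<le> j then 1 else 0) (\<lambda>_. 0) (\<lambda>_. 0) (\<lambda>_. 0) :: _ \<Rightarrow> _ \<Rightarrow> 'a"
    have "aadd (schur11 d) ?K (idem_elem d (Suc j))
        = coord_mat d (\<lambda>i. if i \<le> Suc j then 1 else 0) (\<lambda>_. 0) (\<lambda>_. 0) (\<lambda>_. 0)"
      unfolding idem_elem_def coord_mat_add by (rule coord_mat_cong[OF d]) (auto simp: le_Suc_eq)
    moreover have "op (aadd (schur11 d) ?K (idem_elem d (Suc j))) v = op ?K v + op (idem_elem d (Suc j)) v"
      using rep by (simp add: op_def is_rep_def mat_vec_add_mat gens(1) coord_mat_in_carrier)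
    ultimately show ?case using Suc.IH by simp
  qed
  have "coord_mat d (\<lambda>i. if i \<le> d then 1 else 0) (\<lambda>_. 0) (\<lambda>_. 0) (\<lambda>_. 0) = (aone (schur11 d) :: _ \<Rightarrow> _ \<Rightarrow> 'a)"
    unfolding coord_mat_one by (rule coord_mat_cong[OF d]) auto
  then have sum: "(\<Sum>i\<le>d. op (idem_elem d i) v) = (\<lambda>i. if i < n then v i else 0)" for v
    using partial[of v d] rep by (simp add: op_def is_rep_def mat_vec_id)
  show "(\<Sum>i\<le>d. mat_vec n (\<rho> (idem_elem d i)) v) = (\<lambda>i. if i < n then v i else 0)"
    using sum by (simp add: op_def)
  show "graded_module vec_scale d (\<lambda>i. mat_vec n (\<rho> (idem_elem d i))) (mat_vec n (\<rho> (raise_elem d)))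
      (mat_vec n (\<rho> (lower_elem d)))"
    unfolding op_def[symmetric]
  proof
    show "op (lower_elem d) v = op (lower_elem d) (\<Sum>i\<le>d. op (idem_elem d i) v)" for v
      unfolding sum by (simp add: op_def mat_vec_trunc)
    show "op (idem_elem d i) (op (idem_elem d j) v) = (if i = j then op (idem_elem d i) v else 0)" for i j v
      by (simp add: mul gens schur11_relations[OF d] zero)
    show "op (idem_elem d (Suc i)) (op (raise_elem d) v) = op (raise_elem d) (op (idem_elem d i) v)" for i v
      by (simp only: mul gens schur11_relations(3)[OF d])
    show "op (idem_elem d i) (op (lower_elem d) v) = op (lower_elem d) (op (idem_elem d (Suc i)) v)" for i v
      by (simp only: mul gens schur11_relations(5)[OF d])
    show "op (raise_elem d) (op (lower_elem d) v) = op (lower_elem d) (op (raise_elem d) v)" for v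
      by (simp only: mul gens schur11_relations(9)[OF d])
  qed (simp_all add: mul gens schur11_relations[OF d] zero op_add op_scale)
qed

text \<open>The nested shape with explicit defaults is the one counted by
  \<open>finite_set_of_finite_funs\<close>; fixing the values outside the range is what makes the
  set finite.\<close>

definition elementary_datum :: "nat \<Rightarrow> nat \<Rightarrow> ((bool list \<Rightarrow> bool list \<Rightarrow> 'a::field) \<Rightarrow> nat \<Rightarrow> nat \<Rightarrow> 'a) \<Rightarrow> bool" where
  "elementary_datum d n Z \<longleftrightarrow> (\<forall>g. (g \<in> schur_gens d \<longrightarrow>
      (\<forall>i. (i \<in> {..<n} \<longrightarrow> (\<forall>j. (j \<in> {..<n} \<longrightarrow> Z g i j \<in> {0, 1}) \<and> (j \<notin> {..<n} \<longrightarrow> Z g i j = 0)))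
         \<and> (i \<notin> {..<n} \<longrightarrow> Z g i = (\<lambda>_. 0)))) \<and> (g \<notin> schur_gens d \<longrightarrow> Z g = (\<lambda>_ _. 0)))"

lemma finite_elementary_data: "finite {Z. elementary_datum d n Z}"
proof -
  let ?row = "{r :: nat \<Rightarrow> 'a. \<forall>j. (j \<in> {..<n} \<longrightarrow> r j \<in> {0, 1}) \<and> (j \<notin> {..<n} \<longrightarrow> r j = 0)}"
  let ?mat = "{X. \<forall>i. (i \<in> {..<n} \<longrightarrow> X i \<in> ?row) \<and> (i \<notin> {..<n} \<longrightarrow> X i = (\<lambda>_. 0))}"
  have "finite ?row" by (rule finite_set_of_finite_funs) auto
  then have mat: "finite ?mat" by (rule finite_set_of_finite_funs[OF finite_lessThan])
  have "finite (schur_gens d :: (_ \<Rightarrow> _ \<Rightarrow> 'a) set)" by (simp add: schur_gens_def)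
  then have "finite {Z. \<forall>g :: bool list \<Rightarrow> bool list \<Rightarrow> 'a. (g \<in> schur_gens d \<longrightarrow> Z g \<in> ?mat) \<and> (g \<notin> schur_gens d \<longrightarrow> Z g = (\<lambda>_ _. 0))}"
    using mat by (rule finite_set_of_finite_funs)
  then show ?thesis by (simp add: elementary_datum_def)
qed

text \<open>The span \<open>U\<close> of the thin vectors and the common kernel \<open>W\<close> of
  the functionals are complementary submodules with \<open>U\<close> nonzero. Indecomposability
  forces \<open>W\<close> to vanish, so the thin vectors are a basis.\<close>

lemma indecomposable_elementary:
  assumes d: "of_nat d = (0 :: 'a::field)" and two: "(2 :: 'a) \<noteq> 0"
    and rep: "is_rep (schur11 d) n (\<rho> :: _ \<Rightarrow> _ \<Rightarrow> _ \<Rightarrow> 'a)" and indec: "indecomposable (schur11 d) n \<rho>"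
  shows "n \<le> d + 4 \<and> (\<exists>Z. elementary_datum d n Z \<and> realizes d n \<rho> Z)"
proof -
  note plus_fun_apply [simp del] and zero_fun_apply [simp del] and vec_scale_apply [simp del]
  define op where "op a = mat_vec n (\<rho> a)" for a
  have op_add: "op a (u + v) = op a u + op a v" and op_scale: "op a (vec_scale c v) = vec_scale c (op a v)" for a c u v
    by (simp_all add: op_def mat_vec_add mat_vec_scale)
  have op_0: "op a 0 = 0" for a using op_add[of a 0 0] by simp
  interpret graded_module vec_scale d "\<lambda>i. op (idem_elem d i)" "op (raise_elem d)" "op (lower_elem d)"
    unfolding op_def by (rule rep_graded_module[OF d rep])
  have n: "0 < n" using indec by (simp add: indecomposable_def)
  \<comment> \<open>The idempotents applied to the first unit vector add up to that vector, so they
    cannot all act as zero.\<close>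
  have "\<exists>i v. op (idem_elem d i) v \<noteq> 0"
  proof (rule ccontr)
    assume "\<not> ?thesis"
    then have "(\<lambda>i. if i < n then unit_vec 0 i else 0 :: 'a) = 0"
      using rep_graded_module(2)[OF d rep, of "unit_vec 0"] by (simp add: op_def)
    from fun_cong[OF this, of 0] show False using n by (simp add: unit_vec_def zero_fun_apply)
  qed
  then obtain N x \<phi> where "thin_datum N x \<phi>" using exists_thin_datum by blast
  note datum = thin_datumD[OF this]
  note N = datum(1,2) and lin = datum(3,4) and x_wt = datum(5) and dual = datum(6)
  have op_gens: "op g \<in> range (\<lambda>i. op (idem_elem d i)) \<union> {op (raise_elem d), op (lower_elem d)}"
    if "g \<in> schur_gens d" for g
    using that by (auto simp: schur_gens_def)
  have gx: "op g (x k) = 0 \<or> (\<exists>l<N. op g (x k) = x l)" if "g \<in> schur_gens d" "k < N" for g k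
    using datum(7)[OF op_gens[OF that(1)] that(2)] .
  have \<phi>g: "(\<forall>v. \<phi> k (op g v) = 0) \<or> (\<exists>l<N. \<forall>v. \<phi> k (op g v) = \<phi> l v)" if "g \<in> schur_gens d" "k < N" for g k
    using datum(8)[OF op_gens[OF that(1)] that(2)] .
  have \<phi>_0: "\<phi> k 0 = 0" if "k < N" for k using lin(2)[OF that, of 0 0] by simp
  have \<phi>_sum: "\<phi> k (\<Sum>i\<in>A. f i) = (\<Sum>i\<in>A. \<phi> k (f i))" if "k < N" for k A and f :: "_ \<Rightarrow> _"
    by (induction A rule: infinite_finite_induct) (simp_all only: simp_thms sum.infinite sum.empty sum.insert \<phi>_0[OF that] lin(1)[OF that])
  have x_kvec: "x k \<in> kvec n" if "k < N" for k
    using x_wt[OF that] mat_vec_in_kvec unfolding op_def by metis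
  define U where "U = vec.span (x ` {..<N})"
  define W where "W = {v \<in> kvec n. \<forall>k<N. \<phi> k v = 0}"
  \<comment> \<open>The projection onto \<open>U\<close> along \<open>W\<close>.\<close>
  let ?proj = "\<lambda>v. \<Sum>k<N. vec_scale (\<phi> k v) (x k)"
  have \<phi>_proj: "\<phi> k (?proj v) = \<phi> k v" if "k < N" for k v
    using that by (simp add: \<phi>_sum lin dual if_distrib[of "\<lambda>a. _ * a"] cong: if_cong)
  have proj_U: "?proj v \<in> U" for v
    unfolding U_def by (intro vec.span_sum vec.span_scale vec.span_base) auto
  have U_kvec: "U \<subseteq> kvec n"
    unfolding U_def by (rule vec.span_minimal) (auto simp: x_kvec subspace_kvec)
  have U_sub: "vec.subspace U" unfolding U_def by (rule vec.subspace_span)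
  have W_sub: "vec.subspace W"
    unfolding W_def using subspace_kvec by (intro vec.subspaceI) (auto simp: \<phi>_0 lin vec.subspace_def)
  have proj_id: "v = ?proj v" if "v \<in> U" for v
  proof -
    have "U \<subseteq> {v. v = ?proj v}"
      unfolding U_def
    proof (rule vec.span_minimal)
      show "x ` {..<N} \<subseteq> {v. v = ?proj v}"
        by (auto simp: dual fun_eq_iff sum_fun_apply vec_scale_apply if_distrib[of "\<lambda>a. a * _"] cong: if_cong)
      show "vec.subspace {v. v = ?proj v}"
      proof (rule vec.subspaceI)
        show "0 \<in> {v. v = ?proj v}" by (simp add: \<phi>_0)
        show "u + v \<in> {v. v = ?proj v}" if "u \<in> {v. v = ?proj v}" "v \<in> {v. v = ?proj v}" for u v
          using that by (simp add: lin vec.scale_left_distrib sum.distrib)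
        show "vec_scale c v \<in> {v. v = ?proj v}" if "v \<in> {v. v = ?proj v}" for c v
        proof -
          have "vec_scale c v = vec_scale c (?proj v)" using that by simp
          also have "\<dots> = ?proj (vec_scale c v)"
            by (simp add: lin vec.scale_sum_right)
          finally show ?thesis by simp
        qed
      qed
    qed
    then show ?thesis using that by blast
  qed
  have U_closed: "op a v \<in> U" if "a \<in> acarrier (schur11 d)" "v \<in> U" for a v
    using that(1) d two that(2)
  proof (induction a arbitrary: v rule: schur11_induct)
    case (add A B)
    then have "op (aadd (schur11 d) A B) v = op A v + op B v"
      using rep by (simp add: op_def is_rep_def mat_vec_add_mat)
    then show ?case using add U_sub by (simp add: vec.subspace_add)
  next
    case (smult c A)
    then have "op (asmul (schur11 d) c A) v = vec_scale c (op A v)"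
      using rep by (simp add: op_def is_rep_def mat_vec_scale_mat)
    then show ?case using smult U_sub by (simp add: vec.subspace_scale)
  next
    case (mult A B)
    then have "op (amul (schur11 d) A B) v = op A (op B v)"
      using rep by (simp add: op_def is_rep_def mat_vec_mult)
    then show ?case using mult by simp
  next
    have gen: "op g v \<in> U" if g: "g \<in> schur_gens d" and v: "v \<in> U" for g v
    proof -
      have "U \<subseteq> {v. op g v \<in> U}"
      proof (subst U_def, rule vec.span_minimal)
        show "x ` {..<N} \<subseteq> {v. op g v \<in> U}"
        proof clarsimp
          fix k assume "k < N"
          then consider "op g (x k) = 0" | l where "l < N" "op g (x k) = x l" using gx[OF g] by blast
          then show "op g (x k) \<in> U"
            by cases (auto simp: U_def intro: vec.span_zero vec.span_base)
        qed
        show "vec.subspace {v. op g v \<in> U}"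
          using U_sub by (intro vec.subspaceI) (auto simp: op_add op_scale op_0 vec.subspace_def)
      qed
      then show ?thesis using v by blast
    qed
    {
      case (idem i)
      then show ?case by (intro gen) (auto simp: schur_gens_def)
    next
      case lower
      then show ?case by (intro gen) (auto simp: schur_gens_def)
    next
      case raise
      then show ?case by (intro gen) (auto simp: schur_gens_def)
    }
  qed
  have W_closed: "op a v \<in> W" if "a \<in> acarrier (schur11 d)" "v \<in> W" for a v
    using that(1) d two that(2)
  proof (induction a arbitrary: v rule: schur11_induct)
    case (add A B)
    then have "op (aadd (schur11 d) A B) v = op A v + op B v"
      using rep by (simp add: op_def is_rep_def mat_vec_add_mat)
    then show ?case using add W_sub by (simp add: vec.subspace_add)
  next
    case (smult c A)
    then have "op (asmul (schur11 d) c A) v = vec_scale c (op A v)"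
      using rep by (simp add: op_def is_rep_def mat_vec_scale_mat)
    then show ?case using smult W_sub by (simp add: vec.subspace_scale)
  next
    case (mult A B)
    then have "op (amul (schur11 d) A B) v = op A (op B v)"
      using rep by (simp add: op_def is_rep_def mat_vec_mult)
    then show ?case using mult by simp
  next
    have gen: "op g v \<in> W" if g: "g \<in> schur_gens d" and v: "v \<in> W" for g v
      using v \<phi>g[OF g] by (fastforce simp: W_def op_def mat_vec_in_kvec)
    {
      case (idem i)
      then show ?case by (intro gen) (auto simp: schur_gens_def)
    next
      case lower
      then show ?case by (intro gen) (auto simp: schur_gens_def)
    next
      case raise
      then show ?case by (intro gen) (auto simp: schur_gens_def)
    }
  qed
  have "W = {0}"
  proof (rule ccontr)
    assume "W \<noteq> {0}"
    have "submodule (schur11 d) n \<rho> U" "submodule (schur11 d) n \<rho> W"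
      using U_sub W_sub U_kvec U_closed W_closed
      by (auto simp: submodule_def subspace_of_iff op_def W_def)
    moreover have "U \<noteq> {0}"
    proof
      assume "U = {0}"
      then have "x 0 = 0" using N(1) unfolding U_def by (metis imageI lessThan_iff singletonD vec.span_base)
      then show False using dual[of 0 0] N(1) \<phi>_0 by simp
    qed
    moreover have "U \<inter> W = {0}"
    proof -
      have "v = 0" if "v \<in> U" "v \<in> W" for v
        using proj_id[OF that(1)] that(2) by (simp add: W_def)
      then show ?thesis using vec.subspace_0[OF U_sub] vec.subspace_0[OF W_sub] by blast
    qed
    moreover have "\<exists>u\<in>U. \<exists>w\<in>W. v = (\<lambda>i. u i + w i)" if "v \<in> kvec n" for v
    proof (intro bexI)
      show "v = (\<lambda>i. ?proj v i + (v - ?proj v) i)" by (simp add: fun_eq_iff plus_fun_apply)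
      have "v - ?proj v \<in> kvec n"
        using that U_kvec proj_U by (intro vec.subspace_diff[OF subspace_kvec]) auto
      moreover have "\<phi> k (v - ?proj v) = 0" if "k < N" for k
        using lin(1)[OF that, of "v - ?proj v" "?proj v"] \<phi>_proj[OF that] by simp
      ultimately show "v - ?proj v \<in> W" by (simp add: W_def)
    qed (rule proj_U)
    ultimately show False
      using indec \<open>W \<noteq> {0}\<close> unfolding indecomposable_def zero_fun_def by blast
  qed
  have expand: "v = ?proj v" if "v \<in> kvec n" for v
  proof -
    have "v - ?proj v \<in> kvec n"
      using that U_kvec proj_U by (intro vec.subspace_diff[OF subspace_kvec]) auto
    moreover have "\<phi> k (v - ?proj v) = 0" if "k < N" for k
      using lin(1)[OF that, of "v - ?proj v" "?proj v"] \<phi>_proj[OF that] by simp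
    ultimately have "v - ?proj v \<in> W" by (simp add: W_def)
    then show ?thesis using \<open>W = {0}\<close> by (simp only: singleton_iff right_minus_eq)
  qed
  have unit_kvec: "unit_vec j \<in> kvec n" if "j < n" for j
    using that by (simp add: unit_vec_def kvec_def)
  have "N \<le> card (unit_vec ` {..<n} :: (nat \<Rightarrow> 'a) set)"
  proof (rule vec.dual_family_card[of N \<phi> x])
    show "x ` {..<N} \<subseteq> vec.span (unit_vec ` {..<n})"
    proof clarify
      fix k assume "k < N"
      then have "x k = (\<Sum>j<n. vec_scale (x k j) (unit_vec j))" by (intro kvec_unit_decomp x_kvec)
      also have "\<dots> \<in> vec.span (unit_vec ` {..<n})"
        by (intro vec.span_sum vec.span_scale vec.span_base) auto
      finally show "x k \<in> vec.span (unit_vec ` {..<n})" .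
    qed
  qed (use lin dual in auto)
  moreover have "card (unit_vec ` {..<n} :: (nat \<Rightarrow> 'a) set) \<le> n"
    using card_image_le[of "{..<n}" unit_vec] by simp
  moreover have "n \<le> card (x ` {..<N})"
  proof (rule vec.dual_family_card[of n "\<lambda>k v. v k" unit_vec])
    show "unit_vec ` {..<n} \<subseteq> vec.span (x ` {..<N})"
    proof clarify
      fix j assume "j < n"
      then show "unit_vec j \<in> vec.span (x ` {..<N})"
        using proj_U[of "unit_vec j"] expand[OF unit_kvec[of j]] unfolding U_def by metis
    qed
  qed (auto simp: unit_vec_def plus_fun_apply vec_scale_apply)
  moreover have "card (x ` {..<N}) \<le> N"
    using card_image_le[of "{..<N}" x] by simp
  ultimately have Nn: "N = n" by simp
  \<comment> \<open>\<open>P\<close> takes coordinates in the thin basis, \<open>Q\<close> has that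
    basis as columns, and \<open>Z g\<close> is the matrix of \<open>g\<close> in it. Its entries
    are 0 or 1 because \<open>g\<close> sends a basis vector to zero or to a basis vector.\<close>
  define P where "P = (\<lambda>k j. if k < n \<and> j < n then \<phi> k (unit_vec j) else 0)"
  define Q where "Q = (\<lambda>j k. if k < n \<and> j < n then x k j else 0)"
  define Z where "Z = (\<lambda>g k j. if g \<in> schur_gens d \<and> k < n \<and> j < n then \<phi> k (op g (x j)) else 0)"
  have "mat_mult n P Q = mat_id n"
  proof (intro ext)
    fix k l
    show "mat_mult n P Q k l = mat_id n k l"
    proof (cases "k < n \<and> l < n")
      case True
      then have "mat_mult n P Q k l = (\<Sum>j<n. \<phi> k (vec_scale (x l j) (unit_vec j)))"
        by (simp add: mat_mult_def P_def Q_def lin Nn mult.commute)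
      also have "\<dots> = \<phi> k (\<Sum>j<n. vec_scale (x l j) (unit_vec j))"
        using True by (simp add: \<phi>_sum Nn)
      also have "\<dots> = \<phi> k (x l)"
        using kvec_unit_decomp[OF x_kvec[of l]] True Nn by simp
      finally show ?thesis using True dual Nn by (simp add: mat_id_def)
    qed (auto simp: mat_mult_def mat_id_def)
  qed
  moreover have "mat_mult n Q P = mat_id n"
  proof (intro ext)
    fix i j
    show "mat_mult n Q P i j = mat_id n i j"
    proof (cases "i < n \<and> j < n")
      case True
      then have "mat_mult n Q P i j = ?proj (unit_vec j) i"
        by (simp add: mat_mult_def P_def Q_def sum_fun_apply vec_scale_apply Nn mult.commute)
      also have "\<dots> = unit_vec j i" using expand[OF unit_kvec[of j]] True by simp
      finally show ?thesis using True by (auto simp: mat_id_def unit_vec_def)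
    qed (auto simp: mat_mult_def mat_id_def)
  qed
  moreover have "mat_mult n P (\<rho> g) = mat_mult n (Z g) P" if g: "g \<in> schur_gens d" for g
  proof (intro ext)
    fix k j
    show "mat_mult n P (\<rho> g) k j = mat_mult n (Z g) P k j"
    proof (cases "k < n \<and> j < n")
      case True
      then have k: "k < N" using Nn by simp
      have "op g (unit_vec j) i = \<rho> g i j" if "i < n" for i
        using that True by (simp add: op_def mat_vec_def unit_vec_def if_distrib[of "\<lambda>a. _ * a"] cong: if_cong)
      then have "mat_mult n P (\<rho> g) k j = (\<Sum>i<n. \<phi> k (vec_scale (op g (unit_vec j) i) (unit_vec i)))"
        using True by (simp add: mat_mult_def P_def lin Nn mult.commute)
      also have "\<dots> = \<phi> k (op g (unit_vec j))"
        using kvec_unit_decomp[of "op g (unit_vec j)" n] k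
        by (simp add: \<phi>_sum[symmetric] op_def mat_vec_in_kvec)
      also have "\<dots> = \<phi> k (op g (?proj (unit_vec j)))"
        using expand[OF unit_kvec[of j]] True by simp
      also have "op g (?proj (unit_vec j)) = (\<Sum>l<N. vec_scale (\<phi> l (unit_vec j)) (op g (x l)))"
      proof -
        have "op g (\<Sum>i\<in>A. f i) = (\<Sum>i\<in>A. op g (f i))" for A and f :: "nat \<Rightarrow> _"
          by (induction A rule: infinite_finite_induct) (simp_all add: op_0 op_add)
        then show ?thesis by (simp add: op_scale)
      qed
      also have "\<phi> k \<dots> = mat_mult n (Z g) P k j"
        using True g by (simp add: \<phi>_sum k lin mat_mult_def Z_def P_def Nn mult.commute)
      finally show ?thesis .
    qed (auto simp: mat_mult_def)
  qed
  moreover have "elementary_datum d n Z"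
  proof -
    have "\<phi> k (op g (x j)) \<in> {0, 1}" if g: "g \<in> schur_gens d" and kj: "k < n" "j < n" for g k j
    proof -
      have kj: "k < N" "j < N" using kj Nn by auto
      consider "op g (x j) = 0" | l where "l < N" "op g (x j) = x l" using gx[OF g kj(2)] by blast
      then show ?thesis by cases (simp_all add: \<phi>_0 kj dual)
    qed
    then show ?thesis by (auto simp: elementary_datum_def Z_def)
  qed
  moreover have "is_mat n P" "is_mat n Q" by (auto simp: is_mat_def P_def Q_def)
  ultimately show ?thesis unfolding realizes_def using N(2) Nn by blast
qed

lemma schur11_finite_rep_type:
  assumes d: "of_nat d = (0 :: 'a::field)" and two: "(2 :: 'a) \<noteq> 0"
  shows "finite_rep_type (schur11 d :: ('a, _) kalg)"
proof -
  define indec where "indec n \<rho> Z \<longleftrightarrow> is_rep (schur11 d) n \<rho> \<and> indecomposable (schur11 d) n \<rho> \<and> realizes d n \<rho> Z"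
    for n \<rho> and Z :: "(bool list \<Rightarrow> bool list \<Rightarrow> 'a) \<Rightarrow> nat \<Rightarrow> nat \<Rightarrow> 'a"
  \<comment> \<open>Only data realized by some indecomposable module are kept, and
    \<open>SOME\<close> selects one such module for each; by \<open>realizes_imp_rep_iso\<close> the
    choice is immaterial up to isomorphism.\<close>
  define T where "T = Sigma {..d + 4} (\<lambda>n. {Z. elementary_datum d n Z \<and> (\<exists>\<rho>. indec n \<rho> Z)})"
  define F where "F = (\<lambda>(n, Z). (n, SOME \<rho>. indec n \<rho> Z)) ` T"
  have chosen: "indec n (SOME \<rho>. indec n \<rho> Z) Z" if "(n, Z) \<in> T" for n Z
  proof -
    have "\<exists>\<rho>. indec n \<rho> Z" using that by (simp add: T_def)
    then show ?thesis by (rule someI_ex)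
  qed
  have "finite T" unfolding T_def
    by (intro finite_SigmaI) (auto intro: finite_subset[OF _ finite_elementary_data])
  then have "finite F" by (simp add: F_def)
  moreover have "\<forall>(n, \<rho>)\<in>F. is_rep (schur11 d) n \<rho> \<and> indecomposable (schur11 d) n \<rho>"
    using chosen by (auto simp: F_def indec_def)
  moreover have "\<exists>(n', \<rho>')\<in>F. rep_iso (schur11 d) n \<rho> n' \<rho>'"
    if rep: "is_rep (schur11 d) n \<rho>" "indecomposable (schur11 d) n \<rho>" for n and \<rho> :: "_ \<Rightarrow> _ \<Rightarrow> _ \<Rightarrow> 'a"
  proof -
    obtain Z where Z: "n \<le> d + 4" "elementary_datum d n Z" "realizes d n \<rho> Z"
      using indecomposable_elementary[OF d two rep] by blast
    then have T: "(n, Z) \<in> T" using rep by (auto simp: T_def indec_def)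
    let ?\<rho> = "SOME \<rho>. indec n \<rho> Z"
    have "is_rep (schur11 d) n ?\<rho>" "realizes d n ?\<rho> Z"
      using chosen[OF T] by (auto simp: indec_def)
    then have "rep_iso (schur11 d) n \<rho> n ?\<rho>"
      using realizes_imp_rep_iso[OF d two rep(1)] Z(3) by blast
    moreover have "(n, ?\<rho>) \<in> F" using T unfolding F_def by force
    ultimately show ?thesis by blast
  qed
  ultimately show ?thesis unfolding finite_rep_type_def by (intro exI[of _ F]) simp
qed

theorem theorem4p1p3:
  fixes p d :: nat
  assumes "CHAR('a::alg_closed_field) = p"
    and "p > 2"
    and "d \<ge> 1"
    and "p dvd d"
  shows "alg_iso (schur11 d :: ('a, bool list \<Rightarrow> bool list \<Rightarrow> 'a) kalg) (atilde d :: ('a, _) kalg)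
         \<and> finite_rep_type (schur11 d :: ('a, bool list \<Rightarrow> bool list \<Rightarrow> 'a) kalg)"
proof -
  have d: "of_nat d = (0 :: 'a)"
    using assms(1,4) by (simp add: of_nat_eq_0_iff_char_dvd)
  have "(of_nat 2 :: 'a) \<noteq> 0"
    using assms(1,2) by (simp only: of_nat_eq_0_iff_char_dvd) (use nat_dvd_not_less in auto)
  then have two: "(2 :: 'a) \<noteq> 0" by simp
  show ?thesis
    using schur11_iso_atilde[OF d assms(3) two] schur11_finite_rep_type[OF d two] by blast
qed

end
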